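(* Let $\mathbb F$ be a field of characteristic $p$ with $p>n$ or $p=0$, let $n\ge 2$ and $0\le k\le n$. Then $$M^n_k=\bigoplus_{j=0}^{k}E_{k,j},\qquad E_{k,j}=\bigoplus_{i=0}^{\min\{k-j,\,n-k\}}E_{k,j,i},$$ where the $E_{k,j}$ ($0\le j\le k$) are the eigenspaces of $\sigma_k$ and the $E_{k,j,i}$ are eigenspaces of $\nu^+_k$. For fixed $k$, the modules $E_{k,j,i}$ with $0\le j\le k$ and $0\le i\le\min\{k-j,n-k\}$ are pairwise non-isomorphic irreducible $\mathbb F B_n$-modules. Furthermore, $E_{k,j,i}$ is isomorphic (as $\mathbb F B_n$-module) to $E_{k',j',i'}$ if and only if $j=j'$ and $i=i'$.
   Context: Let $V=\{\alpha_1,\bar\alpha_1,\dots,\alpha_n,\bar\alpha_n\}$ be a set of $2n$ distinct elements (vertices), with the convention $\bar{\bar\alpha}_i=\alpha_i$. For $0\le k\le n$, $L^n_k$ is the set of $k$-element subsets $x\subseteq V$ with $|x\cap\{\alpha_i,\bar\alpha_i\}|\le 1$ for all $i$ (the $k$-faces of the hyperoctahedron); $L^n=\bigcup_k L^n_k$. For a field $\mathbb F$, $M^n_k$ is the $\mathbb F$-vector space with basis $L^n_k$ (and $M^n_k=0$ if $k<0$ or $k>n$), $M^n=\bigoplus_k M^n_k$. Elements of $M^n$ are written as polynomials in the vertices: a product of distinct vertices forming a face denotes that face, extended bilinearly. Linear maps are defined on faces $x\in L^n_k$ by $\epsilon(x)=\sum_{y\in L^n_{k+1},\,y\supset x}y$,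 $\partial(x)=\sum_{z\in L^n_{k-1},\,z\subset x}z$, $\sigma(x)=\sum_{\gamma\in x}(x\setminus\{\gamma\})\cup\{\bar\gamma\}$; their restrictions are $\epsilon_k:M^n_k\to M^n_{k+1}$, $\partial_k:M^n_k\to M^n_{k-1}$, $\sigma_k:M^n_k\to M^n_k$, and $\nu^+_k=\partial_{k+1}\epsilon_k$, $\nu^-_k=\epsilon_{k-1}\partial_k$ on $M^n_k$. Let $\dot V=\{\alpha_1,\dots,\alpha_n\}$; for disjoint $a,b\subseteq\dot V$ put $[a,b]=\prod_{\alpha\in a}(\alpha+\bar\alpha)\prod_{\beta\in b}(\beta-\bar\beta)\in M^n_{|a|+|b|}$ (with $[\emptyset,\emptyset]=\emptyset$). For $0\le j\le k$, $E_{k,j}$ is the span of all $[a,b]$ with $a,b\subseteq\dot V$ disjoint, $|a|=k-j$, $|b|=j$; $\nu^+_k$ maps $E_{k,j}$ into itself, and $\nu^+_{k,j}$ denotes this restriction. $E_{k,j,i}$ denotes the eigenspace of $\nu^+_{k,j}$ for the eigenvalue $2(k-j+1-i)(n-k-i)$. The hyperoctahedral group $B_n$ is the group of permutations $g$ of $V$ with $\bar\beta^g=\overline{\beta^g}$ for all $\beta\in V$; it acts on faces by $x^g=\{\beta^g:\beta\in x\}$, making each $M^n_k$ an $\mathbb F B_n$-permutation module, and the $E_{k,j,i}$ are $B_n$-invariant. *)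

theory Defs
  imports Complex_Main
    "HOL-Library.Multiset"
    "HOL-Library.Poly_Mapping"
    "HOL-Combinatorics.Permutations"
begin

type_synonym vertex = "nat \<times> bool"

definition alpha :: "nat \<Rightarrow> vertex"
  where "alpha i = (i, True)"

definition bar :: "vertex \<Rightarrow> vertex"
  where "bar v = (fst v, \<not> snd v)"

definition Vdot :: "nat \<Rightarrow> vertex set"
  where "Vdot n = alpha ` {1..n}"

definition V :: "nat \<Rightarrow> vertex set"
  where "V n = Vdot n \<union> bar ` Vdot n"

definition L :: "nat \<Rightarrow> nat \<Rightarrow> vertex set set"
  where "L n k = {x. x \<subseteq> V n \<and> card x = k \<and>
                     (\<forall>i\<in>{1..n}. card (x \<inter> {alpha i, bar (alpha i)}) \<le> 1)}"

definition faces :: "nat \<Rightarrow> vertex set set"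
  where "faces n = (\<Union>k\<le>n. L n k)"

text \<open>
  Polynomials over \<open>'f\<close> with the vertices as indeterminates; a monomial is a multiset of
  vertices. A face is identified with the product of its vertices, so that \<open>M n k\<close> is the
  subspace with basis \<open>face ` L n k\<close>.
\<close>

type_synonym 'f vpoly = "vertex multiset \<Rightarrow>\<^sub>0 'f"

definition scale :: "'f::field \<Rightarrow> 'f vpoly \<Rightarrow> 'f vpoly"
  where "scale c p = Poly_Mapping.single 0 c * p"

global_interpretation vpoly: vector_space "scale :: 'f::field \<Rightarrow> 'f vpoly \<Rightarrow> 'f vpoly"
  by standard (simp_all add: scale_def single_add mult_single algebra_simps flip: mult.assoc)

definition var :: "vertex \<Rightarrow> 'f::field vpoly"
  where "var v = Poly_Mapping.single {#v#} 1"

definition face :: "vertex set \<Rightarrow> 'f::field vpoly"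
  where "face x = (\<Prod>v\<in>x. var v)"

definition face_coeff :: "'f::field vpoly \<Rightarrow> vertex set \<Rightarrow> 'f"
  where "face_coeff p x = Poly_Mapping.lookup p (mset_set x)"

lemma face_eq_single: "finite x \<Longrightarrow> face x = Poly_Mapping.single (mset_set x) 1"
  by (induction x rule: finite_induct) (simp_all add: face_def var_def mult_single)

lemma face_coeff_face:
  "finite x \<Longrightarrow> finite y \<Longrightarrow> face_coeff (face x) y = (if x = y then 1 else 0)"
  by (auto simp: face_coeff_def face_eq_single lookup_single when_def)

definition M :: "nat \<Rightarrow> nat \<Rightarrow> 'f::field vpoly set"
  where "M n k = vpoly.span (face ` L n k)"

text \<open>
  The linear extension to \<open>M\<^sup>n\<close> of a map given on faces. (As a map on all polynomials it
  sends every monomial that is not a face to 0.)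
\<close>

definition face_extend ::
    "nat \<Rightarrow> (vertex set \<Rightarrow> 'f vpoly) \<Rightarrow> 'f::field vpoly \<Rightarrow> 'f vpoly"
  where "face_extend n h p = (\<Sum>x\<in>faces n. scale (face_coeff p x) (h x))"

definition eps :: "nat \<Rightarrow> 'f::field vpoly \<Rightarrow> 'f vpoly"
  where "eps n = face_extend n (\<lambda>x. \<Sum>y | y \<in> L n (card x + 1) \<and> x \<subset> y. face y)"

definition del :: "nat \<Rightarrow> 'f::field vpoly \<Rightarrow> 'f vpoly"
  where "del n = face_extend n (\<lambda>x. \<Sum>z | z \<in> faces n \<and> card z + 1 = card x \<and> z \<subset> x. face z)"

definition sigma :: "nat \<Rightarrow> 'f::field vpoly \<Rightarrow> 'f vpoly"
  where "sigma n = face_extend n (\<lambda>x. \<Sum>\<gamma>\<in>x. face ((x - {\<gamma>}) \<union> {bar \<gamma>}))"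

definition nu_plus :: "nat \<Rightarrow> 'f::field vpoly \<Rightarrow> 'f vpoly"
  where "nu_plus n p = del n (eps n p)"

definition is_direct_sum :: "'f::field vpoly set \<Rightarrow> 'i set \<Rightarrow> ('i \<Rightarrow> 'f vpoly set) \<Rightarrow> bool"
  where "is_direct_sum W I U \<longleftrightarrow>
    (\<forall>i\<in>I. vpoly.subspace (U i)) \<and>
    W = {\<Sum>i\<in>I. u i | u. \<forall>i\<in>I. u i \<in> U i} \<and>
    (\<forall>u. (\<forall>i\<in>I. u i \<in> U i) \<and> (\<Sum>i\<in>I. u i) = 0 \<longrightarrow> (\<forall>i\<in>I. u i = 0))"

definition eigenspace_on ::
    "'f::field vpoly set \<Rightarrow> ('f vpoly \<Rightarrow> 'f vpoly) \<Rightarrow> 'f \<Rightarrow> 'f vpoly set"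
  where "eigenspace_on W f c = {v \<in> W. f v = scale c v}"

text \<open>\<open>U\<close> is an eigenspace, for some eigenvalue, of the restriction of \<open>f\<close> to \<open>W\<close>.\<close>

definition is_eigenspace_on ::
    "'f::field vpoly set \<Rightarrow> ('f vpoly \<Rightarrow> 'f vpoly) \<Rightarrow> 'f vpoly set \<Rightarrow> bool"
  where "is_eigenspace_on W f U \<longleftrightarrow>
    f ` W \<subseteq> W \<and> U \<noteq> {0} \<and> (\<exists>c. U = eigenspace_on W f c)"

definition bracket :: "vertex set \<Rightarrow> vertex set \<Rightarrow> 'f::field vpoly"
  where "bracket a b = (\<Prod>\<alpha>\<in>a. var \<alpha> + var (bar \<alpha>)) * (\<Prod>\<beta>\<in>b. var \<beta> - var (bar \<beta>))"

definition Ekj :: "nat \<Rightarrow> nat \<Rightarrow> nat \<Rightarrow> 'f::field vpoly set"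
  where "Ekj n k j = vpoly.span
    {bracket a b | a b. a \<subseteq> Vdot n \<and> b \<subseteq> Vdot n \<and> a \<inter> b = {} \<and> card a = k - j \<and> card b = j}"

definition Ekji :: "nat \<Rightarrow> nat \<Rightarrow> nat \<Rightarrow> nat \<Rightarrow> 'f::field vpoly set"
  where "Ekji n k j i = eigenspace_on (Ekj n k j) (nu_plus n)
    (of_int (2 * (int k - int j + 1 - int i) * (int n - int k - int i)))"

definition B :: "nat \<Rightarrow> (vertex \<Rightarrow> vertex) set"
  where "B n = {g. g permutes V n \<and> (\<forall>\<beta>\<in>V n. g (bar \<beta>) = bar (g \<beta>))}"

definition act :: "nat \<Rightarrow> (vertex \<Rightarrow> vertex) \<Rightarrow> 'f::field vpoly \<Rightarrow> 'f vpoly"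
  where "act n g = face_extend n (\<lambda>x. face (g ` x))"

definition B_submodule :: "nat \<Rightarrow> 'f::field vpoly set \<Rightarrow> bool"
  where "B_submodule n U \<longleftrightarrow>
    vpoly.subspace U \<and> (\<forall>g\<in>B n. \<forall>v\<in>U. act n g v \<in> U)"

definition B_irreducible :: "nat \<Rightarrow> 'f::field vpoly set \<Rightarrow> bool"
  where "B_irreducible n U \<longleftrightarrow>
    B_submodule n U \<and> U \<noteq> {0} \<and>
    (\<forall>W. B_submodule n W \<and> W \<subseteq> U \<longrightarrow> W = {0} \<or> W = U)"

definition B_isomorphic :: "nat \<Rightarrow> 'f::field vpoly set \<Rightarrow> 'f vpoly set \<Rightarrow> bool"
  where "B_isomorphic n U W \<longleftrightarrow>
    (\<exists>\<phi>. bij_betw \<phi> U W \<and>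
         (\<forall>u\<in>U. \<forall>v\<in>U. \<phi> (u + v) = \<phi> u + \<phi> v) \<and>
         (\<forall>c. \<forall>u\<in>U. \<phi> (scale c u) = scale c (\<phi> u)) \<and>
         (\<forall>g\<in>B n. \<forall>u\<in>U. \<phi> (act n g u) = act n g (\<phi> u)))"

end

theory Submission
  imports Defs
begin

text \<open>
  On \<open>M\<^sub>k\<close> one has \<open>\<partial>\<epsilon> - \<epsilon>\<partial> = 2n - 3k - \<sigma>\<close>, \<open>\<sigma>\<epsilon> = \<epsilon>\<sigma> + \<epsilon>\<close> and \<open>\<partial>\<sigma> = \<sigma>\<partial> + \<partial>\<close>. The bracket
  \<open>[a,b]\<close> is a \<open>\<sigma>\<close>-eigenvector for \<open>|a| - |b|\<close> and the brackets span, so \<open>E\<^sub>k\<^sub>,\<^sub>j\<close> is the full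
  eigenspace for \<open>k - 2j\<close>. For fixed \<open>j\<close> the maps \<open>\<epsilon>\<close>, \<open>\<partial>\<close> act as in a representation of
  \<open>sl\<^sub>2\<close>, and induction on \<open>k\<close> splits \<open>E\<^sub>k\<^sub>,\<^sub>j\<close> into eigenspaces of \<open>\<nu>\<^sup>+ = \<partial>\<epsilon>\<close>; on
  \<open>E\<^sub>k\<^sub>,\<^sub>j\<^sub>,\<^sub>i\<close> the maps \<open>\<epsilon>\<close> and \<open>\<partial>\<close> are mutually inverse up to a nonzero scalar, which gives the
  isomorphisms between different \<open>k\<close>.

  For irreducibility, \<open>M\<^sub>k\<close> is a permutation module, and an element of \<open>E\<^sub>k\<^sub>,\<^sub>j\<^sub>,\<^sub>i\<close> fixed by the
  stabilizer of a face \<open>x\<close> is determined by its coefficient at \<open>x\<close>. As \<open>|B\<^sub>n| = 2\<^sup>nn!\<close> is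
  invertible, averaging shows that every nonzero submodule contains these vectors, normalized to
  \<open>z\<^sub>x\<close>; since \<open>\<langle>u, z\<^sub>x\<rangle> = \<theta> u(x)\<close> with \<open>\<theta> \<noteq> 0\<close>, they span. An isomorphism between different
  eigenspaces in the same \<open>M\<^sub>k\<close> would map \<open>z\<^sub>x\<close> to a multiple of \<open>z'\<^sub>x\<close>, hence vanish by
  orthogonality. For different \<open>k\<close>, the sum of all flips \<open>\<alpha>\<^sub>i \<leftrightarrow> \<alpha>\<^sub>i\<close>-bar, acting as \<open>n - 2j\<close>,
  first forces equal \<open>j\<close>.
\<close>

section \<open>Faces and the operators\<close>

global_interpretation vpoly_pair: vector_space_pair
    "scale :: 'f::field \<Rightarrow> 'f vpoly \<Rightarrow> 'f vpoly" "scale :: 'f \<Rightarrow> 'f vpoly \<Rightarrow> 'f vpoly"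
  by unfold_locales

abbreviation vlinear :: "('f::field vpoly \<Rightarrow> 'f vpoly) \<Rightarrow> bool"
  where "vlinear \<equiv> Vector_Spaces.linear scale scale"

lemma vlinear_iff:
  "vlinear f \<longleftrightarrow> (\<forall>p q. f (p + q) = f p + f q) \<and> (\<forall>c p. f (scale c p) = scale c (f p))"
  using vpoly.vector_space_axioms by (auto simp: Vector_Spaces.linear_iff)

section \<open>Antipodes, faces and free vertices\<close>

lemma bar_bar [simp]: "bar (bar v) = v"
  by (simp add: bar_def)

lemma bar_neq [simp]: "bar v \<noteq> v" "v \<noteq> bar v"
  by (cases v; simp add: bar_def)+

lemma bar_inject [simp]: "bar u = bar v \<longleftrightarrow> u = v"
  by (metis bar_bar)

lemma fst_bar [simp]: "fst (bar v) = fst v"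
  by (simp add: bar_def)

lemma bar_eq_swap: "bar u = v \<longleftrightarrow> u = bar v"
  by auto

lemma fst_eq_iff_bar: "fst u = fst v \<longleftrightarrow> u = v \<or> u = bar v"
  by (cases u; cases v; auto simp: bar_def)

lemma Vdot_eq: "Vdot n = {1..n} \<times> {True}"
  by (auto simp: Vdot_def alpha_def)

lemma V_eq: "V n = {1..n} \<times> UNIV"
  by (auto simp: V_def Vdot_def alpha_def bar_def image_iff)

lemma finite_V [simp, intro!]: "finite (V n)"
  by (simp add: V_eq)

lemma card_V: "card (V n) = 2 * n"
  by (simp add: V_eq card_cartesian_product)

lemma bar_in_V [simp]: "bar v \<in> V n \<longleftrightarrow> v \<in> V n"
  by (cases v) (simp add: V_eq bar_def)

lemma Vdot_subset_V: "Vdot n \<subseteq> V n"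
  by (auto simp: V_def)

text \<open>Trades the count over every pair of antipodes for the index-free condition that no two
  vertices are antipodal; all later arguments about faces use this form.\<close>

lemma L_iff: "x \<in> L n k \<longleftrightarrow> x \<subseteq> V n \<and> card x = k \<and> (\<forall>v\<in>x. bar v \<notin> x)"
proof -
  have "(\<forall>i\<in>{1..n}. card (x \<inter> {alpha i, bar (alpha i)}) \<le> 1) \<longleftrightarrow> (\<forall>v\<in>x. bar v \<notin> x)"
    if x: "x \<subseteq> V n"
  proof (intro iffI ballI notI)
    fix v assume *: "\<forall>i\<in>{1..n}. card (x \<inter> {alpha i, bar (alpha i)}) \<le> 1" "v \<in> x" "bar v \<in> x"
    then have "fst v \<in> {1..n}" using x by (auto simp: V_eq)
    moreover have "x \<inter> {alpha (fst v), bar (alpha (fst v))} = {v, bar v}"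
      using * by (cases v) (auto simp: alpha_def bar_def)
    ultimately have "card {v, bar v} \<le> 1" using bspec[OF *(1), of "fst v"] by simp
    then show False by simp
  next
    fix i assume *: "\<forall>v\<in>x. bar v \<notin> x"
    then have "x \<inter> {alpha i, bar (alpha i)} \<subseteq> {alpha i} \<or> x \<inter> {alpha i, bar (alpha i)} \<subseteq> {bar (alpha i)}"
      by auto
    then show "card (x \<inter> {alpha i, bar (alpha i)}) \<le> 1"
      by (metis card.empty card.insert card_mono empty_iff finite.emptyI finite.insertI One_nat_def)
  qed
  then show ?thesis by (auto simp: L_def)
qed

lemma L_finite: "x \<in> L n k \<Longrightarrow> finite x"
  by (auto simp: L_iff intro: finite_subset)

lemma finite_L [simp, intro!]: "finite (L n k)"
  by (rule finite_subset[of _ "Pow (V n)"]) (auto simp: L_iff)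

text \<open>Two vertices with the same index are equal or antipodal, so \<open>fst\<close> is
  injective on a face. Hence the bound \<open>k \<le> n\<close> in \<open>faces\<close> loses
  nothing.\<close>

lemma face_card_le:
  assumes "x \<subseteq> V n" "\<forall>v\<in>x. bar v \<notin> x"
  shows "card x \<le> n"
proof -
  have "inj_on fst x" using assms by (auto simp: inj_on_def fst_eq_iff_bar)
  then have "card x = card (fst ` x)" by (simp add: card_image)
  also have "\<dots> \<le> card {1..n}" by (rule card_mono) (use assms in \<open>auto simp: V_eq\<close>)
  finally show ?thesis by simp
qed

lemma L_le: "x \<in> L n k \<Longrightarrow> k \<le> n"
  using face_card_le[of x n] by (auto simp: L_iff)

lemma faces_iff: "x \<in> faces n \<longleftrightarrow> x \<subseteq> V n \<and> (\<forall>v\<in>x. bar v \<notin> x)"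
  using face_card_le[of x n] by (auto simp: faces_def L_iff)

lemma faces_finite: "x \<in> faces n \<Longrightarrow> finite x"
  by (auto simp: faces_iff intro: finite_subset)

lemma finite_faces [simp, intro!]: "finite (faces n)"
  by (simp add: faces_def)

lemma L_faces: "x \<in> L n k \<Longrightarrow> x \<in> faces n"
  by (simp add: L_iff faces_iff)

lemma faces_L: "x \<in> faces n \<Longrightarrow> x \<in> L n (card x)"
  by (simp add: L_iff faces_iff)

text \<open>For a face \<open>x\<close> these are exactly the vertices that can be added to it,
  which turns the sums over larger faces into sums over single vertices.\<close>

definition free :: "nat \<Rightarrow> vertex set \<Rightarrow> vertex set"
  where "free n x = {v \<in> V n. v \<notin> x \<and> bar v \<notin> x}"

lemma finite_free [simp, intro!]: "finite (free n x)"
  by (simp add: free_def)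

text \<open>The face and its antipodes are disjoint and of equal size; \<open>free\<close> is what
  they leave of the \<open>2 * n\<close> vertices.\<close>

lemma card_free:
  assumes "x \<in> faces n"
  shows "card (free n x) = 2 * (n - card x)"
proof -
  have x: "x \<subseteq> V n" "\<forall>v\<in>x. bar v \<notin> x" "finite x"
    using assms faces_finite by (auto simp: faces_iff)
  have bx: "bar ` x \<subseteq> V n" "card (bar ` x) = card x"
    using x by (auto simp: card_image inj_on_def)
  have "x \<inter> bar ` x = {}" using x by auto
  then have c: "card (x \<union> bar ` x) = 2 * card x" using x bx by (simp add: card_Un_disjoint)
  have "free n x = V n - (x \<union> bar ` x)" by (auto simp: free_def image_iff bar_eq_swap) (metis bar_bar)+
  then show ?thesis
    using c x bx card_V[of n] by (simp add: card_Diff_subset)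
qed

section \<open>Coefficients, linear extension and the spaces \<open>M n k\<close>\<close>

lemma face_coeff_add [simp]: "face_coeff (p + q) x = face_coeff p x + face_coeff q x"
  by (simp add: face_coeff_def lookup_add)

lemma face_coeff_scale [simp]: "face_coeff (scale c p) x = c * face_coeff p x"
  unfolding face_coeff_def scale_def mult_map_scale_conv_mult[symmetric]
  by (simp add: Poly_Mapping.map.rep_eq when_def)

lemma face_coeff_0 [simp]: "face_coeff 0 x = 0"
  by (simp add: face_coeff_def)

lemma face_coeff_diff [simp]: "face_coeff (p - q) x = face_coeff p x - face_coeff q x"
  by (simp add: face_coeff_def lookup_minus)

lemma face_coeff_sum [simp]: "face_coeff (sum f A) x = (\<Sum>i\<in>A. face_coeff (f i) x)"
  by (induction A rule: infinite_finite_induct) auto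

lemma vlinear_face_extend: "vlinear (face_extend n h)"
  by (simp add: vlinear_iff face_extend_def vpoly.scale_left_distrib sum.distrib vpoly.scale_sum_right)

lemma face_extend_face:
  assumes "x \<in> faces n" shows "face_extend n h (face x) = h x"
proof -
  have "face_extend n h (face x) = (\<Sum>y\<in>faces n. if x = y then h y else 0)"
    unfolding face_extend_def using assms faces_finite
    by (intro sum.cong) (auto simp: face_coeff_face)
  then show ?thesis using assms by simp
qed

lemma vlinear_eps: "vlinear (eps n)" and vlinear_del: "vlinear (del n)"
  and vlinear_sigma: "vlinear (sigma n)" and vlinear_act: "vlinear (act n g)"
  by (simp_all add: eps_def del_def sigma_def act_def vlinear_face_extend)

lemma vlinear_nu_plus: "vlinear (nu_plus n)"
  using vlinear_eps[of n] vlinear_del[of n] unfolding vlinear_iff nu_plus_def by metis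

lemma vlinear_simps:
  assumes "vlinear f"
  shows "f (p + q) = f p + f q" "f (scale c p) = scale c (f p)" "f (p - q) = f p - f q"
    "f 0 = 0" "f (sum g A) = (\<Sum>i\<in>A. f (g i))"
  using vpoly_pair.linear_add[OF assms] vpoly_pair.linear_scale[OF assms]
    vpoly_pair.linear_diff[OF assms] vpoly_pair.linear_0[OF assms]
    vpoly_pair.linear_sum[OF assms] by auto

lemmas op_simps [simp] =
  vlinear_simps[OF vlinear_eps] vlinear_simps[OF vlinear_del] vlinear_simps[OF vlinear_sigma]
  vlinear_simps[OF vlinear_act] vlinear_simps[OF vlinear_nu_plus]

lemma subspace_M: "vpoly.subspace (M n k)"
  by (simp add: M_def)

lemma face_in_M: "x \<in> L n k \<Longrightarrow> face x \<in> M n k"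
  by (simp add: M_def vpoly.span_base)

lemma M_expand:
  assumes "p \<in> M n k"
  shows "p = (\<Sum>x\<in>L n k. scale (face_coeff p x) (face x))"
  using assms unfolding M_def
proof (induction rule: vpoly.span_induct_alt)
  case base
  then show ?case by simp
next
  case (step c p q)
  then obtain x where x: "x \<in> L n k" "p = face x" by auto
  have "(\<Sum>y\<in>L n k. scale (face_coeff p y) (face y)) = (\<Sum>y\<in>L n k. if x = y then p else 0)"
    using x L_finite by (intro sum.cong) (auto simp: face_coeff_face)
  also have "\<dots> = p" using x by simp
  finally have "scale c (\<Sum>y\<in>L n k. scale (face_coeff p y) (face y)) = scale c p" by simp
  then show ?case
    using step.IH by (simp add: vpoly.scale_left_distrib sum.distrib vpoly.scale_sum_right)
qed

lemma M_coeff_eq_0: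
  assumes "p \<in> M n k" "finite x" "x \<notin> L n k"
  shows "face_coeff p x = 0"
  using assms(1) unfolding M_def
proof (induction rule: vpoly.span_induct_alt)
  case (step c y z)
  then obtain w where "w \<in> L n k" "y = face w" by auto
  then show ?case using step.IH assms L_finite[of w n k] by (auto simp: face_coeff_face)
qed simp

lemma M_eqI:
  assumes "p \<in> M n k" "q \<in> M n k" "\<And>x. x \<in> L n k \<Longrightarrow> face_coeff p x = face_coeff q x"
  shows "p = q"
  using M_expand[OF assms(1)] M_expand[OF assms(2)] assms(3) by (metis (no_types, lifting) sum.cong)

lemma M_linear_eq:
  assumes "vlinear f" "vlinear g" "\<And>x. x \<in> L n k \<Longrightarrow> f (face x) = g (face x)" "p \<in> M n k"
  shows "f p = g p"
  using vpoly_pair.linear_eq_on[OF assms(1,2) assms(4)[unfolded M_def]] assms(3) by auto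

lemma M_linear_in:
  assumes "vlinear f" "\<And>x. x \<in> L n k \<Longrightarrow> f (face x) \<in> U" "vpoly.subspace U" "p \<in> M n k"
  shows "f p \<in> U"
  using assms(4) unfolding M_def
  by (induction rule: vpoly.span_induct_alt)
    (auto simp: vlinear_simps[OF assms(1)]
      intro!: vpoly.subspace_0 vpoly.subspace_add vpoly.subspace_scale assms)

lemma M_eq_0:
  assumes "p \<in> M n k" "n < k" shows "p = 0"
  using M_expand[OF assms(1)] L_le[of _ n k] assms(2) by (metis empty_iff equals0I linorder_not_less sum.empty)

section \<open>The operators on single faces\<close>

lemma insert_free_faces: "x \<in> faces n \<Longrightarrow> v \<in> free n x \<Longrightarrow> insert v x \<in> faces n"
  by (auto simp: faces_iff free_def bar_eq_swap)

lemma insert_free_L: "x \<in> L n k \<Longrightarrow> v \<in> free n x \<Longrightarrow> insert v x \<in> L n (Suc k)"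
  using L_finite[of x n k] by (auto simp: L_iff free_def bar_eq_swap)

lemma remove_faces: "x \<in> faces n \<Longrightarrow> x - y \<in> faces n"
  by (auto simp: faces_iff)

lemma remove_L: "x \<in> L n (Suc k) \<Longrightarrow> u \<in> x \<Longrightarrow> x - {u} \<in> L n k"
  using L_finite[of x n "Suc k"] by (auto simp: L_iff)

lemma flip_faces: "x \<in> faces n \<Longrightarrow> u \<in> x \<Longrightarrow> insert (bar u) (x - {u}) \<in> faces n"
  by (auto simp: faces_iff)

lemma flip_L: "x \<in> L n k \<Longrightarrow> u \<in> x \<Longrightarrow> insert (bar u) (x - {u}) \<in> L n k"
  using L_finite[of x n k] card_Suc_Diff1[of x u] by (auto simp: L_iff)

lemma eps_face:
  assumes "x \<in> faces n"
  shows "eps n (face x) = (\<Sum>v\<in>free n x. face (insert v x))"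
proof -
  have fin: "finite x" using assms faces_finite by blast
  have inj: "inj_on (\<lambda>v. insert v x) (free n x)"
    by (rule inj_onI) (use free_def in auto)
  have "{y. y \<in> L n (card x + 1) \<and> x \<subset> y} = (\<lambda>v. insert v x) ` free n x"
  proof (intro equalityI subsetI)
    fix y assume y: "y \<in> {y. y \<in> L n (card x + 1) \<and> x \<subset> y}"
    then have fy: "finite y" using L_finite by auto
    then have "card (y - x) = 1" using y fin by (auto simp: L_iff card_Diff_subset)
    then obtain v where v: "y - x = {v}" by (auto simp: card_1_singleton_iff)
    then have "y = insert v x" using y by auto
    moreover have "v \<in> free n x" using v y \<open>y = insert v x\<close> by (auto simp: free_def L_iff bar_eq_swap)
    ultimately show "y \<in> (\<lambda>v. insert v x) ` free n x" by auto
  next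
    fix y assume "y \<in> (\<lambda>v. insert v x) ` free n x"
    then obtain v where v: "v \<in> free n x" "y = insert v x" by auto
    then show "y \<in> {y. y \<in> L n (card x + 1) \<and> x \<subset> y}"
      using insert_free_L[OF faces_L[OF assms]] by (auto simp: free_def)
  qed
  then show ?thesis
    by (simp add: eps_def face_extend_face[OF assms] sum.reindex[OF inj])
qed

lemma del_face:
  assumes "x \<in> faces n"
  shows "del n (face x) = (\<Sum>u\<in>x. face (x - {u}))"
proof -
  have fin: "finite x" using assms faces_finite by blast
  have inj: "inj_on (\<lambda>u. x - {u}) x" by (rule inj_onI) auto
  have "{z. z \<in> faces n \<and> card z + 1 = card x \<and> z \<subset> x} = (\<lambda>u. x - {u}) ` x"
  proof (intro equalityI subsetI)
    fix z assume z: "z \<in> {z. z \<in> faces n \<and> card z + 1 = card x \<and> z \<subset> x}"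
    then have "card (x - z) = 1" using fin by (auto simp: card_Diff_subset faces_finite)
    then obtain u where u: "x - z = {u}" by (auto simp: card_1_singleton_iff)
    then have "z = x - {u}" "u \<in> x" using z by auto
    then show "z \<in> (\<lambda>u. x - {u}) ` x" by auto
  next
    fix z assume "z \<in> (\<lambda>u. x - {u}) ` x"
    then show "z \<in> {z. z \<in> faces n \<and> card z + 1 = card x \<and> z \<subset> x}"
      using remove_faces[OF assms] fin card_Suc_Diff1[OF fin] by auto
  qed
  then show ?thesis
    by (simp add: del_def face_extend_face[OF assms] sum.reindex[OF inj])
qed

lemma sigma_face:
  assumes "x \<in> faces n"
  shows "sigma n (face x) = (\<Sum>u\<in>x. face (insert (bar u) (x - {u})))"
  by (simp add: sigma_def face_extend_face[OF assms])

lemma act_face: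
  assumes "x \<in> faces n" shows "act n g (face x) = face (g ` x)"
  by (simp add: act_def face_extend_face[OF assms])

lemma eps_M: "p \<in> M n k \<Longrightarrow> eps n p \<in> M n (Suc k)"
  by (rule M_linear_in[OF vlinear_eps _ subspace_M])
    (auto simp: eps_face L_faces intro!: vpoly.subspace_sum subspace_M face_in_M insert_free_L)

lemma del_M: "p \<in> M n (Suc k) \<Longrightarrow> del n p \<in> M n k"
  by (rule M_linear_in[OF vlinear_del _ subspace_M])
    (auto simp: del_face L_faces intro!: vpoly.subspace_sum subspace_M face_in_M remove_L)

lemma del_M_0: "p \<in> M n 0 \<Longrightarrow> del n p = 0"
  by (rule M_linear_eq[of _ "\<lambda>_. 0"])
    (auto simp: vlinear_iff del_face L_faces L_iff dest: finite_subset[OF _ finite_V])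

lemma sigma_M: "p \<in> M n k \<Longrightarrow> sigma n p \<in> M n k"
  by (rule M_linear_in[OF vlinear_sigma _ subspace_M])
    (auto simp: sigma_face L_faces intro!: vpoly.subspace_sum subspace_M face_in_M flip_L)

section \<open>Commutation relations\<close>

lemma free_remove:
  assumes "x \<in> faces n" "u \<in> x"
  shows "free n (x - {u}) = insert u (insert (bar u) (free n x))"
  using assms by (auto simp: free_def faces_iff bar_eq_swap)

lemma free_flip:
  assumes "x \<in> faces n" "u \<in> x"
  shows "free n (insert (bar u) (x - {u})) = free n x"
  using assms by (auto simp: free_def faces_iff bar_eq_swap)

lemma free_bar: "bar v \<in> free n x \<longleftrightarrow> v \<in> free n x"
  by (auto simp: free_def)

lemma sum_const_scale: "(\<Sum>x\<in>A. p) = scale (of_nat (card A)) (p :: 'f::field vpoly)"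
  by (induction A rule: infinite_finite_induct)
    (auto simp: vpoly.scale_left_distrib simp del: sum_constant)

text \<open>Adding a free \<open>v\<close> and removing it again returns \<open>x\<close>, once for
  each of the \<open>2 * (n - k)\<close> free vertices; removing another vertex gives an
  exchange.\<close>

lemma del_eps_face:
  assumes "x \<in> L n k"
  shows "del n (eps n (face x :: 'f::field vpoly)) = scale (of_nat (2 * (n - k))) (face x)
    + (\<Sum>v\<in>free n x. \<Sum>u\<in>x. face (insert v (x - {u})))"
proof -
  have x: "x \<in> faces n" "finite x" "card x = k" using assms L_faces L_finite by (auto simp: L_iff)
  have "del n (face (insert v x) :: 'f vpoly) = face x + (\<Sum>u\<in>x. face (insert v (x - {u})))" if v: "v \<in> free n x" for v
  proof -
    have "v \<notin> x" using v by (simp add: free_def)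
    then have "insert v x - {v} = x" "\<And>u. u \<in> x \<Longrightarrow> insert v x - {u} = insert v (x - {u})" by auto
    then show ?thesis using insert_free_faces[OF x(1) v] x(2) \<open>v \<notin> x\<close>
      by (simp add: del_face)
  qed
  then show ?thesis using x
    by (simp add: eps_face sum.distrib sum_const_scale card_free del: sum_constant)
qed

text \<open>Once \<open>u\<close> is removed, the vertices that can be added are \<open>u\<close>,
  \<open>bar u\<close> and those free for \<open>x\<close>; they give the multiple of
  \<open>x\<close>, the flips and the exchanges. The exchange sum agrees with the one in
  \<open>del_eps_face\<close>.\<close>

lemma eps_del_face:
  assumes "x \<in> L n k"
  shows "eps n (del n (face x :: 'f::field vpoly)) = scale (of_nat k) (face x) + sigma n (face x)
    + (\<Sum>v\<in>free n x. \<Sum>u\<in>x. face (insert v (x - {u})))"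
proof -
  have x: "x \<in> faces n" "finite x" "card x = k" using assms L_faces L_finite by (auto simp: L_iff)
  have "eps n (face (x - {u}) :: 'f vpoly) = face x + face (insert (bar u) (x - {u}))
      + (\<Sum>v\<in>free n x. face (insert v (x - {u})))" if u: "u \<in> x" for u
  proof -
    have "u \<notin> insert (bar u) (free n x)" "bar u \<notin> free n x" using u by (auto simp: free_def)
    moreover have "insert u (x - {u}) = x" using u by auto
    ultimately show ?thesis
      by (simp add: eps_face remove_faces x free_remove[OF x(1) u] add.assoc)
  qed
  then show ?thesis using x
    by (simp add: del_face sum.distrib sum_const_scale sigma_face sum.swap[of _ x] del: sum_constant)
qed

text \<open>The exchange sums cancel, and the multiples of \<open>x\<close> combine to
  \<open>2 * (n - k) - k\<close>.\<close>

lemma del_eps_commutator: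
  fixes p :: "'f::field vpoly"
  assumes "p \<in> M n k"
  shows "del n (eps n p) = eps n (del n p) + scale (2 * of_nat n - 3 * of_nat k) p - sigma n p"
proof -
  have "vlinear (\<lambda>p. del n (eps n p))"
    "vlinear (\<lambda>p. eps n (del n p) + scale (2 * of_nat n - 3 * of_nat k) p - sigma n p)"
    by (simp_all add: vlinear_iff algebra_simps vpoly.scale_right_distrib vpoly.scale_right_diff_distrib mult.commute)
  then show ?thesis
  proof (rule M_linear_eq[OF _ _ _ assms])
    fix x assume x: "x \<in> L n k"
    then have "k \<le> n" by (rule L_le)
    then show "del n (eps n (face x)) =
        eps n (del n (face x)) + scale (2 * of_nat n - 3 * of_nat k) (face x) - sigma n (face x)"
      by (simp add: del_eps_face[OF x] eps_del_face[OF x] of_nat_diff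
          vpoly.scale_left_diff_distrib flip: vpoly.scale_left_distrib)
        (simp add: algebra_simps flip: vpoly.scale_left_distrib)
  qed
qed

text \<open>Flips of old vertices commute with adding a new one. The surplus \<open>eps n p\<close>
  comes from flipping the vertex just added.\<close>

lemma sigma_eps:
  fixes p :: "'f::field vpoly"
  assumes "p \<in> M n k"
  shows "sigma n (eps n p) = eps n (sigma n p) + eps n p"
proof -
  have "vlinear (\<lambda>p. sigma n (eps n p))" "vlinear (\<lambda>p. eps n (sigma n p) + eps n p)"
    by (simp_all add: vlinear_iff algebra_simps vpoly.scale_right_distrib)
  then show ?thesis
  proof (rule M_linear_eq[OF _ _ _ assms])
    fix x assume "x \<in> L n k"
    then have x: "x \<in> faces n" "finite x" using L_faces L_finite by auto
    have *: "sigma n (face (insert v x) :: 'f vpoly) = face (insert (bar v) x)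
        + (\<Sum>u\<in>x. face (insert v (insert (bar u) (x - {u}))))" if v: "v \<in> free n x" for v
    proof -
      have "v \<notin> x" using v by (simp add: free_def)
      then have "insert v x - {v} = x"
        "\<And>u. u \<in> x \<Longrightarrow> insert (bar u) (insert v x - {u}) = insert v (insert (bar u) (x - {u}))" by auto
      then show ?thesis using insert_free_faces[OF x(1) v] x(2) \<open>v \<notin> x\<close>
        by (simp add: sigma_face)
    qed
    \<comment> \<open>\<open>bar\<close> permutes the free vertices, so flipping the added vertex
      reproduces \<open>eps n (face x)\<close>.\<close>
    have "(\<Sum>v\<in>free n x. face (insert (bar v) x) :: 'f vpoly) = (\<Sum>v\<in>free n x. face (insert v x))"
      by (rule sum.reindex_bij_witness[of _ bar bar]) (auto simp: free_bar)
    moreover have "eps n (sigma n (face x :: 'f vpoly)) = (\<Sum>u\<in>x. \<Sum>v\<in>free n x. face (insert v (insert (bar u) (x - {u}))))"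
      using x by (simp add: sigma_face eps_face flip_faces free_flip)
    moreover have "sigma n (eps n (face x :: 'f vpoly)) = (\<Sum>v\<in>free n x. face (insert (bar v) x)
        + (\<Sum>u\<in>x. face (insert v (insert (bar u) (x - {u})))))"
      using x * by (simp add: eps_face)
    ultimately show "sigma n (eps n (face x)) = eps n (sigma n (face x)) + eps n (face x :: 'f vpoly)"
      by (simp add: eps_face x sum.distrib sum.swap[of _ x])
  qed
qed

lemma sigma_del:
  fixes p :: "'f::field vpoly"
  assumes "p \<in> M n k"
  shows "sigma n (del n p) = del n (sigma n p) - del n p"
proof -
  have "vlinear (\<lambda>p. sigma n (del n p) + del n p)" "vlinear (\<lambda>p. del n (sigma n p))"
    by (simp_all add: vlinear_iff algebra_simps vpoly.scale_right_distrib)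
  \<comment> \<open>In this form both sides are sums of faces: on the right, removing the vertex
    just flipped gives \<open>del n p\<close>, and the other removals commute with the flip.\<close>
  then have "sigma n (del n p) + del n p = del n (sigma n p)"
  proof (rule M_linear_eq[OF _ _ _ assms])
    fix x assume "x \<in> L n k"
    then have x: "x \<in> faces n" "finite x" using L_faces L_finite by auto
    have *: "del n (face (insert (bar u) (x - {u})) :: 'f vpoly) = face (x - {u})
        + (\<Sum>w\<in>x - {u}. face (insert (bar u) (x - {u} - {w})))" if u: "u \<in> x" for u
    proof -
      have b: "bar u \<notin> x - {u}" using u x by (auto simp: faces_iff)
      then have "insert (bar u) (x - {u}) - {bar u} = x - {u}"
        "\<And>w. w \<in> x - {u} \<Longrightarrow> insert (bar u) (x - {u}) - {w} = insert (bar u) (x - {u} - {w})" by auto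
      then show ?thesis using flip_faces[OF x(1) u] x(2) b
        by (auto simp del: insert_Diff_single simp add: del_face intro!: sum.cong)
    qed
    have "sigma n (del n (face x :: 'f vpoly))
        = (\<Sum>w\<in>x. \<Sum>u\<in>x - {w}. face (insert (bar u) (x - {w} - {u})))"
      using x by (simp add: sigma_face del_face remove_faces)
    \<comment> \<open>Both double sums run over ordered pairs of distinct vertices of
      \<open>x\<close>, taken in opposite order.\<close>
    also have "\<dots> = (\<Sum>u\<in>x. \<Sum>w\<in>x - {u}. face (insert (bar u) (x - {u} - {w})))"
      unfolding sum.Sigma[OF x(2) ballI[OF finite_Diff[OF x(2)]]]
      by (rule sum.reindex_bij_witness[of _ prod.swap prod.swap]) (auto intro!: arg_cong[where f = face])
    finally have 1: "sigma n (del n (face x :: 'f vpoly)) = \<dots>" .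
    have "del n (sigma n (face x :: 'f vpoly)) = (\<Sum>u\<in>x. face (x - {u}) +
        (\<Sum>w\<in>x - {u}. face (insert (bar u) (x - {u} - {w}))))"
      using x * by (simp add: sigma_face)
    then show "sigma n (del n (face x)) + del n (face x) = del n (sigma n (face x :: 'f vpoly))"
      unfolding 1 by (simp add: sum.distrib del_face x add.commute)
  qed
  then show ?thesis by (simp add: algebra_simps)
qed

section \<open>Products of faces and eigenspaces of \<open>\<sigma>\<close>\<close>

text \<open>Keeping track of the indices in use guarantees that multiplying by a vertex of a new
  index turns faces into faces.\<close>

definition MS :: "nat \<Rightarrow> nat set \<Rightarrow> nat \<Rightarrow> 'f::field vpoly set"
  where "MS n I k = vpoly.span (face ` {x \<in> L n k. fst ` x \<subseteq> I})"

lemma subspace_MS: "vpoly.subspace (MS n I k)"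
  by (simp add: MS_def)

lemma face_in_MS: "x \<in> L n k \<Longrightarrow> fst ` x \<subseteq> I \<Longrightarrow> face x \<in> MS n I k"
  by (auto simp: MS_def intro: vpoly.span_base)

lemma MS_M: "p \<in> MS n I k \<Longrightarrow> p \<in> M n k"
  unfolding MS_def M_def using vpoly.span_mono[of "face ` {x \<in> L n k. fst ` x \<subseteq> I}" "face ` L n k"] by auto

lemma MS_linear_eq:
  assumes "vlinear f" "vlinear g" "p \<in> MS n I k"
    "\<And>x. x \<in> L n k \<Longrightarrow> fst ` x \<subseteq> I \<Longrightarrow> f (face x) = g (face x)"
  shows "f p = g p"
  using vpoly_pair.linear_eq_on[OF assms(1,2) assms(3)[unfolded MS_def]] assms(4) by auto

lemma MS_linear_in:
  assumes "vlinear f" "vpoly.subspace U" "p \<in> MS n I k"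
    "\<And>x. x \<in> L n k \<Longrightarrow> fst ` x \<subseteq> I \<Longrightarrow> f (face x) \<in> U"
  shows "f p \<in> U"
  using assms(3) unfolding MS_def
  by (induction rule: vpoly.span_induct_alt)
    (auto simp: vlinear_simps[OF assms(1)]
      intro!: vpoly.subspace_0 vpoly.subspace_add vpoly.subspace_scale assms)

lemma vlinear_times: "vlinear (\<lambda>q. p * q)"
  by (simp add: vlinear_iff scale_def algebra_simps)

lemma vlinear_compose: "vlinear f \<Longrightarrow> vlinear g \<Longrightarrow> vlinear (\<lambda>q. f (g q))"
  unfolding vlinear_iff by metis

lemma vlinear_add: "vlinear f \<Longrightarrow> vlinear g \<Longrightarrow> vlinear (\<lambda>q. f q + g q)"
  by (simp add: vlinear_iff vpoly.scale_right_distrib algebra_simps)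

lemma vlinear_id: "vlinear (\<lambda>q. q)"
  by (simp add: vlinear_iff)

lemma scale_mult_right: "p * scale c q = scale c (p * q)" for p :: "'f::field vpoly"
  by (simp add: scale_def mult.left_commute)

lemma var_times_face: "finite x \<Longrightarrow> v \<notin> x \<Longrightarrow> var v * face x = face (insert v x)"
  by (simp add: face_def)

lemma insert_L:
  assumes "x \<in> L n k" "v \<in> V n" "fst v \<notin> fst ` x"
  shows "insert v x \<in> L n (Suc k)"
proof -
  have "v \<notin> x" "bar v \<notin> x" using assms(3) by (metis fst_bar imageI)+
  then show ?thesis using insert_free_L[OF assms(1), of v] assms(2) by (simp add: free_def)
qed

text \<open>For a factor of new index the operators obey a product rule: \<open>sigma\<close> and
  \<open>del\<close> act on the new vertex as \<open>v\<close> to \<open>bar v\<close> and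
  \<open>v\<close> to 1, and otherwise on the remaining factor.\<close>

lemma var_times:
  fixes q :: "'f::field vpoly"
  assumes q: "q \<in> MS n I k" and v: "v \<in> V n" "fst v \<notin> I"
  shows "var v * q \<in> MS n (insert (fst v) I) (Suc k)"
    and "sigma n (var v * q) = var (bar v) * q + var v * sigma n q"
    and "del n (var v * q) = q + var v * del n q"
proof -
  have *: "var w * face x = (face (insert w x) :: 'f vpoly)" "insert w x \<in> L n (Suc k)" "insert w x \<in> faces n"
      "x \<in> faces n" "finite x"
    if "x \<in> L n k" "fst ` x \<subseteq> I" "w \<in> V n" "fst w \<notin> I" for x w
    using that L_finite[of x n k] L_faces[of x n k] insert_L[of x n k w] L_faces[of "insert w x" n "Suc k"]
    by (auto intro!: var_times_face)
  show "var v * q \<in> MS n (insert (fst v) I) (Suc k)"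
  proof (rule MS_linear_in[OF vlinear_times subspace_MS q])
    fix x assume x: "x \<in> L n k" "fst ` x \<subseteq> I"
    show "var v * face x \<in> (MS n (insert (fst v) I) (Suc k) :: 'f vpoly set)"
      unfolding *(1)[OF x v] using *(2)[OF x v] x(2) by (intro face_in_MS) auto
  qed
  show "sigma n (var v * q) = var (bar v) * q + var v * sigma n q"
  proof (rule MS_linear_eq[OF _ _ q])
    show "vlinear (\<lambda>q. sigma n (var v * q))" "vlinear (\<lambda>q. var (bar v) * q + var v * sigma n q)"
      by (intro vlinear_compose[OF vlinear_sigma] vlinear_add vlinear_times
          vlinear_compose[OF vlinear_times vlinear_sigma])+
    fix x assume x: "x \<in> L n k" "fst ` x \<subseteq> I"
    have "v \<notin> x" using x v by auto
    have "face (insert (bar u) (insert v x - {u})) = (var v * face (insert (bar u) (x - {u})) :: 'f vpoly)" if "u \<in> x" for u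
    proof -
      have "fst u \<noteq> fst v" using that x v by auto
      then have "v \<notin> insert (bar u) (x - {u})" "u \<noteq> v" using \<open>v \<notin> x\<close> by auto
      moreover have "insert (bar u) (insert v x - {u}) = insert v (insert (bar u) (x - {u}))"
        using \<open>u \<noteq> v\<close> by auto
      ultimately show ?thesis using *(5)[OF x v] by (simp add: var_times_face)
    qed
    then show "sigma n (var v * face x) = var (bar v) * face x + var v * sigma n (face x :: 'f vpoly)"
      using *[OF x v] *(1)[OF x, of "bar v"] v \<open>v \<notin> x\<close>
      by (simp add: sigma_face sum_distrib_left)
  qed
  show "del n (var v * q) = q + var v * del n q"
  proof (rule MS_linear_eq[OF _ _ q])
    show "vlinear (\<lambda>q. del n (var v * q))" "vlinear (\<lambda>q. q + var v * del n q)"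
      by (intro vlinear_compose[OF vlinear_del] vlinear_add vlinear_id vlinear_times
          vlinear_compose[OF vlinear_times vlinear_del])+
    fix x assume x: "x \<in> L n k" "fst ` x \<subseteq> I"
    have "v \<notin> x" using x v by auto
    have "face (insert v x - {u}) = (var v * face (x - {u}) :: 'f vpoly)" if "u \<in> x" for u
    proof -
      have "insert v x - {u} = insert v (x - {u})" using \<open>v \<notin> x\<close> that by auto
      then show ?thesis using *(5)[OF x v] \<open>v \<notin> x\<close> by (simp add: var_times_face)
    qed
    then show "del n (var v * face x) = face x + var v * del n (face x :: 'f vpoly)"
      using *[OF x v] v \<open>v \<notin> x\<close> by (simp add: del_face sum_distrib_left)
  qed
qed

text \<open>
  Contracting a product with a vertex of one factor recovers the other factor, so products of
  linear forms in disjoint variables are nonzero.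
\<close>

definition contract :: "nat \<Rightarrow> vertex \<Rightarrow> 'f::field vpoly \<Rightarrow> 'f vpoly"
  where "contract n v = face_extend n (\<lambda>x. if v \<in> x then face (x - {v}) else 0)"

lemma vlinear_contract: "vlinear (contract n v)"
  by (simp add: contract_def vlinear_face_extend)

lemma contract_var_times:
  assumes q: "q \<in> MS n I k" and v: "v \<in> V n" "w \<in> V n" "fst v \<notin> I" "fst w \<notin> I"
  shows "contract n v (var w * q) = (if v = w then q else 0)"
proof (rule MS_linear_eq[OF vlinear_compose[OF vlinear_contract vlinear_times] _ q])
  show "vlinear (\<lambda>q. if v = w then q else 0)" by (simp add: vlinear_iff)
  fix x assume x: "x \<in> L n k" "fst ` x \<subseteq> I"
  have "v \<notin> x" "w \<notin> x" "fst w \<notin> fst ` x" using x v by auto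
  then show "contract n v (var w * face x) = (if v = w then face x else 0)"
    using L_finite[OF x(1)] L_faces[OF insert_L[OF x(1) v(2)]]
    by (simp add: var_times_face contract_def face_extend_face)
qed

section \<open>Brackets as \<open>sigma\<close>-eigenvectors that span \<open>M n k\<close>\<close>

lemma bracket_insert:
  assumes "finite a" "v \<notin> a"
  shows "bracket (insert v a) b = (var v + var (bar v)) * bracket a b"
    and "bracket b (insert v a) = (var v - var (bar v)) * bracket b a"
  using assms by (simp_all add: bracket_def algebra_simps)

text \<open>By the product rule every factor contributes its own eigenvalue: 1 for a sum of
  antipodes, -1 for a difference. The factors of \<open>b\<close> are built up first, then those of
  \<open>a\<close>.\<close>

lemma bracket_properties:
  assumes "a \<subseteq> Vdot n" "b \<subseteq> Vdot n" "a \<inter> b = {}"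
  shows "(bracket a b :: 'f::field vpoly) \<in> MS n (fst ` (a \<union> b)) (card a + card b)"
    and "sigma n (bracket a b :: 'f vpoly) = scale (of_int (int (card a) - int (card b))) (bracket a b)"
proof -
  have inj: "inj_on fst (Vdot n)" by (auto simp: inj_on_def Vdot_eq)
  have fin: "finite a" "finite b" using assms finite_subset[OF _ finite_subset[OF Vdot_subset_V finite_V]] by auto
  have B: "(bracket {} b :: 'f vpoly) \<in> MS n (fst ` b) (card b) \<and>
      sigma n (bracket {} b :: 'f vpoly) = scale (of_int (- int (card b))) (bracket {} b)"
    using fin(2) assms(2)
  proof (induction b rule: finite_induct)
    case empty
    have "bracket {} {} = (face {} :: 'f vpoly)" "{} \<in> L n 0" by (simp_all add: bracket_def face_def L_iff)
    then show ?case using L_faces[of "{}" n 0] sigma_face[of "{}" n, where 'a = 'f]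
      by (auto intro: face_in_MS)
  next
    case (insert v b)
    then have v: "v \<in> V n" "fst v \<notin> fst ` b"
      using Vdot_subset_V inj_on_image_mem_iff[OF inj, of v b] by auto
    then have bv: "bar v \<in> V n" "fst (bar v) \<notin> fst ` b" by auto
    have "(bracket {} b :: 'f vpoly) \<in> MS n (fst ` b) (card b)"
      "sigma n (bracket {} b :: 'f vpoly) = scale (of_int (- int (card b))) (bracket {} b)"
      using insert by auto
    note q = this(2) var_times[OF this(1) v] var_times[OF this(1) bv]
    show ?case
    proof
      show "(bracket {} (insert v b) :: 'f vpoly) \<in> MS n (fst ` insert v b) (card (insert v b))"
        using vpoly.subspace_diff[OF subspace_MS q(2), of "var (bar v) * bracket {} b"] q(5) insert.hyps
        by (simp add: bracket_insert left_diff_distrib)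
      show "sigma n (bracket {} (insert v b) :: 'f vpoly) =
          scale (of_int (- int (card (insert v b)))) (bracket {} (insert v b))"
        using insert.hyps q(1,3,6)
        by (simp add: bracket_insert left_diff_distrib scale_mult_right vpoly.scale_right_diff_distrib)
          (simp add: algebra_simps vpoly.scale_left_diff_distrib vpoly.scale_left_distrib)
    qed
  qed
  have "(bracket a b :: 'f vpoly) \<in> MS n (fst ` (a \<union> b)) (card a + card b) \<and>
    sigma n (bracket a b :: 'f vpoly) = scale (of_int (int (card a) - int (card b))) (bracket a b)"
    using fin(1) assms(1,3)
  proof (induction a rule: finite_induct)
    case empty
    show ?case using B by simp
  next
    case (insert v a)
    then have v: "v \<in> V n" "fst v \<notin> fst ` (a \<union> b)"
      using Vdot_subset_V inj_on_image_mem_iff[OF inj, of v "a \<union> b"] assms(2) by auto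
    then have bv: "bar v \<in> V n" "fst (bar v) \<notin> fst ` (a \<union> b)" by auto
    have "(bracket a b :: 'f vpoly) \<in> MS n (fst ` (a \<union> b)) (card a + card b)"
      "sigma n (bracket a b :: 'f vpoly) = scale (of_int (int (card a) - int (card b))) (bracket a b)"
      using insert by auto
    note q = this(2) var_times[OF this(1) v] var_times[OF this(1) bv]
    show ?case
    proof
      show "(bracket (insert v a) b :: 'f vpoly) \<in> MS n (fst ` (insert v a \<union> b)) (card (insert v a) + card b)"
        using vpoly.subspace_add[OF subspace_MS q(2), of "var (bar v) * bracket a b"] q(5) insert.hyps
        by (simp add: bracket_insert distrib_right)
      show "sigma n (bracket (insert v a) b :: 'f vpoly) =
          scale (of_int (int (card (insert v a)) - int (card b))) (bracket (insert v a) b)"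
        using insert.hyps q(1,3,6)
        by (simp add: bracket_insert distrib_right scale_mult_right vpoly.scale_right_distrib)
          (simp add: algebra_simps vpoly.scale_left_diff_distrib vpoly.scale_left_distrib)
    qed
  qed
  then show "(bracket a b :: 'f vpoly) \<in> MS n (fst ` (a \<union> b)) (card a + card b)"
    and "sigma n (bracket a b :: 'f vpoly) = scale (of_int (int (card a) - int (card b))) (bracket a b)" by auto
qed

lemma subspace_eigenspace_on:
  assumes "vlinear f" "vpoly.subspace W"
  shows "vpoly.subspace (eigenspace_on W f c)"
  using assms(2) unfolding vpoly.subspace_def eigenspace_on_def
  by (auto simp: vlinear_simps[OF assms(1)] vpoly.scale_right_distrib mult.commute)

text \<open>The eigenvalue is \<open>(k - j) - j\<close>, the one of a bracket with \<open>j\<close>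
  differences. Unlike \<open>Ekj\<close>, this space stays inside \<open>M n k\<close> when
  \<open>k < j\<close>, a case needed at the bottom of the ladder.\<close>

definition Skj :: "nat \<Rightarrow> nat \<Rightarrow> nat \<Rightarrow> 'f::field vpoly set"
  where "Skj n k j = eigenspace_on (M n k) (sigma n) (of_int (int k - 2 * int j))"

lemma Ekj_subset_Skj:
  assumes "j \<le> k"
  shows "(Ekj n k j :: 'f::field vpoly set) \<subseteq> Skj n k j"
  unfolding Ekj_def
proof (rule vpoly.span_minimal)
  show "vpoly.subspace (Skj n k j :: 'f vpoly set)"
    unfolding Skj_def by (intro subspace_eigenspace_on vlinear_sigma subspace_M)
  show "{bracket a b | a b. a \<subseteq> Vdot n \<and> b \<subseteq> Vdot n \<and> a \<inter> b = {} \<and> card a = k - j \<and> card b = j}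
      \<subseteq> (Skj n k j :: 'f vpoly set)"
  proof safe
    fix a b assume ab: "a \<subseteq> Vdot n" "b \<subseteq> Vdot n" "a \<inter> b = {}" "card a = k - card b" "j = card b"
    have "int (card a) - int (card b) = int k - 2 * int (card b)" "card a + card b = k"
      using ab assms by auto
    then show "bracket a b \<in> (Skj n k (card b) :: 'f vpoly set)"
      using bracket_properties[OF ab(1-3), where 'f = 'f] MS_M by (fastforce simp: Skj_def eigenspace_on_def)
  qed
qed

lemma subspace_Ekj: "vpoly.subspace (Ekj n k j)"
  by (simp add: Ekj_def)

text \<open>Twice a vertex is the sum or difference of its two bracket factors. Since 2 is
  invertible, the vertices of the face can be converted into such factors one at a time.\<close>

lemma face_times_bracket:
  assumes two: "(2 :: 'f::field) \<noteq> 0"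
    and "finite x" "x \<subseteq> V n" "\<forall>v\<in>x. bar v \<notin> x"
    and "a \<subseteq> Vdot n" "b \<subseteq> Vdot n" "a \<inter> b = {}" "fst ` x \<inter> fst ` (a \<union> b) = {}"
  shows "face x * bracket a b \<in> vpoly.span {bracket a' b' :: 'f vpoly | a' b'. a' \<subseteq> Vdot n \<and> b' \<subseteq> Vdot n
    \<and> a' \<inter> b' = {} \<and> card a' + card b' = card x + card a + card b}"
  using assms(2-)
proof (induction x arbitrary: a b rule: finite_induct)
  case empty
  then show ?case by (auto simp: face_def intro!: vpoly.span_base)
next
  case (insert v x)
  \<comment> \<open>The representative in \<open>Vdot n\<close> of the antipodal pair of
    \<open>v\<close>.\<close>
  let ?w = "alpha (fst v)"
  have v: "v = ?w \<or> v = bar ?w" "?w \<in> Vdot n"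
    using insert.prems(1) by (cases v; auto simp: alpha_def bar_def V_eq Vdot_eq)+
  have fw: "fst ?w = fst v" by (simp add: alpha_def)
  have fin: "finite a" "finite b"
    using insert.prems finite_subset[OF _ finite_subset[OF Vdot_subset_V finite_V]] by auto
  have "fst v \<notin> fst ` (a \<union> b)" using insert.prems(6) by auto
  then have wab: "?w \<notin> a" "?w \<notin> b" using fw by (metis UnI1 UnI2 imageI)+
  have vx: "fst v \<notin> fst ` x"
    using insert.hyps(2) insert.prems(2) unfolding image_iff by (metis fst_eq_iff_bar insertI1 insertI2)
  let ?S = "vpoly.span {bracket a' b' :: 'f vpoly | a' b'. a' \<subseteq> Vdot n \<and> b' \<subseteq> Vdot n
    \<and> a' \<inter> b' = {} \<and> card a' + card b' = card (insert v x) + card a + card b}"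
  have "face x * bracket (insert ?w a) b \<in> vpoly.span {bracket a' b' :: 'f vpoly | a' b'. a' \<subseteq> Vdot n \<and> b' \<subseteq> Vdot n
    \<and> a' \<inter> b' = {} \<and> card a' + card b' = card x + card (insert ?w a) + card b}"
    using insert.prems v wab fw vx by (intro insert.IH) auto
  then have 1: "face x * bracket (insert ?w a) b \<in> ?S"
    using insert.hyps wab fin by simp
  have "face x * bracket a (insert ?w b) \<in> vpoly.span {bracket a' b' :: 'f vpoly | a' b'. a' \<subseteq> Vdot n \<and> b' \<subseteq> Vdot n
    \<and> a' \<inter> b' = {} \<and> card a' + card b' = card x + card a + card (insert ?w b)}"
    using insert.prems v wab fw vx by (intro insert.IH) auto
  then have 2: "face x * bracket a (insert ?w b) \<in> ?S"
    using insert.hyps wab fin by simp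
  have s2: "scale (2 :: 'f) p = p + p" for p
    using vpoly.scale_left_distrib[of 1 1 p] by simp
  have "scale 2 (face (insert v x) * bracket a b :: 'f vpoly) =
      (if v = ?w then face x * bracket (insert ?w a) b + face x * bracket a (insert ?w b)
       else face x * bracket (insert ?w a) b - face x * bracket a (insert ?w b))"
    using v(1) insert.hyps fin wab
    by (auto simp: face_def bracket_insert s2 algebra_simps)
  also have "\<dots> \<in> ?S" by (simp only: vpoly.span_add[OF 1 2] vpoly.span_diff[OF 1 2] split: if_split) simp
  finally have "scale (1/2) (scale 2 (face (insert v x) * bracket a b)) \<in> ?S"
    by (rule vpoly.span_scale)
  then show ?case using two by simp
qed

section \<open>Sums of eigenspaces\<close>

lemma subspace_sums:
  assumes "\<And>i. i \<in> I \<Longrightarrow> vpoly.subspace (U i)"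
  shows "vpoly.subspace {\<Sum>i\<in>I. u i | u. \<forall>i\<in>I. u i \<in> U i}" (is "vpoly.subspace ?S")
  unfolding vpoly.subspace_def
proof (intro conjI ballI allI)
  show "0 \<in> ?S"
    by (rule CollectI, rule exI[of _ "\<lambda>_. 0"]) (use vpoly.subspace_0[OF assms] in auto)
  fix p q c assume "p \<in> ?S"
  then obtain u where u: "p = (\<Sum>i\<in>I. u i)" "\<forall>i\<in>I. u i \<in> U i" by auto
  show "scale c p \<in> ?S"
    by (rule CollectI, rule exI[of _ "\<lambda>i. scale c (u i)"])
      (use u vpoly.subspace_scale[OF assms] in \<open>auto simp: vpoly.scale_sum_right\<close>)
  assume "q \<in> ?S"
  then obtain w where w: "q = (\<Sum>i\<in>I. w i)" "\<forall>i\<in>I. w i \<in> U i" by auto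
  show "p + q \<in> ?S"
    by (rule CollectI, rule exI[of _ "\<lambda>i. u i + w i"])
      (use u w vpoly.subspace_add[OF assms] in \<open>auto simp: sum.distrib\<close>)
qed

text \<open>Every face is a combination of brackets by \<open>face_times_bracket\<close> with the
  empty bracket; sorting these by the size of \<open>b\<close> gives the summands.\<close>

lemma M_sum_Ekj:
  assumes two: "(2 :: 'f::field) \<noteq> 0" and p: "p \<in> M n k"
  shows "\<exists>u. (\<forall>j\<in>{0..k}. u j \<in> Ekj n k j) \<and> (p :: 'f vpoly) = (\<Sum>j\<in>{0..k}. u j)"
proof -
  let ?S = "{\<Sum>j\<in>{0..k}. u j | u. \<forall>j\<in>{0..k}. u j \<in> (Ekj n k j :: 'f vpoly set)}"
  have sub: "vpoly.subspace ?S" by (intro subspace_sums subspace_Ekj)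
  have "bracket a b \<in> ?S" if ab: "a \<subseteq> Vdot n" "b \<subseteq> Vdot n" "a \<inter> b = {}" "card a + card b = k" for a b
  proof -
    have "bracket a b = (\<Sum>j\<in>{0..k}. if j = card b then bracket a b else (0 :: 'f vpoly))"
      using ab by simp
    moreover have "bracket a b \<in> (Ekj n k (card b) :: 'f vpoly set)"
      unfolding Ekj_def using ab by (intro vpoly.span_base CollectI exI[of _ a] exI[of _ b]) auto
    ultimately show ?thesis using vpoly.subspace_0[OF subspace_Ekj]
      by (intro CollectI exI[of _ "\<lambda>j. if j = card b then bracket a b else 0"]) auto
  qed
  then have "vpoly.span {bracket a b | a b. a \<subseteq> Vdot n \<and> b \<subseteq> Vdot n \<and> a \<inter> b = {} \<and> card a + card b = k} \<subseteq> ?S"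
    by (intro vpoly.span_minimal sub) auto
  moreover have "face x \<in> vpoly.span {bracket a b :: 'f vpoly | a b. a \<subseteq> Vdot n \<and> b \<subseteq> Vdot n
      \<and> a \<inter> b = {} \<and> card a + card b = k}" if "x \<in> L n k" for x
    using face_times_bracket[OF two L_finite[OF that], of n "{}" "{}"] that
    by (simp add: L_iff bracket_def)
  ultimately have "face ` L n k \<subseteq> ?S" by blast
  then have "M n k \<subseteq> ?S" unfolding M_def by (rule vpoly.span_minimal[OF _ sub])
  with p have "p \<in> ?S" by blast
  then show ?thesis by blast
qed

text \<open>Applying \<open>T\<close> minus the scalar \<open>c l\<close> removes one summand and
  multiplies each other one by a nonzero constant, so induction applies.\<close>

lemma eigen_sum_zero:
  assumes "vlinear T" "finite I" "inj_on c I" "\<And>i. i \<in> I \<Longrightarrow> T (u i) = scale (c i) (u i)"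
    "(\<Sum>i\<in>I. u i) = 0" "i \<in> I"
  shows "u i = 0"
  using assms(2-)
proof (induction I arbitrary: u i rule: finite_induct)
  case (insert l J)
  have "u l = - (\<Sum>i\<in>J. u i)" using insert.prems(3) insert.hyps by (simp add: eq_neg_iff_add_eq_0)
  have "0 = T (\<Sum>i\<in>insert l J. u i) - scale (c l) (\<Sum>i\<in>insert l J. u i)"
    unfolding insert.prems by (simp add: vlinear_simps[OF assms(1)])
  also have "\<dots> = (\<Sum>i\<in>insert l J. scale (c i - c l) (u i))"
    using insert.prems(2)
    by (simp add: vlinear_simps[OF assms(1)] vpoly.scale_sum_right vpoly.scale_left_diff_distrib
        sum_subtractf del: sum.insert)
  also have "\<dots> = (\<Sum>i\<in>J. scale (c i - c l) (u i))" using insert.hyps by simp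
  finally have "(\<Sum>i\<in>J. scale (c i - c l) (u i)) = 0" by simp
  then have "scale (c i - c l) (u i) = 0" if "i \<in> J" for i
    using insert.prems(1,2) that
    by (intro insert.IH[of "\<lambda>i. scale (c i - c l) (u i)" i])
      (auto simp: vlinear_simps[OF assms(1)] mult.commute)
  then have J: "u i = 0" if "i \<in> J" for i
    using that insert.hyps(2) insert.prems(1) vpoly.scale_eq_0_iff by (auto simp: inj_on_def)
  with insert.prems(3,4) insert.hyps show ?case by auto
qed simp

text \<open>\<open>T\<close> minus the scalar \<open>d\<close> kills the sum, so by independence it
  kills every summand. This locates an eigenvector inside a decomposition.\<close>

lemma eigen_sum_component:
  assumes "vlinear T" "finite I" "inj_on c I" "\<And>i. i \<in> I \<Longrightarrow> T (u i) = scale (c i) (u i)"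
    "v = (\<Sum>i\<in>I. u i)" "T v = scale d v" "i \<in> I" "c i \<noteq> d"
  shows "u i = 0"
proof -
  have "scale (c i - d) (u i) = 0"
  proof (rule eigen_sum_zero[OF assms(1-3) _ _ assms(7), of "\<lambda>i. scale (c i - d) (u i)"])
    show "(\<Sum>i\<in>I. scale (c i - d) (u i)) = 0"
      using assms(4,6) unfolding assms(5)
      by (simp add: vlinear_simps[OF assms(1)] vpoly.scale_sum_right vpoly.scale_left_diff_distrib
        sum_subtractf)
  qed (simp add: vlinear_simps[OF assms(1)] assms(4) mult.commute)
  then show ?thesis using assms(8) by simp
qed

section \<open>Eigenspaces of \<open>\<nu>\<^sup>+\<close>\<close>

definition lam :: "nat \<Rightarrow> nat \<Rightarrow> nat \<Rightarrow> nat \<Rightarrow> 'f::field"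
  where "lam n k j i = of_int (2 * (int k - int j + 1 - int i) * (int n - int k - int i))"

lemma Ekji_def': "Ekji n k j i = eigenspace_on (Ekj n k j) (nu_plus n) (lam n k j i)"
  by (simp add: Ekji_def lam_def)

locale large_char =
  fixes n :: nat and F :: "'f::field itself"
  assumes large: "CHAR('f) > n \<or> CHAR('f) = 0" and n2: "n \<ge> 2"
begin

text \<open>The characteristic, if positive, exceeds \<open>n\<close> and so cannot divide such an
  integer. The inequalities between eigenvalues below reduce to this bound by factorization.\<close>

lemma of_int_nonzero:
  assumes "z \<noteq> 0" "\<bar>z\<bar> \<le> int n" shows "(of_int z :: 'f) \<noteq> 0"
proof
  assume "(of_int z :: 'f) = 0"
  then have "int CHAR('f) dvd z" by (simp add: of_int_eq_0_iff_char_dvd)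
  then have "int CHAR('f) \<le> \<bar>z\<bar>" "CHAR('f) \<noteq> 0" using assms(1) by (auto dest: dvd_imp_le_int)
  then show False using assms large by linarith
qed

lemma two_nonzero [simp]: "(2 :: 'f) \<noteq> 0"
  using of_int_nonzero[of 2] n2 by simp

lemma of_nat_nonzero: "0 < m \<Longrightarrow> m \<le> n \<Longrightarrow> (of_nat m :: 'f) \<noteq> 0"
  using of_int_nonzero[of "int m"] by simp

lemma sigma_eigenvalue_inject:
  assumes "j \<le> n" "j' \<le> n"
  shows "(of_int (int k - 2 * int j) :: 'f) = of_int (int k - 2 * int j') \<longleftrightarrow> j = j'"
proof
  assume "(of_int (int k - 2 * int j) :: 'f) = of_int (int k - 2 * int j')"
  then have "(2 :: 'f) * of_int (int j - int j') = 0" by (simp add: algebra_simps)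
  then have "(of_int (int j - int j') :: 'f) = 0" by simp
  then show "j = j'" using of_int_nonzero[of "int j - int j'"] assms by fastforce
qed simp

text \<open>The difference of two eigenvalues factors as
  \<open>2 * (i - i') * (i + i' - (n - j + 1))\<close>, and the last factor is negative because
  \<open>i + i' \<le> (k - j) + (n - k)\<close>.\<close>

lemma lam_inject:
  assumes "j \<le> k" "k \<le> n" "i \<le> min (k - j) (n - k)" "i' \<le> min (k - j) (n - k)"
  shows "(lam n k j i :: 'f) = lam n k j i' \<longleftrightarrow> i = i'"
proof
  assume "(lam n k j i :: 'f) = lam n k j i'"
  then have "(of_int (2 * (int k - int j + 1 - int i) * (int n - int k - int i) -
      2 * (int k - int j + 1 - int i') * (int n - int k - int i')) :: 'f) = 0"
    by (simp add: lam_def)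
  also have "2 * (int k - int j + 1 - int i) * (int n - int k - int i) -
      2 * (int k - int j + 1 - int i') * (int n - int k - int i')
      = 2 * ((int i - int i') * (int i + int i' - (int n - int j + 1)))"
    by (simp add: algebra_simps)
  finally have "(2 :: 'f) * (of_int (int i - int i') * of_int (int i + int i' - (int n - int j + 1))) = 0"
    by (simp only: of_int_mult of_int_numeral)
  then have *: "(of_int (int i - int i') :: 'f) = 0 \<or> (of_int (int i + int i' - (int n - int j + 1)) :: 'f) = 0"
    by (simp only: mult_eq_0_iff two_nonzero simp_thms)
  show "i = i'"
  proof (rule ccontr)
    assume "i \<noteq> i'"
    \<comment> \<open>For \<open>j = 0\<close> the bound on the second factor requires
      \<open>i + i' \<ge> 1\<close>, which follows from \<open>i \<noteq> i'\<close>.\<close>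
    moreover have "\<bar>int i - int i'\<bar> \<le> int n" "int i + int i' - (int n - int j + 1) \<noteq> 0"
      "\<bar>int i + int i' - (int n - int j + 1)\<bar> \<le> int n" using assms \<open>i \<noteq> i'\<close> by auto
    ultimately show False using * of_int_nonzero by (metis eq_iff_diff_eq_0 of_nat_eq_iff)
  qed
qed simp

lemma lam_nonzero:
  assumes "j \<le> k" "i \<le> k - j" "k < n" "i \<le> n - k - 1"
  shows "(lam n k j i :: 'f) \<noteq> 0"
proof -
  have "(of_int (int k - int j + 1 - int i) :: 'f) \<noteq> 0" "(of_int (int n - int k - int i) :: 'f) \<noteq> 0"
    using assms by (intro of_int_nonzero; simp)+
  then show ?thesis
    unfolding lam_def of_int_mult by (simp only: mult_eq_0_iff of_int_numeral two_nonzero simp_thms)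
qed

text \<open>In a decomposition along the \<open>Ekj\<close>, the components of a
  \<open>sigma\<close>-eigenvector with a different eigenvalue vanish.\<close>

lemma Skj_subset_Ekj:
  assumes "j \<le> k" "k \<le> n"
  shows "(Skj n k j :: 'f vpoly set) \<subseteq> Ekj n k j"
proof
  fix p :: "'f vpoly" assume "p \<in> Skj n k j"
  then have p: "p \<in> M n k" "sigma n p = scale (of_int (int k - 2 * int j)) p"
    by (auto simp: Skj_def eigenspace_on_def)
  obtain u where u: "\<forall>j\<in>{0..k}. u j \<in> Ekj n k j" "p = (\<Sum>j\<in>{0..k}. u j)"
    using M_sum_Ekj[OF two_nonzero p(1)] by blast
  have "u j' = 0" if "j' \<in> {0..k}" "j' \<noteq> j" for j'
  proof (rule eigen_sum_component[OF vlinear_sigma _ _ _ u(2) p(2) that(1)])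
    show "inj_on (\<lambda>j. of_int (int k - 2 * int j) :: 'f) {0..k}"
      by (rule inj_onI) (use sigma_eigenvalue_inject assms in auto)
    show "sigma n (u i) = scale (of_int (int k - 2 * int i)) (u i)" if "i \<in> {0..k}" for i
      using u(1) that Ekj_subset_Skj[of i k n] by (auto simp: Skj_def eigenspace_on_def)
    show "(of_int (int k - 2 * int j') :: 'f) \<noteq> of_int (int k - 2 * int j)"
      using sigma_eigenvalue_inject that assms by auto
  qed simp
  then have "p = u j" using assms unfolding u(2) by (subst sum.remove[of _ j]) auto
  then show "p \<in> Ekj n k j" using u(1) assms by auto
qed

lemma Ekj_eq: "j \<le> k \<Longrightarrow> k \<le> n \<Longrightarrow> (Ekj n k j :: 'f vpoly set) = Skj n k j"
  using Skj_subset_Ekj Ekj_subset_Skj by blast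

lemma Ekj_iff:
  assumes "j \<le> k" "k \<le> n"
  shows "(p :: 'f vpoly) \<in> Ekj n k j \<longleftrightarrow> p \<in> M n k \<and> sigma n p = scale (of_int (int k - 2 * int j)) p"
  using assms by (simp add: Ekj_eq Skj_def eigenspace_on_def)

text \<open>For \<open>k < j \<le> n\<close> the number \<open>k - 2 * j\<close> differs in the
  field from all eigenvalues that occur on \<open>M n k\<close>.\<close>

lemma Skj_eq_0:
  assumes "k < j" "j \<le> n" "(p :: 'f vpoly) \<in> Skj n k j"
  shows "p = 0"
proof -
  have p: "p \<in> M n k" "sigma n p = scale (of_int (int k - 2 * int j)) p"
    using assms(3) by (auto simp: Skj_def eigenspace_on_def)
  obtain u where u: "\<forall>j\<in>{0..k}. u j \<in> Ekj n k j" "p = (\<Sum>j\<in>{0..k}. u j)"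
    using M_sum_Ekj[OF two_nonzero p(1)] by blast
  have "u j' = 0" if "j' \<in> {0..k}" for j'
  proof (rule eigen_sum_component[OF vlinear_sigma _ _ _ u(2) p(2) that])
    show "inj_on (\<lambda>j. of_int (int k - 2 * int j) :: 'f) {0..k}"
      by (rule inj_onI) (use sigma_eigenvalue_inject assms in auto)
    show "sigma n (u i) = scale (of_int (int k - 2 * int i)) (u i)" if "i \<in> {0..k}" for i
      using u(1) that Ekj_subset_Skj[of i k n] by (auto simp: Skj_def eigenspace_on_def)
    show "(of_int (int k - 2 * int j') :: 'f) \<noteq> of_int (int k - 2 * int j)"
      using sigma_eigenvalue_inject[of j' j k] that assms by auto
  qed simp
  then show ?thesis unfolding u(2) by simp
qed

lemma Ekji_iff:
  assumes "j \<le> k" "k \<le> n"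
  shows "(p :: 'f vpoly) \<in> Ekji n k j i \<longleftrightarrow> p \<in> M n k \<and> sigma n p = scale (of_int (int k - 2 * int j)) p
    \<and> nu_plus n p = scale (lam n k j i) p"
  using Ekj_iff[OF assms, of p] by (auto simp: Ekji_def' eigenspace_on_def)

lemma subspace_Ekji: "vpoly.subspace (Ekji n k j i :: 'f vpoly set)"
  unfolding Ekji_def' by (intro subspace_eigenspace_on vlinear_nu_plus subspace_Ekj)

section \<open>The ladder of \<open>eps\<close> and \<open>del\<close> for fixed
  \<open>j\<close>\<close>

lemma eps_Ekj:
  assumes "j \<le> k" "k < n" "(p :: 'f vpoly) \<in> Ekj n k j"
  shows "eps n p \<in> Ekj n (Suc k) j"
  using assms(3) Ekj_iff[of j k p] Ekj_iff[of j "Suc k" "eps n p"] assms(1,2)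
  by (auto simp: sigma_eps eps_M simp flip: vpoly.scale_left_distrib)
    (simp add: algebra_simps vpoly.scale_left_distrib vpoly.scale_left_diff_distrib)

lemma del_Skj:
  assumes "(p :: 'f vpoly) \<in> Skj n (Suc k) j"
  shows "del n p \<in> Skj n k j"
proof -
  have p: "p \<in> M n (Suc k)" "sigma n p = scale (of_int (int (Suc k) - 2 * int j)) p"
    using assms by (auto simp: Skj_def eigenspace_on_def)
  have "of_int (int (Suc k) - 2 * int j) = (of_int (int k - 2 * int j) + 1 :: 'f)" by simp
  then show ?thesis
    using del_M[OF p(1)] unfolding Skj_def eigenspace_on_def
    by (simp only: mem_Collect_eq sigma_del[OF p(1)] p(2) op_simps vpoly.scale_left_distrib
        vpoly.scale_one add_diff_cancel_right' simp_thms)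
qed

lemma del_Ekj:
  assumes "j \<le> k" "k < n" "(p :: 'f vpoly) \<in> Ekj n (Suc k) j"
  shows "del n p \<in> Ekj n k j"
  using del_Skj[of p k j] Ekj_eq[of j k] Ekj_eq[of j "Suc k"] assms by simp

text \<open>For positive \<open>j\<close> the image lies one level below \<open>j\<close> and still
  belongs to the index \<open>j\<close>, where \<open>Skj_eq_0\<close> leaves only 0.\<close>

lemma del_Ekj_bottom:
  assumes "j \<le> n" "(p :: 'f vpoly) \<in> Ekj n j j"
  shows "del n p = 0"
proof (cases j)
  case 0
  then show ?thesis using assms Ekj_iff[of j j p] del_M_0[of p n] by simp
next
  case (Suc k)
  then show ?thesis using assms Ekj_eq[of j j] del_Skj[of p k j] Skj_eq_0[of k j "del n p"] by simp
qed

text \<open>On \<open>Ekj\<close> the operator \<open>sigma\<close> is a scalar, and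
  \<open>2 * n - 3 * k - (k - 2 * j)\<close> is the constant shown; it acts as the weight in the sl2
  picture.\<close>

lemma del_eps_Ekj:
  assumes "j \<le> k" "k \<le> n" "(p :: 'f vpoly) \<in> Ekj n k j"
  shows "del n (eps n p) = eps n (del n p) + scale (of_int (2 * (int n + int j - 2 * int k))) p"
proof -
  have p: "p \<in> M n k" "sigma n p = scale (of_int (int k - 2 * int j)) p"
    using assms Ekj_iff by auto
  show ?thesis unfolding del_eps_commutator[OF p(1)] p(2) add_diff_eq[symmetric]
    by (simp add: algebra_simps flip: vpoly.scale_left_diff_distrib)
qed

lemma of_int_distrib_scale: "scale (of_int a) p + scale (of_int b) p = scale (of_int (a + b)) (p :: 'f vpoly)"
  by (simp add: vpoly.scale_left_distrib)

text \<open>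
  Above the middle level an element killed by \<open>\<epsilon>\<partial>\<close> vanishes: \<open>\<partial>\<close> maps
  \<open>\<epsilon>\<^sup>r\<^sup>+\<^sup>1p\<close> to a nonzero multiple of \<open>\<epsilon>\<^sup>rp\<close>, while high powers of \<open>\<epsilon>\<close> are zero.
\<close>

lemma eps_del_eq_0_imp:
  assumes j: "j \<le> k" "k \<le> n" and high: "n + j < 2 * k"
    and p: "(p :: 'f vpoly) \<in> Ekj n k j" "eps n (del n p) = 0"
  shows "p = 0"
proof -
  define q where "q r = (eps n ^^ r) p" for r
  have q: "q 0 = p" "q (Suc r) = eps n (q r)" for r by (auto simp: q_def)
  have E: "q r \<in> Ekj n (k + r) j" if "k + r \<le> n" for r
    using that by (induction r) (use p j eps_Ekj in \<open>auto simp: q\<close>)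
  \<comment> \<open>The sum of the commutator constants \<open>2 * (n + j - 2 * (k + s))\<close>
    over \<open>s\<close> from 0 to \<open>r\<close>.\<close>
  define c where "c r = - (2 * (int r + 1) * (2 * int k - int n - int j + int r))" for r
  have d: "del n (q (Suc r)) = scale (of_int (c r)) (q r)" if "k + r \<le> n" for r
    using that
  proof (induction r)
    case 0
    show ?case using del_eps_Ekj[OF j p(1)] p(2) by (simp add: q c_def algebra_simps)
  next
    case (Suc r)
    have "del n (q (Suc (Suc r))) = eps n (del n (q (Suc r))) +
        scale (of_int (2 * (int n + int j - 2 * int (k + Suc r)))) (q (Suc r))"
      unfolding q(2)[of "Suc r"] using j Suc.prems by (intro del_eps_Ekj E) auto
    also have "eps n (del n (q (Suc r))) = scale (of_int (c r)) (q (Suc r))"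
      using Suc by (simp add: q)
    also have "scale (of_int (c r)) (q (Suc r)) + scale (of_int (2 * (int n + int j - 2 * int (k + Suc r)))) (q (Suc r))
      = scale (of_int (c r + 2 * (int n + int j - 2 * int (k + Suc r)))) (q (Suc r))"
      by (rule of_int_distrib_scale)
    also have "c r + 2 * (int n + int j - 2 * int (k + Suc r)) = c (Suc r)"
      by (simp add: c_def algebra_simps)
    finally show ?case .
  qed
  \<comment> \<open>This power of \<open>eps\<close> lands in \<open>M n (Suc n)\<close>, which is
    zero. The vanishing is then carried down to \<open>q 0\<close>.\<close>
  have top: "q (Suc (n - k)) = 0"
    using E[of "n - k"] j Ekj_iff[of j n] eps_M[of "q (n - k)" n n] M_eq_0[of _ n "Suc n"]
    by (simp add: q)
  have "q (Suc (n - k) - r) = 0" if "r \<le> Suc (n - k)" for r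
    using that
  proof (induction r)
    case (Suc r)
    define m where "m = Suc (n - k) - Suc r"
    have m: "Suc (n - k) - r = Suc m" "k + m \<le> n" using Suc.prems j by (auto simp: m_def)
    then have "scale (of_int (c m)) (q m) = 0" using Suc d[of m] by simp
    \<comment> \<open>Both factors lie between 1 and \<open>n\<close>: \<open>high\<close> makes the
      second one positive and excludes \<open>k = 0\<close>, and \<open>m \<le> n - k\<close> bounds
      both above.\<close>
    moreover have "(of_int (int m + 1) :: 'f) \<noteq> 0" "(of_int (2 * int k - int n - int j + int m) :: 'f) \<noteq> 0"
      using m j high by (intro of_int_nonzero; simp)+
    then have "(of_int (c m) :: 'f) \<noteq> 0"
      unfolding c_def of_int_mult of_int_minus
      by (simp only: mult_eq_0_iff neg_equal_0_iff_equal of_int_numeral two_nonzero simp_thms)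
    ultimately show ?case by (simp add: m_def)
  qed (use top in simp)
  from this[of "Suc (n - k)"] show ?thesis by (simp add: q)
qed

text \<open>The eigenvalues change from level to level by the commutator constant, which is why
  \<open>eps\<close> and \<open>del\<close> preserve the index \<open>i\<close>.\<close>

lemma lam_Suc: "(lam n (Suc k) j i :: 'f) = lam n k j i + of_int (2 * (int n + int j - 2 * int (Suc k)))"
  unfolding lam_def of_int_add[symmetric] by (rule arg_cong[of _ _ of_int]) (simp add: algebra_simps)

lemma Ekji_iff_Ekj: "p \<in> Ekji n k j i \<longleftrightarrow> p \<in> Ekj n k j \<and> del n (eps n p) = scale (lam n k j i) p"
  by (auto simp: Ekji_def' eigenspace_on_def nu_plus_def)

lemma eps_Ekji:
  assumes "j \<le> k" "k < n" "(p :: 'f vpoly) \<in> Ekji n k j i"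
  shows "eps n p \<in> Ekji n (Suc k) j i"
proof -
  have p: "p \<in> Ekj n k j" "del n (eps n p) = scale (lam n k j i) p"
    using assms by (auto simp: Ekji_iff_Ekj)
  have "del n (eps n (eps n p)) = eps n (del n (eps n p)) + scale (of_int (2 * (int n + int j - 2 * int (Suc k)))) (eps n p)"
    using assms by (intro del_eps_Ekj eps_Ekj p) auto
  then show ?thesis
    unfolding Ekji_iff_Ekj using eps_Ekj[OF assms(1,2) p(1)] p(2)
    by (simp add: lam_Suc vpoly.scale_left_distrib)
qed

lemma del_Ekji:
  assumes "j \<le> k" "k < n" "(p :: 'f vpoly) \<in> Ekji n (Suc k) j i"
  shows "del n p \<in> Ekji n k j i" "eps n (del n p) = scale (lam n k j i) p"
proof -
  have p: "p \<in> Ekj n (Suc k) j" "del n (eps n p) = scale (lam n (Suc k) j i) p"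
    using assms by (auto simp: Ekji_iff_Ekj)
  have "del n (eps n p) = eps n (del n p) + scale (of_int (2 * (int n + int j - 2 * int (Suc k)))) p"
    using assms by (intro del_eps_Ekj p) auto
  then show *: "eps n (del n p) = scale (lam n k j i) p"
    unfolding p(2) lam_Suc vpoly.scale_left_distrib by simp
  then show "del n p \<in> Ekji n k j i"
    unfolding Ekji_iff_Ekj using del_Ekj[OF assms(1,2) p(1)] by simp
qed

text \<open>Induction on \<open>k\<close>: the decomposition of \<open>del n p\<close> is lifted by
  \<open>eps\<close>, up to scalars. What remains of \<open>p\<close> is killed by
  \<open>eps\<close> after \<open>del\<close>, so it is zero above the middle level and otherwise an
  eigenvector with the new index \<open>Suc k - j\<close>.\<close>

lemma Ekj_sum_Ekji:
  assumes "j \<le> k" "k \<le> n" "(p :: 'f vpoly) \<in> Ekj n k j"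
  shows "\<exists>u. (\<forall>i\<in>{0..min (k - j) (n - k)}. u i \<in> Ekji n k j i) \<and> p = (\<Sum>i\<in>{0..min (k - j) (n - k)}. u i)"
  using assms
proof (induction k arbitrary: p rule: dec_induct)
  case base
  \<comment> \<open>At the lowest level \<open>del n p = 0\<close>, so the commutator alone acts,
    and the range of \<open>i\<close> is \<open>{0..0}\<close>.\<close>
  have "del n (eps n p) = scale (lam n j j 0) p"
    using del_eps_Ekj[of j j p] del_Ekj_bottom[of j p] base by (simp add: lam_def algebra_simps)
  then show ?case using base by (intro exI[of _ "\<lambda>_. p"]) (simp add: Ekji_iff_Ekj)
next
  case (step k)
  \<comment> \<open>\<open>?A\<close> is the range of \<open>i\<close> at level \<open>k\<close>;
    \<open>?I\<close> drops \<open>i = n - k\<close> if it occurs there. The range at level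
    \<open>Suc k\<close> is \<open>?I\<close>, possibly with \<open>Suc k - j\<close> added.\<close>
  let ?A = "{0..min (k - j) (n - k)}" and ?I = "{0..min (k - j) (n - Suc k)}"
  have k: "j \<le> k" "k < n" using step by auto
  obtain w where w: "\<forall>i\<in>?A. w i \<in> Ekji n k j i" "del n p = (\<Sum>i\<in>?A. w i)"
    using step.IH[of "del n p"] del_Ekj[OF k step.prems(2)] k by auto
  \<comment> \<open>The factor is chosen so that \<open>eps n (del n (u i)) = eps n (w i)\<close>;
    on \<open>?I\<close> the eigenvalue is nonzero.\<close>
  define u where "u i = scale (1 / lam n k j i) (eps n (w i))" for i
  have u: "u i \<in> Ekji n (Suc k) j i" if "i \<in> ?I" for i
    unfolding u_def using w(1) that k by (intro vpoly.subspace_scale[OF subspace_Ekji] eps_Ekji) auto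
  have edu: "eps n (del n (u i)) = eps n (w i)" if "i \<in> ?I" for i
    using w(1) that k lam_nonzero[of j k i] by (auto simp: u_def Ekji_iff_Ekj)
  \<comment> \<open>For the dropped index \<open>i = n - k\<close> the eigenvalue is zero, and its
    presence in \<open>?A\<close> places level \<open>Suc k\<close> above the middle.\<close>
  have top: "eps n (w i) = 0" if "i \<in> ?A - ?I" for i
  proof (rule eps_del_eq_0_imp[of j "Suc k"])
    have i: "i = n - k" "n - k \<le> k - j" using that k by auto
    then have "(lam n k j i :: 'f) = 0" using k by (simp add: lam_def)
    then show "eps n (del n (eps n (w i))) = 0" using that w(1) by (auto simp: Ekji_iff_Ekj)
    show "n + j < 2 * Suc k" using i k by auto
    show "eps n (w i) \<in> Ekj n (Suc k) j" using that w(1) k by (intro eps_Ekj) (auto simp: Ekji_iff_Ekj)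
  qed (use k in auto)
  define v where "v = p - (\<Sum>i\<in>?I. u i)"
  have v: "v \<in> Ekj n (Suc k) j"
    unfolding v_def using step.prems u
    by (intro vpoly.subspace_diff[OF subspace_Ekj] vpoly.subspace_sum[OF subspace_Ekj])
      (auto simp: Ekji_iff_Ekj)
  have "eps n (del n v) = (\<Sum>i\<in>?A. eps n (w i)) - (\<Sum>i\<in>?I. eps n (w i))"
    unfolding v_def by (simp add: w(2) edu)
  also have "(\<Sum>i\<in>?A. eps n (w i)) = (\<Sum>i\<in>?I. eps n (w i))"
    by (rule sum.mono_neutral_right) (use top in auto)
  finally have v0: "eps n (del n v) = 0" by simp
  show ?case
  proof (cases "n + j < 2 * Suc k")
    case True
    then have "v = 0" using k by (intro eps_del_eq_0_imp[OF _ _ True v v0]) auto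
    moreover have "{0..min (Suc k - j) (n - Suc k)} = ?I" using True k by auto
    ultimately show ?thesis using u by (intro exI[of _ u]) (auto simp: v_def)
  next
    case False
    then have I: "{0..min (Suc k - j) (n - Suc k)} = insert (Suc k - j) ?I" "Suc k - j \<notin> ?I"
      using k by auto
    \<comment> \<open>With \<open>eps n (del n v) = 0\<close> only the commutator constant is left;
      it is the eigenvalue for \<open>i = Suc k - j\<close>.\<close>
    have "del n (eps n v) = scale (lam n (Suc k) j (Suc k - j)) v"
      using del_eps_Ekj[OF _ _ v] v0 k by (simp add: lam_def algebra_simps of_nat_diff)
    then have vE: "v \<in> Ekji n (Suc k) j (Suc k - j)" using v by (simp add: Ekji_iff_Ekj)
    let ?u = "u(Suc k - j := v)"
    have "(\<Sum>i\<in>?I. ?u i) = (\<Sum>i\<in>?I. u i)" using I(2) by (intro sum.cong) auto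
    then have "p = (\<Sum>i\<in>insert (Suc k - j) ?I. ?u i)" using I(2) by (simp add: v_def)
    then show ?thesis unfolding I(1) using u vE by (intro exI[of _ ?u]) auto
  qed
qed

end

section \<open>The action of the hyperoctahedral group\<close>

lemma B_bar: "g \<in> B n \<Longrightarrow> g (bar v) = bar (g v)"
  using permutes_not_in[of g "V n" v] permutes_not_in[of g "V n" "bar v"] by (cases "v \<in> V n") (auto simp: B_def)

lemma B_permutes: "g \<in> B n \<Longrightarrow> g permutes V n"
  by (simp add: B_def)

lemma B_inj: "g \<in> B n \<Longrightarrow> inj g"
  by (metis B_permutes permutes_inj)

lemma B_in_V [simp]: "g \<in> B n \<Longrightarrow> g v \<in> V n \<longleftrightarrow> v \<in> V n"
  by (simp add: B_permutes permutes_in_image)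

lemma B_id: "id \<in> B n"
  by (simp add: B_def permutes_id)

lemma B_comp: "g \<in> B n \<Longrightarrow> h \<in> B n \<Longrightarrow> g \<circ> h \<in> B n"
  using permutes_compose[of h "V n" g] by (auto simp: B_def permutes_in_image)

lemma B_inv:
  assumes "g \<in> B n" shows "inv g \<in> B n"
proof -
  have "inv g (bar v) = bar (inv g v)" for v
    by (metis B_bar B_permutes assms permutes_inverses)
  then show ?thesis using assms by (simp add: B_def permutes_inv)
qed

lemma B_inv_image [simp]: "g \<in> B n \<Longrightarrow> inv g ` (g ` x) = x" "g \<in> B n \<Longrightarrow> g ` (inv g ` x) = x"
  by (simp_all add: image_image permutes_inverses[OF B_permutes])

lemma finite_B [simp, intro!]: "finite (B n)"
  by (rule finite_subset[OF _ finite_permutations[OF finite_V[of n]]]) (auto simp: B_def)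

lemma bar_in_image: "g \<in> B n \<Longrightarrow> bar (g v) \<in> g ` x \<longleftrightarrow> bar v \<in> x"
  by (metis B_bar B_inj inj_image_mem_iff)

lemma image_faces: "g \<in> B n \<Longrightarrow> x \<in> faces n \<Longrightarrow> g ` x \<in> faces n"
  by (auto simp: faces_iff bar_in_image)

lemma image_L: "g \<in> B n \<Longrightarrow> x \<in> L n k \<Longrightarrow> g ` x \<in> L n k"
  using card_image[of g x] inj_on_subset[OF B_inj] by (auto simp: L_iff bar_in_image)

lemma image_free:
  assumes "g \<in> B n" shows "free n (g ` x) = g ` free n x"
proof -
  have mem: "g w \<in> free n (g ` x) \<longleftrightarrow> w \<in> free n x" for w
    using assms by (simp add: free_def bar_in_image inj_image_mem_iff[OF B_inj])
  have "v \<in> g ` free n x" if "v \<in> free n (g ` x)" for v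
    using that mem[of "inv g v"] permutes_inverses(1)[OF B_permutes[OF assms], of v] by force
  then show ?thesis using mem by auto
qed

section \<open>The group action and its commutation with the operators\<close>

lemma act_M: "g \<in> B n \<Longrightarrow> p \<in> M n k \<Longrightarrow> act n g p \<in> M n k"
  by (rule M_linear_in[OF vlinear_act _ subspace_M]) (auto simp: act_face L_faces intro!: face_in_M image_L)

lemma act_comp:
  assumes "g \<in> B n" "h \<in> B n" "p \<in> M n k"
  shows "act n g (act n h p) = act n (g \<circ> h) p"
  by (rule M_linear_eq[OF vlinear_compose[OF vlinear_act vlinear_act] vlinear_act _ assms(3)])
    (use assms in \<open>simp add: act_face L_faces image_faces image_comp\<close>)

lemma act_id: "p \<in> M n k \<Longrightarrow> act n id p = p"
  by (rule M_linear_eq[OF vlinear_act vlinear_id]) (auto simp: act_face L_faces)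

lemma face_coeff_act:
  assumes "g \<in> B n" "x \<in> faces n"
  shows "face_coeff (act n g p) (g ` x) = face_coeff p x"
proof -
  have "face_coeff (act n g p) (g ` x) = (\<Sum>y\<in>faces n. if y = x then face_coeff p y else 0)"
    unfolding act_def face_extend_def face_coeff_sum
    using assms faces_finite inj_image_eq_iff[OF B_inj[OF assms(1)]]
    by (intro sum.cong) (auto simp: face_coeff_face)
  then show ?thesis using assms by simp
qed

lemma act_eps:
  fixes p :: "'f::field vpoly"
  assumes "g \<in> B n" "p \<in> M n k"
  shows "act n g (eps n p) = eps n (act n g p)"
proof (rule M_linear_eq[OF vlinear_compose[OF vlinear_act vlinear_eps] vlinear_compose[OF vlinear_eps vlinear_act] _ assms(2)])
  fix x assume "x \<in> L n k"
  then have x: "x \<in> faces n" by (rule L_faces)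
  have "inj_on g (free n x)" using B_inj[OF assms(1)] inj_on_subset by blast
  then show "act n g (eps n (face x)) = eps n (act n g (face x :: 'f vpoly))"
    using x assms by (simp add: eps_face act_face image_faces insert_free_faces image_free sum.reindex)
qed

lemma act_del:
  fixes p :: "'f::field vpoly"
  assumes "g \<in> B n" "p \<in> M n k"
  shows "act n g (del n p) = del n (act n g p)"
proof (rule M_linear_eq[OF vlinear_compose[OF vlinear_act vlinear_del] vlinear_compose[OF vlinear_del vlinear_act] _ assms(2)])
  fix x assume "x \<in> L n k"
  then have x: "x \<in> faces n" by (rule L_faces)
  have "inj_on g x" using B_inj[OF assms(1)] inj_on_subset by blast
  moreover have "g ` (x - {u}) = g ` x - {g u}" for u using image_set_diff[OF B_inj[OF assms(1)]] by simp
  ultimately show "act n g (del n (face x)) = del n (act n g (face x :: 'f vpoly))"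
    using x assms by (simp add: del_face act_face image_faces remove_faces sum.reindex)
qed

lemma act_sigma:
  fixes p :: "'f::field vpoly"
  assumes "g \<in> B n" "p \<in> M n k"
  shows "act n g (sigma n p) = sigma n (act n g p)"
proof (rule M_linear_eq[OF vlinear_compose[OF vlinear_act vlinear_sigma] vlinear_compose[OF vlinear_sigma vlinear_act] _ assms(2)])
  fix x assume "x \<in> L n k"
  then have x: "x \<in> faces n" by (rule L_faces)
  have "inj_on g x" using B_inj[OF assms(1)] inj_on_subset by blast
  moreover have "g ` (x - {u}) = g ` x - {g u}" for u using image_set_diff[OF B_inj[OF assms(1)]] by simp
  ultimately show "act n g (sigma n (face x)) = sigma n (act n g (face x :: 'f vpoly))"
    using x assms by (simp add: sigma_face act_face image_faces flip_faces sum.reindex B_bar)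
qed

definition flip :: "nat \<Rightarrow> vertex \<Rightarrow> vertex"
  where "flip i v = (if fst v = i then bar v else v)"

lemma flip_flip [simp]: "flip i (flip i v) = v"
  by (simp add: flip_def)

lemma flip_B: "i \<in> {1..n} \<Longrightarrow> flip i \<in> B n"
  unfolding B_def
  by (auto intro!: bij_imp_permutes bij_betwI[of _ _ _ "flip i"] simp: flip_def)
    (auto simp: V_eq)

text \<open>The sum of all flips is a class sum of the hyperoctahedral group; it separates the \<open>E\<^sub>k\<^sub>,\<^sub>j\<close>.\<close>

lemma sum_flip:
  fixes p :: "'f::field vpoly"
  assumes "p \<in> M n k"
  shows "(\<Sum>i\<in>{1..n}. act n (flip i) p) = sigma n p + scale (of_nat (n - k)) p"
proof (rule M_linear_eq[OF _ _ _ assms])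
  show "vlinear (\<lambda>p. \<Sum>i\<in>{1..n}. act n (flip i) p)"
    by (simp add: vlinear_iff sum.distrib vpoly.scale_sum_right)
  show "vlinear (\<lambda>p. sigma n p + scale (of_nat (n - k)) p)"
    by (simp add: vlinear_iff vpoly.scale_right_distrib mult.commute)
  fix x assume "x \<in> L n k"
  then have x: "x \<in> faces n" "finite x" "card x = k" "x \<subseteq> V n" "\<forall>v\<in>x. bar v \<notin> x"
    using L_faces L_finite by (auto simp: L_iff)
  have inj: "inj_on fst x" using x by (auto simp: inj_on_def fst_eq_iff_bar)
  have sub: "fst ` x \<subseteq> {1..n}" using x by (auto simp: V_eq)
  have on: "flip (fst u) ` x = insert (bar u) (x - {u})" if "u \<in> x" for u
  proof -
    have "flip (fst u) v = v" if "v \<in> x - {u}" for v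
      using inj that \<open>u \<in> x\<close> by (auto simp: flip_def inj_on_def)
    then have "flip (fst u) ` (x - {u}) = x - {u}" by simp
    moreover have "flip (fst u) u = bar u" by (simp add: flip_def)
    moreover have "flip (fst u) ` insert u (x - {u}) = insert (flip (fst u) u) (flip (fst u) ` (x - {u}))" by blast
    ultimately show ?thesis using that by (simp add: insert_absorb)
  qed
  have off: "flip i ` x = x" if "i \<notin> fst ` x" for i
  proof -
    have "flip i v = v" if "v \<in> x" for v using \<open>i \<notin> fst ` x\<close> that by (auto simp: flip_def)
    then show ?thesis by simp
  qed
  have "(\<Sum>i\<in>{1..n}. act n (flip i) (face x :: 'f vpoly)) = (\<Sum>i\<in>{1..n}. face (flip i ` x))"
    using x by (simp add: act_face)
  \<comment> \<open>The \<open>n - k\<close> indices that do not occur in \<open>x\<close> fix it;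
    the others flip one vertex each.\<close>
  also have "\<dots> = (\<Sum>i\<in>{1..n} - fst ` x. face (flip i ` x)) + (\<Sum>i\<in>fst ` x. face (flip i ` x))"
    by (rule sum.subset_diff[OF sub]) simp
  also have "(\<Sum>i\<in>{1..n} - fst ` x. face (flip i ` x)) = (\<Sum>i\<in>{1..n} - fst ` x. (face x :: 'f vpoly))"
    by (rule sum.cong) (auto simp: off)
  also have "\<dots> = scale (of_nat (n - k)) (face x)"
    unfolding sum_const_scale using sub x card_image[OF inj] by (simp add: card_Diff_subset)
  also have "(\<Sum>i\<in>fst ` x. face (flip i ` x)) = (\<Sum>u\<in>x. face (insert (bar u) (x - {u})) :: 'f vpoly)"
    unfolding sum.reindex[OF inj] by (rule sum.cong) (auto simp: on)
  also have "\<dots> = sigma n (face x)" using x by (simp add: sigma_face)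
  finally show "(\<Sum>i\<in>{1..n}. act n (flip i) (face x)) = sigma n (face x) + scale (of_nat (n - k)) (face x :: 'f vpoly)"
    by (simp add: add.commute)
qed

section \<open>Isomorphisms of modules\<close>

lemma B_isomorphicI:
  assumes "bij_betw \<phi> U W" "\<And>u v. u \<in> U \<Longrightarrow> v \<in> U \<Longrightarrow> \<phi> (u + v) = \<phi> u + \<phi> v"
    "\<And>c u. u \<in> U \<Longrightarrow> \<phi> (scale c u) = scale c (\<phi> u)"
    "\<And>g u. g \<in> B n \<Longrightarrow> u \<in> U \<Longrightarrow> \<phi> (act n g u) = act n g (\<phi> u)"
  shows "B_isomorphic n U W"
  using assms unfolding B_isomorphic_def by blast

lemma B_isomorphic_refl: "B_isomorphic n U U"
  by (rule B_isomorphicI[of id]) auto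

lemma B_isomorphic_trans:
  assumes "B_isomorphic n U W" "B_isomorphic n W X"
  shows "B_isomorphic n U X"
proof -
  obtain \<phi> where \<phi>: "bij_betw \<phi> U W" "\<forall>u\<in>U. \<forall>v\<in>U. \<phi> (u + v) = \<phi> u + \<phi> v"
    "\<forall>c. \<forall>u\<in>U. \<phi> (scale c u) = scale c (\<phi> u)" "\<forall>g\<in>B n. \<forall>u\<in>U. \<phi> (act n g u) = act n g (\<phi> u)"
    using assms(1) unfolding B_isomorphic_def by blast
  obtain \<psi> where \<psi>: "bij_betw \<psi> W X" "\<forall>u\<in>W. \<forall>v\<in>W. \<psi> (u + v) = \<psi> u + \<psi> v"
    "\<forall>c. \<forall>u\<in>W. \<psi> (scale c u) = scale c (\<psi> u)" "\<forall>g\<in>B n. \<forall>u\<in>W. \<psi> (act n g u) = act n g (\<psi> u)"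
    using assms(2) unfolding B_isomorphic_def by blast
  show ?thesis
    by (rule B_isomorphicI[of "\<psi> \<circ> \<phi>"])
      (use \<phi> \<psi> bij_betwE[OF \<phi>(1)] in \<open>auto intro: bij_betw_trans\<close>)
qed

text \<open>\<open>inv_into U\<close> inverts the map on \<open>U\<close>, so each identity is
  pulled back to preimages; this uses that \<open>U\<close> is closed under the module
  operations.\<close>

lemma B_isomorphic_sym:
  assumes "B_isomorphic n U W" "B_submodule n U"
  shows "B_isomorphic n W U"
proof -
  obtain \<phi> where \<phi>: "bij_betw \<phi> U W" "\<forall>u\<in>U. \<forall>v\<in>U. \<phi> (u + v) = \<phi> u + \<phi> v"
    "\<forall>c. \<forall>u\<in>U. \<phi> (scale c u) = scale c (\<phi> u)" "\<forall>g\<in>B n. \<forall>u\<in>U. \<phi> (act n g u) = act n g (\<phi> u)"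
    using assms(1) unfolding B_isomorphic_def by blast
  let ?\<psi> = "inv_into U \<phi>"
  have W: "\<exists>u\<in>U. w = \<phi> u" if "w \<in> W" for w using \<phi>(1) that by (auto simp: bij_betw_def)
  have inv: "?\<psi> (\<phi> u) = u" if "u \<in> U" for u using \<phi>(1) that by (simp add: bij_betw_def)
  have U: "u + v \<in> U" "scale c u \<in> U" "act n g u \<in> U" if "u \<in> U" "v \<in> U" "g \<in> B n" for u v c g
    using assms(2) that vpoly.subspace_add vpoly.subspace_scale unfolding B_submodule_def by auto
  show ?thesis
  proof (rule B_isomorphicI[of ?\<psi>])
    show "bij_betw ?\<psi> W U" by (rule bij_betw_inv_into[OF \<phi>(1)])
  next
    fix w w' assume "w \<in> W" "w' \<in> W"
    then obtain u u' where "u \<in> U" "w = \<phi> u" "u' \<in> U" "w' = \<phi> u'" using W by blast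
    then show "?\<psi> (w + w') = ?\<psi> w + ?\<psi> w'" using \<phi>(2) U(1)[OF _ _ B_id] inv by metis
  next
    fix c w assume "w \<in> W"
    then obtain u where "u \<in> U" "w = \<phi> u" using W by blast
    then show "?\<psi> (scale c w) = scale c (?\<psi> w)" using \<phi>(3) U(2)[OF _ _ B_id] inv by metis
  next
    fix g w assume "w \<in> W" "g \<in> B n"
    then obtain u where "u \<in> U" "w = \<phi> u" using W by blast
    then show "?\<psi> (act n g w) = act n g (?\<psi> w)" using \<phi>(4) U(3) inv \<open>g \<in> B n\<close> by metis
  qed
qed

text \<open>
  Each factor is killed by \<open>\<partial>\<close>, so with \<open>|b| = j\<close> this is an element of \<open>E\<^sub>k\<^sub>,\<^sub>j\<^sub>,\<^sub>i\<close> at the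
  lowest level \<open>k = i + j\<close>.
\<close>

fun hvec :: "nat \<Rightarrow> vertex set \<Rightarrow> 'f::field vpoly" where
  "hvec 0 b = bracket {} b"
| "hvec (Suc i) b = (var (alpha (2*i+1)) + var (bar (alpha (2*i+1)))
      - var (alpha (2*i+2)) - var (bar (alpha (2*i+2)))) * hvec i b"

section \<open>Explicit nonzero eigenvectors at the lowest level\<close>

lemma alpha_V [simp]: "alpha i \<in> V n \<longleftrightarrow> i \<in> {1..n}"
  by (simp add: alpha_def V_eq)

lemma fst_alpha [simp]: "fst (alpha i) = i"
  by (simp add: alpha_def)

lemma bracket_empty_nonzero:
  assumes "b \<subseteq> Vdot n"
  shows "bracket {} b \<noteq> (0 :: 'f::field vpoly)"
proof -
  have "finite b" using assms finite_subset[OF Vdot_subset_V finite_V] finite_subset by blast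
  then show ?thesis using assms
  proof (induction b rule: finite_induct)
    case empty
    then show ?case by (simp add: bracket_def)
  next
    case (insert v b)
    have inj: "inj_on fst (Vdot n)" by (auto simp: inj_on_def Vdot_eq)
    then have v: "v \<in> V n" "fst v \<notin> fst ` b"
      using insert Vdot_subset_V inj_on_image_mem_iff[OF inj, of v b] by auto
    have q: "(bracket {} b :: 'f vpoly) \<in> MS n (fst ` b) (card b)"
      using bracket_properties(1)[of "{}" n b, where 'f = 'f] insert by auto
    have nz: "bracket {} b \<noteq> (0 :: 'f vpoly)" using insert by auto
    have c: "contract n v (bracket {} (insert v b) :: 'f vpoly) = bracket {} b"
      using v insert contract_var_times[OF q, of v v] contract_var_times[OF q, of v "bar v"]
      by (simp add: bracket_insert left_diff_distrib vlinear_simps[OF vlinear_contract])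
    show ?case
    proof
      assume "bracket {} (insert v b) = (0 :: 'f vpoly)"
      then show False using c nz vlinear_simps(4)[OF vlinear_contract] by metis
    qed
  qed
qed

text \<open>Each factor has \<open>sigma\<close>-eigenvalue 1, and \<open>del\<close> sends it to
  \<open>1 + 1 - 1 - 1 = 0\<close>; the product rule transfers both to the product. Contracting with
  one vertex of the last factor recovers the previous vector, so it is nonzero.\<close>

lemma hvec_properties:
  assumes b: "b \<subseteq> Vdot n" and disj: "\<forall>v\<in>b. 2 * i < fst v" and i: "2 * i \<le> n"
  shows "(hvec i b :: 'f::field vpoly) \<in> MS n ({1..2*i} \<union> fst ` b) (i + card b)"
    and "sigma n (hvec i b :: 'f vpoly) = scale (of_int (int i - int (card b))) (hvec i b)"
    and "del n (hvec i b :: 'f vpoly) = 0"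
    and "hvec i b \<noteq> (0 :: 'f vpoly)"
proof -
  have "(hvec i b :: 'f vpoly) \<in> MS n ({1..2*i} \<union> fst ` b) (i + card b) \<and>
     sigma n (hvec i b :: 'f vpoly) = scale (of_int (int i - int (card b))) (hvec i b) \<and>
     del n (hvec i b :: 'f vpoly) = 0 \<and> hvec i b \<noteq> (0 :: 'f vpoly)"
    using disj i
  proof (induction i)
    case 0
    have "finite b" using b finite_subset[OF Vdot_subset_V finite_V] finite_subset by blast
    then have "del n (bracket {} b :: 'f vpoly) = 0" using b
    proof (induction b rule: finite_induct)
      case empty
      then show ?case using del_face[of "{}" n, where 'a = 'f] by (simp add: bracket_def face_def faces_iff)
    next
      case (insert v b)
      have inj: "inj_on fst (Vdot n)" by (auto simp: inj_on_def Vdot_eq)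
      then have v: "v \<in> V n" "fst v \<notin> fst ` b"
        using insert Vdot_subset_V inj_on_image_mem_iff[OF inj, of v b] by auto
      then have bv: "bar v \<in> V n" "fst (bar v) \<notin> fst ` b" by auto
      have q: "(bracket {} b :: 'f vpoly) \<in> MS n (fst ` b) (card b)"
        using bracket_properties(1)[of "{}" n b, where 'f = 'f] insert by auto
      then show ?case using insert var_times(3)[OF q v] var_times(3)[OF q bv]
        by (simp add: bracket_insert left_diff_distrib)
    qed
    then show ?case using bracket_properties[of "{}" n b, where 'f = 'f] bracket_empty_nonzero[OF b] b
      by simp
  next
    case (Suc i)
    let ?I = "{1..2*i} \<union> fst ` b"
    let ?v = "alpha (2*i+1)" and ?w = "alpha (2*i+2)"
    let ?h = "hvec i b :: 'f vpoly"
    have nb: "2*i+1 \<notin> fst ` b" "2*i+2 \<notin> fst ` b" using Suc.prems by auto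
    have q: "?h \<in> MS n ?I (i + card b)" "sigma n ?h = scale (of_int (int i - int (card b))) ?h"
      "del n ?h = 0" "?h \<noteq> 0"
      using Suc by fastforce+
    have V: "?v \<in> V n" "?w \<in> V n" "bar ?v \<in> V n" "bar ?w \<in> V n" using Suc.prems by auto
    have I: "fst ?v \<notin> ?I" "fst ?w \<notin> ?I" "fst (bar ?v) \<notin> ?I" "fst (bar ?w) \<notin> ?I" using nb by auto
    note t = var_times[OF q(1) V(1) I(1)] var_times[OF q(1) V(2) I(2)]
      var_times[OF q(1) V(3) I(3)] var_times[OF q(1) V(4) I(4)]
    have eq: "(hvec (Suc i) b :: 'f vpoly) = var ?v * ?h + var (bar ?v) * ?h - var ?w * ?h - var (bar ?w) * ?h"
      by (simp add: left_diff_distrib distrib_right)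
    let ?J = "{1..2 * Suc i} \<union> fst ` b"
    \<comment> \<open>The four products use different index sets; all are embedded in the common
      \<open>?J\<close>.\<close>
    have up: "p \<in> MS n ?J (Suc i + card b)" if "p \<in> MS n (insert c ?I) (Suc (i + card b))" "c \<in> ?J"
      for p :: "'f vpoly" and c
      by (rule MS_linear_in[OF vlinear_id subspace_MS that(1)]) (use that(2) in \<open>auto intro!: face_in_MS\<close>)
    have mem: "(hvec (Suc i) b :: 'f vpoly) \<in> MS n ?J (Suc i + card b)"
      unfolding eq by (intro vpoly.subspace_diff[OF subspace_MS] vpoly.subspace_add[OF subspace_MS]
          up[OF t(1)] up[OF t(4)] up[OF t(7)] up[OF t(10)]) auto
    have sig: "sigma n (hvec (Suc i) b :: 'f vpoly) = scale (of_int (int (Suc i) - int (card b))) (hvec (Suc i) b)"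
      unfolding eq op_simps t(2,5,8,11) q(2) scale_mult_right bar_bar
      by (simp add: vpoly.scale_right_diff_distrib vpoly.scale_right_distrib
          vpoly.scale_left_diff_distrib vpoly.scale_left_distrib)
    have del: "del n (hvec (Suc i) b :: 'f vpoly) = 0"
      unfolding eq op_simps t(3,6,9,12) q(3) by simp
    have "contract n ?v (hvec (Suc i) b :: 'f vpoly) = ?h"
      unfolding eq vlinear_simps[OF vlinear_contract]
        contract_var_times[OF q(1) V(1) V(1) I(1) I(1)] contract_var_times[OF q(1) V(1) V(2) I(1) I(2)]
        contract_var_times[OF q(1) V(1) V(3) I(1) I(3)] contract_var_times[OF q(1) V(1) V(4) I(1) I(4)]
      by (auto simp: alpha_def bar_def)
    then have "hvec (Suc i) b \<noteq> (0 :: 'f vpoly)" using q(4) vlinear_simps(4)[OF vlinear_contract] by metis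
    with mem sig del show ?case by blast
  qed
  then show "(hvec i b :: 'f::field vpoly) \<in> MS n ({1..2*i} \<union> fst ` b) (i + card b)"
    and "sigma n (hvec i b :: 'f vpoly) = scale (of_int (int i - int (card b))) (hvec i b)"
    and "del n (hvec i b :: 'f vpoly) = 0"
    and "hvec i b \<noteq> (0 :: 'f vpoly)" by auto
qed

section \<open>Isomorphisms between levels, and the index \<open>j\<close> as an invariant\<close>

context large_char
begin

lemma B_submodule_Ekji:
  assumes "j \<le> k" "k \<le> n"
  shows "B_submodule n (Ekji n k j i :: 'f vpoly set)"
  unfolding B_submodule_def
proof (intro conjI subspace_Ekji ballI)
  fix g and v :: "'f vpoly" assume g: "g \<in> B n" and v: "v \<in> Ekji n k j i"
  have v': "v \<in> M n k" "sigma n v = scale (of_int (int k - 2 * int j)) v"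
    "del n (eps n v) = scale (lam n k j i) v"
    using v Ekji_iff[OF assms] by (auto simp: nu_plus_def)
  show "act n g v \<in> Ekji n k j i"
    unfolding Ekji_iff[OF assms] nu_plus_def
    by (simp only: act_M[OF g v'(1)] act_sigma[OF g v'(1), symmetric] act_eps[OF g v'(1), symmetric]
        act_del[OF g eps_M[OF v'(1)], symmetric] v'(2,3) op_simps simp_thms)
qed

text \<open>The inverse of \<open>eps\<close> is \<open>del\<close> divided by the eigenvalue; the
  bounds on \<open>i\<close> keep the latter nonzero.\<close>

lemma Ekji_isomorphic_Suc:
  assumes "j \<le> k" "k < n" "i \<le> k - j" "i \<le> n - Suc k"
  shows "B_isomorphic n (Ekji n k j i :: 'f vpoly set) (Ekji n (Suc k) j i)"
proof (rule B_isomorphicI[of "eps n"])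
  have l: "(lam n k j i :: 'f) \<noteq> 0" using lam_nonzero assms by simp
  show "bij_betw (eps n) (Ekji n k j i :: 'f vpoly set) (Ekji n (Suc k) j i)"
  proof (rule bij_betw_byWitness[of _ "\<lambda>p. scale (1 / lam n k j i) (del n p)"])
    show "\<forall>p\<in>Ekji n k j i. scale (1 / lam n k j i) (del n (eps n p)) = (p :: 'f vpoly)"
      using l by (auto simp: Ekji_iff_Ekj)
    show "\<forall>p\<in>Ekji n (Suc k) j i. eps n (scale (1 / lam n k j i) (del n p)) = (p :: 'f vpoly)"
      using l del_Ekji(2) assms by auto
    show "eps n ` Ekji n k j i \<subseteq> (Ekji n (Suc k) j i :: 'f vpoly set)"
      using eps_Ekji assms by auto
    show "(\<lambda>p. scale (1 / lam n k j i) (del n p)) ` Ekji n (Suc k) j i \<subseteq> (Ekji n k j i :: 'f vpoly set)"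
      using del_Ekji(1) assms vpoly.subspace_scale[OF subspace_Ekji] by auto
  qed
  show "eps n (act n g p) = act n g (eps n p)" if "g \<in> B n" "p \<in> Ekji n k j i" for g and p :: "'f vpoly"
    using that act_eps[of g n p k] Ekji_iff assms by auto
qed simp_all

lemma Ekji_isomorphic_le:
  assumes "j \<le> k" "k \<le> k'" "k' \<le> n" "i \<le> k - j" "i \<le> n - k'"
  shows "B_isomorphic n (Ekji n k j i :: 'f vpoly set) (Ekji n k' j i)"
  using assms(2,1,3-)
proof (induction k' rule: dec_induct)
  case base
  show ?case by (rule B_isomorphic_refl)
next
  case (step k')
  have "B_isomorphic n (Ekji n k j i :: 'f vpoly set) (Ekji n k' j i)" using step by auto
  moreover have "B_isomorphic n (Ekji n k' j i :: 'f vpoly set) (Ekji n (Suc k') j i)"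
    using step by (intro Ekji_isomorphic_Suc) auto
  ultimately show ?case by (rule B_isomorphic_trans)
qed

lemma Ekji_isomorphic:
  assumes "j \<le> k" "k \<le> n" "i \<le> min (k - j) (n - k)" "j \<le> k'" "k' \<le> n" "i \<le> min (k' - j) (n - k')"
  shows "B_isomorphic n (Ekji n k j i :: 'f vpoly set) (Ekji n k' j i)"
proof (cases "k \<le> k'")
  case True
  then show ?thesis using assms by (intro Ekji_isomorphic_le) auto
next
  case False
  then have "B_isomorphic n (Ekji n k' j i :: 'f vpoly set) (Ekji n k j i)"
    using assms by (intro Ekji_isomorphic_le) auto
  then show ?thesis using B_isomorphic_sym B_submodule_Ekji assms by blast
qed

lemma B_isomorphic_nonzero:
  assumes "B_isomorphic n U W" "B_submodule n U" "U \<noteq> {0}"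
  shows "W \<noteq> {0}"
proof
  assume "W = {0}"
  obtain \<phi> where \<phi>: "bij_betw \<phi> U W" using assms(1) unfolding B_isomorphic_def by blast
  have "0 \<in> U" using assms(2) vpoly.subspace_0 by (auto simp: B_submodule_def)
  moreover have "inj_on \<phi> U" "\<phi> ` U = {0}" using \<phi> \<open>W = {0}\<close> by (auto simp: bij_betw_def)
  ultimately have "u = 0" if "u \<in> U" for u using that unfolding inj_on_def by (metis image_eqI singletonD)
  then show False using assms(3) \<open>0 \<in> U\<close> by blast
qed

text \<open>The vector \<open>hvec\<close> shows it at level \<open>i + j\<close>, and the
  isomorphism between levels carries it to level \<open>k\<close>.\<close>

lemma Ekji_nonzero:
  assumes "j \<le> k" "k \<le> n" "i \<le> min (k - j) (n - k)"
  shows "(Ekji n k j i :: 'f vpoly set) \<noteq> {0}"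
proof -
  \<comment> \<open>The differences use the last \<open>j\<close> indices and the other factors of
    \<open>hvec\<close> the first \<open>2 * i\<close>; these are disjoint since
    \<open>2 * i + j \<le> (k - j) + (n - k) + j = n\<close>.\<close>
  let ?b = "alpha ` {n - j<..n}"
  let ?h = "hvec i ?b :: 'f vpoly"
  have b: "?b \<subseteq> Vdot n" "card ?b = j" "\<forall>v\<in>?b. 2 * i < fst v" "2 * i \<le> n"
    using assms by (auto simp: Vdot_def card_image inj_on_def alpha_def)
  note h = hvec_properties[OF b(1,3,4), where 'f = 'f]
  have ij: "i + j \<le> n" "j \<le> i + j" using assms by auto
  have "?h \<in> Ekj n (i + j) j"
    using h(1,2) MS_M assms unfolding b(2) by (subst Ekj_iff) (auto simp: algebra_simps)
  moreover from this have "del n (eps n ?h) = scale (of_int (2 * (int n + int j - 2 * int (i + j)))) ?h"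
    using del_eps_Ekj[of j "i + j" ?h] h(3) ij by simp
  moreover have "(lam n (i + j) j i :: 'f) = of_int (2 * (int n + int j - 2 * int (i + j)))"
    unfolding lam_def by (rule arg_cong[of _ _ of_int]) (simp add: algebra_simps)
  ultimately have "?h \<in> Ekji n (i + j) j i" by (simp add: Ekji_iff_Ekj)
  then have "(Ekji n (i + j) j i :: 'f vpoly set) \<noteq> {0}" using h(4) by blast
  moreover have "B_isomorphic n (Ekji n (i + j) j i :: 'f vpoly set) (Ekji n k j i)"
    using assms by (intro Ekji_isomorphic) auto
  ultimately show ?thesis using B_isomorphic_nonzero B_submodule_Ekji[OF ij(2,1)] by blast
qed

text \<open>The sum of all flips acts on \<open>Ekji\<close> as
  \<open>(k - 2 * j) + (n - k) = n - 2 * j\<close>, a scalar free of \<open>k\<close> and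
  \<open>i\<close> that any isomorphism preserves.\<close>

lemma isomorphic_imp_j_eq:
  assumes "j \<le> k" "k \<le> n" "j' \<le> k'" "k' \<le> n" "(Ekji n k j i :: 'f vpoly set) \<noteq> {0}"
    and iso: "B_isomorphic n (Ekji n k j i :: 'f vpoly set) (Ekji n k' j' i')"
  shows "j = j'"
proof -
  let ?U = "Ekji n k j i :: 'f vpoly set" and ?W = "Ekji n k' j' i' :: 'f vpoly set"
  obtain \<phi> where \<phi>: "bij_betw \<phi> ?U ?W" "\<forall>u\<in>?U. \<forall>v\<in>?U. \<phi> (u + v) = \<phi> u + \<phi> v"
    "\<forall>c. \<forall>u\<in>?U. \<phi> (scale c u) = scale c (\<phi> u)" "\<forall>g\<in>B n. \<forall>u\<in>?U. \<phi> (act n g u) = act n g (\<phi> u)"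
    using iso unfolding B_isomorphic_def by blast
  have U: "vpoly.subspace ?U" by (rule subspace_Ekji)
  have act: "act n g u \<in> ?U" if "g \<in> B n" "u \<in> ?U" for g u
    using B_submodule_Ekji assms that by (auto simp: B_submodule_def)
  have \<phi>0: "\<phi> 0 = 0" using \<phi>(3)[rule_format, of 0 0] vpoly.subspace_0[OF U] by simp
  obtain u where u: "u \<in> ?U" "u \<noteq> 0" using assms(5) vpoly.subspace_0[OF U] by blast
  have w: "\<phi> u \<in> ?W" "\<phi> u \<noteq> 0"
    using \<phi>(1) u \<phi>0 vpoly.subspace_0[OF U] by (auto simp: bij_betw_def inj_on_def)
  have Z: "(\<Sum>i\<in>{1..n}. act n (flip i) v) = scale (of_int (int n - 2 * int j)) v"
    if "j \<le> k" "k \<le> n" "v \<in> Ekji n k j i" for v :: "'f vpoly" and k j i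
  proof -
    have v: "v \<in> M n k" "sigma n v = scale (of_int (int k - 2 * int j)) v"
      using that Ekji_iff[of j k v i] by auto
    have "of_int (int n - 2 * int j) = (of_int (int k - 2 * int j) + of_nat (n - k) :: 'f)"
      using that by (simp add: of_nat_diff)
    then show ?thesis unfolding sum_flip[OF v(1)] v(2) by (simp only: vpoly.scale_left_distrib)
  qed
  \<comment> \<open>Additivity of \<open>\<phi>\<close> is known on \<open>?U\<close> alone, so the
    induction carries membership of the partial sums.\<close>
  have "\<phi> (\<Sum>i\<in>I. act n (flip i) u) = (\<Sum>i\<in>I. \<phi> (act n (flip i) u)) \<and> (\<Sum>i\<in>I. act n (flip i) u) \<in> ?U"
    if "finite I" "I \<subseteq> {1..n}" for I
    using that
  proof (induction I rule: finite_induct)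
    case empty
    then show ?case using \<phi>0 vpoly.subspace_0[OF U] by simp
  next
    case (insert l I)
    then have "act n (flip l) u \<in> ?U" using act flip_B u(1) by auto
    with insert show ?case using \<phi>(2) vpoly.subspace_add[OF U] by auto
  qed
  then have "\<phi> (\<Sum>i\<in>{1..n}. act n (flip i) u) = (\<Sum>i\<in>{1..n}. \<phi> (act n (flip i) u))" by blast
  also have "\<dots> = (\<Sum>i\<in>{1..n}. act n (flip i) (\<phi> u))" using \<phi>(4) u(1) flip_B by (intro sum.cong) auto
  finally have "scale (of_int (int n - 2 * int j)) (\<phi> u) = scale (of_int (int n - 2 * int j')) (\<phi> u)"
    using Z[OF assms(1,2) u(1)] Z[OF assms(3,4) w(1)] \<phi>(3) u(1) by simp
  then have "(of_int (int n - 2 * int j) :: 'f) = of_int (int n - 2 * int j')" using w(2) by simp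
  then show ?thesis using sigma_eigenvalue_inject[of j j' n] assms by simp
qed

end

section \<open>Face stabilizers and their invariants\<close>

lemma color_matching:
  fixes c :: "'a \<Rightarrow> 'c" and c' :: "'b \<Rightarrow> 'c"
  assumes fin: "finite T" "finite T'"
    and card: "\<And>col. card {t \<in> T. c t = col} = card {t \<in> T'. c' t = col}"
  shows "\<exists>f. bij_betw f T T' \<and> (\<forall>t\<in>T. c' (f t) = c t)"
proof -
  have "\<exists>h. bij_betw h {t \<in> T. c t = col} {t \<in> T'. c' t = col}" for col
    using fin card[of col] by (intro finite_same_card_bij) auto
  then obtain h where h: "\<And>col. bij_betw (h col) {t \<in> T. c t = col} {t \<in> T'. c' t = col}"
    by metis
  \<comment> \<open>Each element follows the bijection chosen for its own colour class.\<close>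
  define f where "f t = h (c t) t" for t
  have f: "f t \<in> T'" "c' (f t) = c t" if "t \<in> T" for t
    using bij_betwE[OF h[of "c t"]] that by (auto simp: f_def)
  have "inj_on f T"
  proof (rule inj_onI)
    fix s t assume st: "s \<in> T" "t \<in> T" "f s = f t"
    then have "c s = c t" using f(2) by metis
    then show "s = t" using st bij_betw_imp_inj_on[OF h[of "c t"]] by (auto simp: f_def inj_on_def)
  qed
  moreover have "t' \<in> f ` T" if "t' \<in> T'" for t'
  proof -
    have "t' \<in> h (c' t') ` {t \<in> T. c t = c' t'}"
      using bij_betw_imp_surj_on[OF h[of "c' t'"]] that by auto
    then obtain t where "t \<in> T" "c t = c' t'" "t' = h (c' t') t" by auto
    then show ?thesis unfolding f_def by force
  qed
  ultimately show ?thesis using f by (auto simp: bij_betw_def)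
qed

text \<open>
  Colouring a transversal of the antipodal pairs by membership in \<open>x\<close>, \<open>y\<close> and the antipode of
  \<open>y\<close> reduces transitivity on pairs of faces to matching the colour classes.
\<close>

definition transversal :: "nat \<Rightarrow> vertex set \<Rightarrow> vertex set \<Rightarrow> vertex set"
  where "transversal n x y = x \<union> (y - bar ` x) \<union> (Vdot n \<inter> free n x \<inter> free n y)"

lemma bar_mem_image: "v \<in> bar ` x \<longleftrightarrow> bar v \<in> x"
  by (metis bar_bar image_iff)

lemma transversal:
  assumes "x \<in> faces n" "y \<in> faces n"
  shows "transversal n x y \<subseteq> V n"
    and "v \<in> V n \<Longrightarrow> bar v \<in> transversal n x y \<longleftrightarrow> v \<notin> transversal n x y"
proof -
  show "transversal n x y \<subseteq> V n"
    using assms Vdot_subset_V by (auto simp: transversal_def faces_iff)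
  have x: "v \<in> x \<Longrightarrow> bar v \<notin> x" "v \<in> y \<Longrightarrow> bar v \<notin> y" "bar v \<in> x \<Longrightarrow> v \<notin> x" "bar v \<in> y \<Longrightarrow> v \<notin> y"
    using assms by (auto simp: faces_iff)
  assume "v \<in> V n"
  then have "bar v \<in> Vdot n \<longleftrightarrow> v \<notin> Vdot n" by (cases v) (auto simp: V_eq Vdot_eq bar_def)
  then show "bar v \<in> transversal n x y \<longleftrightarrow> v \<notin> transversal n x y"
    using x \<open>v \<in> V n\<close> by (auto simp: transversal_def bar_mem_image free_def)
qed

lemma card_transversal:
  assumes "x \<in> faces n" "y \<in> faces n"
  shows "card (transversal n x y) = n"
proof -
  note T = transversal[OF assms]
  have fin: "finite (transversal n x y)" using T(1) finite_subset by blast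
  have "V n = transversal n x y \<union> bar ` transversal n x y"
    using T by (auto simp: bar_mem_image)
  moreover have "transversal n x y \<inter> bar ` transversal n x y = {}"
    using T by (auto simp: bar_mem_image)
  ultimately have "2 * n = card (transversal n x y) + card (bar ` transversal n x y)"
    using fin card_V[of n] by (simp add: card_Un_disjoint)
  then show ?thesis by (simp add: card_image inj_on_def)
qed

text \<open>The explicit sizes show that the colour classes depend only on \<open>n\<close>, the
  sizes of \<open>x\<close> and \<open>y\<close>, and how \<open>y\<close> meets \<open>x\<close>
  and its antipode.\<close>

lemma card_transversal_color:
  assumes "x \<in> faces n" "y \<in> faces n"
  shows "card {t \<in> transversal n x y. (t \<in> x, t \<in> y, bar t \<in> y) = col} =
    (if col = (True, True, False) then card (y \<inter> x)
     else if col = (True, False, True) then card (y \<inter> bar ` x)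
     else if col = (True, False, False) then card x - (card (y \<inter> x) + card (y \<inter> bar ` x))
     else if col = (False, True, False) then card y - (card (y \<inter> x) + card (y \<inter> bar ` x))
     else if col = (False, False, False) then n - (card x + card y - (card (y \<inter> x) + card (y \<inter> bar ` x)))
     else 0)" (is "card (?C col) = ?R")
proof -
  have x: "\<forall>v\<in>x. bar v \<notin> x" "\<forall>v\<in>y. bar v \<notin> y" "finite x" "finite y"
    using assms by (auto simp: faces_iff faces_finite)
  let ?B = "{t \<in> x. bar t \<in> y}"
  have "bar ` ?B = y \<inter> bar ` x" by (auto simp: bar_mem_image)
  then have cB: "card ?B = card (y \<inter> bar ` x)" by (metis (no_types, lifting) bar_inject card_image inj_onI)
  have C1: "?C (True, True, False) = y \<inter> x" using x by (auto simp: transversal_def)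
  have C2: "?C (True, False, True) = ?B" using x by (auto simp: transversal_def)
  have C3: "?C (True, False, False) = x - (y \<inter> x \<union> ?B)" by (auto simp: transversal_def)
  have C4: "?C (False, True, False) = y - (y \<inter> x \<union> (y \<inter> bar ` x))"
    using x by (auto simp: transversal_def bar_mem_image free_def)
  have C5: "?C (False, False, False) = transversal n x y - (x \<union> (y - (y \<inter> x \<union> (y \<inter> bar ` x))))"
    using x by (auto simp: transversal_def bar_mem_image free_def)
  have C6: "?C (True, True, True) = {}" "?C (False, True, True) = {}" "?C (False, False, True) = {}"
    using x by (auto simp: transversal_def bar_mem_image free_def)
  have d1: "card (y \<inter> x \<union> ?B) = card (y \<inter> x) + card (y \<inter> bar ` x)"
    unfolding cB[symmetric] using x by (intro card_Un_disjoint) auto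
  have d2: "card (y \<inter> x \<union> (y \<inter> bar ` x)) = card (y \<inter> x) + card (y \<inter> bar ` x)"
    using x by (intro card_Un_disjoint) (auto simp: bar_mem_image)
  have d3: "card (x - (y \<inter> x \<union> ?B)) = card x - (card (y \<inter> x) + card (y \<inter> bar ` x))"
    unfolding d1[symmetric] using x by (intro card_Diff_subset) auto
  have d4: "card (y - (y \<inter> x \<union> (y \<inter> bar ` x))) = card y - (card (y \<inter> x) + card (y \<inter> bar ` x))"
    unfolding d2[symmetric] using x by (intro card_Diff_subset) auto
  have le: "card (y \<inter> x) + card (y \<inter> bar ` x) \<le> card y"
    unfolding d2[symmetric] using x by (intro card_mono) auto
  have "card (x \<union> (y - (y \<inter> x \<union> (y \<inter> bar ` x)))) = card x + card (y - (y \<inter> x \<union> (y \<inter> bar ` x)))"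
    using x by (intro card_Un_disjoint) auto
  also have "\<dots> = card x + card y - (card (y \<inter> x) + card (y \<inter> bar ` x))"
    unfolding d4 using le by simp
  finally have d5: "card (transversal n x y - (x \<union> (y - (y \<inter> x \<union> (y \<inter> bar ` x))))) =
      n - (card x + card y - (card (y \<inter> x) + card (y \<inter> bar ` x)))"
    using x card_transversal[OF assms] by (subst card_Diff_subset) (auto simp: transversal_def)
  obtain a b c where col: "col = (a, b, c)" by (cases col)
  show ?thesis
    unfolding col
    by (induct a; induct b; induct c; simp only: C1 C2 C3 C4 C5 C6; simp add: d3 d4 d5 cB)
qed

text \<open>A colour-preserving bijection between the two transversals extends to a group element;
  the colours record enough to send \<open>x\<close> into \<open>x'\<close> and \<open>y\<close>
  into \<open>y'\<close>.\<close>

lemma B_transitive_on_pairs: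
  assumes x: "x \<in> faces n" "x' \<in> faces n" "card x = card x'"
    and y: "y \<in> faces n" "y' \<in> faces n" "card y = card y'"
    and xy: "card (y \<inter> x) = card (y' \<inter> x')" "card (y \<inter> bar ` x) = card (y' \<inter> bar ` x')"
  shows "\<exists>g\<in>B n. g ` x = x' \<and> g ` y = y'"
proof -
  let ?T = "transversal n x y" and ?T' = "transversal n x' y'"
  note T = transversal[OF x(1) y(1)] and T' = transversal[OF x(2) y(2)]
  have "finite ?T" "finite ?T'" using T(1) T'(1) finite_subset by blast+
  moreover have "card {t \<in> ?T. (t \<in> x, t \<in> y, bar t \<in> y) = col} =
      card {t \<in> ?T'. (t \<in> x', t \<in> y', bar t \<in> y') = col}" for col
    unfolding card_transversal_color[OF x(1) y(1)] card_transversal_color[OF x(2) y(2)]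
    by (simp only: x(3) y(3) xy)
  ultimately obtain f where f: "bij_betw f ?T ?T'"
    "\<forall>t\<in>?T. (f t \<in> x', f t \<in> y', bar (f t) \<in> y') = (t \<in> x, t \<in> y, bar t \<in> y)"
    using color_matching[of ?T ?T' "\<lambda>t. (t \<in> x, t \<in> y, bar t \<in> y)" "\<lambda>t. (t \<in> x', t \<in> y', bar t \<in> y')"]
    by blast
  \<comment> \<open>Off the transversal the values are forced by commuting with \<open>bar\<close>;
    outside \<open>V n\<close> a permutation of \<open>V n\<close> is the identity.\<close>
  define g where "g v = (if v \<in> ?T then f v else if v \<in> V n then bar (f (bar v)) else v)" for v
  have fT: "f v \<in> ?T'" "f v \<in> V n" if "v \<in> ?T" for v using f(1) T'(1) that bij_betwE by blast+
  have inj: "f u = f v \<Longrightarrow> u \<in> ?T \<Longrightarrow> v \<in> ?T \<Longrightarrow> u = v" for u v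
    using f(1) by (auto simp: bij_betw_def inj_on_def)
  have gV: "g v \<in> V n" if "v \<in> V n" for v using that fT T(2) by (auto simp: g_def)
  have gT: "g v \<in> ?T' \<longleftrightarrow> v \<in> ?T" if "v \<in> V n" for v
    using that fT T(2)[of v] T'(2) by (auto simp: g_def)
  have gbar: "g (bar v) = bar (g v)" if "v \<in> V n" for v
    using that T(2)[of v] T(1) by (auto simp: g_def)
  have "inj_on g (V n)"
  proof (rule inj_onI)
    fix u v assume uv: "u \<in> V n" "v \<in> V n" "g u = g v"
    then have "u \<in> ?T \<longleftrightarrow> v \<in> ?T" using gT by metis
    then show "u = v" using uv inj[of u v] inj[of "bar u" "bar v"] T(2) by (auto simp: g_def split: if_splits)
  qed
  moreover have "g ` V n \<subseteq> V n" using gV by auto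
  ultimately have "bij_betw g (V n) (V n)" by (simp add: bij_betw_def endo_inj_surj)
  then have "g permutes V n" by (rule bij_imp_permutes) (use T(1) in \<open>auto simp: g_def\<close>)
  then have gB: "g \<in> B n" using gbar by (simp add: B_def)
  have "g ` x \<subseteq> x'" using f(2) by (auto simp: g_def transversal_def)
  then have "g ` x = x'"
    using card_subset_eq[OF faces_finite[OF x(2)], of "g ` x"] x(3)
      card_image[OF inj_on_subset[OF B_inj[OF gB]], of x] by simp
  moreover have "g ` y \<subseteq> y'"
  proof (rule image_subsetI)
    fix v assume v: "v \<in> y"
    then have "v \<in> V n" using y by (auto simp: faces_iff)
    show "g v \<in> y'"
    proof (cases "v \<in> ?T")
      case True
      then show ?thesis using f(2) v by (auto simp: g_def)
    next
      \<comment> \<open>Here the antipode of \<open>v\<close> lies in the transversal, and the third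
        component of its colour records that \<open>v\<close> is in \<open>y\<close>.\<close>
      case False
      then have "bar v \<in> ?T" using T(2) \<open>v \<in> V n\<close> by simp
      then show ?thesis using f(2)[rule_format, of "bar v"] v False \<open>v \<in> V n\<close> by (simp add: g_def)
    qed
  qed
  then have "g ` y = y'"
    using card_subset_eq[OF faces_finite[OF y(2)], of "g ` y"] y(3)
      card_image[OF inj_on_subset[OF B_inj[OF gB]], of y] by simp
  ultimately show ?thesis using gB by blast
qed

lemma B_transitive:
  assumes "x \<in> L n k" "x' \<in> L n k"
  shows "\<exists>g\<in>B n. g ` x = x'"
proof -
  have "{} \<in> faces n" by (simp add: faces_iff)
  then show ?thesis
    using B_transitive_on_pairs[of x n x' "{}" "{}"] assms L_faces by (auto simp: L_iff)
qed

text \<open>Group elements are signed permutations: a permutation of the indices together with the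
  set \<open>S\<close> of indices whose sign changes. The order serves to show that stabilizer
  orders are invertible.\<close>

lemma card_B: "card (B n) = fact n * 2 ^ n"
proof -
  define G where "G = (\<lambda>(\<pi>, S) v. if fst v \<in> {1..n} then (\<pi> (fst v), snd v \<longleftrightarrow> fst v \<notin> S) else (v :: vertex))"
  have "bij_betw G ({\<pi>. \<pi> permutes {1..n}} \<times> Pow {1..n}) (B n)"
    unfolding bij_betw_def
  proof (intro conjI equalityI subsetI inj_onI)
    fix p q assume "p \<in> {\<pi>. \<pi> permutes {1..n}} \<times> Pow {1..n}" "q \<in> {\<pi>. \<pi> permutes {1..n}} \<times> Pow {1..n}"
      and eq: "G p = G q"
    then obtain \<pi> S \<rho> R where pq: "p = (\<pi>, S)" "q = (\<rho>, R)" "\<pi> permutes {1..n}" "\<rho> permutes {1..n}"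
      "S \<subseteq> {1..n}" "R \<subseteq> {1..n}" by auto
    have *: "\<pi> i = \<rho> i" "i \<in> S \<longleftrightarrow> i \<in> R" if "i \<in> {1..n}" for i
      using fun_cong[OF eq, of "(i, True)"] that by (auto simp: pq G_def)
    have "\<pi> i = \<rho> i" for i
      using * pq(3,4) by (cases "i \<in> {1..n}") (auto simp: permutes_not_in)
    then show "p = q" using * pq by auto
  next
    fix g assume "g \<in> G ` ({\<pi>. \<pi> permutes {1..n}} \<times> Pow {1..n})"
    then obtain \<pi> S where g: "g = G (\<pi>, S)" and \<pi>: "\<pi> permutes {1..n}" by auto
    have mem: "\<pi> i \<in> {1..n} \<longleftrightarrow> i \<in> {1..n}" for i using permutes_in_image[OF \<pi>] .
    have inj: "\<pi> i = \<pi> i' \<longleftrightarrow> i = i'" for i i' using \<pi> permutes_inj by (metis injD)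
    have "inj_on g (V n)" by (auto simp: inj_on_def g G_def V_eq inj)
    moreover have "g v \<in> V n" if "v \<in> V n" for v
      using that mem[of "fst v"] by (cases v) (simp add: g G_def V_eq)
    then have "g ` V n \<subseteq> V n" by blast
    ultimately have "bij_betw g (V n) (V n)" by (simp add: bij_betw_def endo_inj_surj)
    then have "g permutes V n" by (rule bij_imp_permutes) (auto simp: g G_def V_eq)
    then show "g \<in> B n" by (auto simp: B_def g G_def bar_def)
  next
    fix g assume g: "g \<in> B n"
    define \<pi> where "\<pi> i = (if i \<in> {1..n} then fst (g (alpha i)) else i)" for i
    define S where "S = {i \<in> {1..n}. \<not> snd (g (alpha i))}"
    have mem: "\<pi> i \<in> {1..n}" if "i \<in> {1..n}" for i
    proof -
      have "g (alpha i) \<in> V n" using g that by simp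
      then show ?thesis using that by (auto simp: \<pi>_def V_eq)
    qed
    have "inj_on \<pi> {1..n}"
    proof (rule inj_onI)
      fix i i' assume i: "i \<in> {1..n}" "i' \<in> {1..n}" "\<pi> i = \<pi> i'"
      then have "g (alpha i) = g (alpha i') \<or> g (alpha i) = g (bar (alpha i'))"
        using B_bar[OF g] by (simp add: \<pi>_def fst_eq_iff_bar)
      then have "alpha i = alpha i' \<or> alpha i = bar (alpha i')" using B_inj[OF g] by (auto dest: injD)
      then show "i = i'" by (auto simp: alpha_def bar_def)
    qed
    moreover have "\<pi> ` {1..n} \<subseteq> {1..n}" using mem by auto
    ultimately have "bij_betw \<pi> {1..n} {1..n}" by (simp add: bij_betw_def endo_inj_surj)
    then have "\<pi> permutes {1..n}" by (rule bij_imp_permutes) (auto simp: \<pi>_def)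
    moreover have "g = G (\<pi>, S)"
    proof
      fix v :: vertex
      obtain i b where v: "v = (i, b)" by (cases v)
      show "g v = G (\<pi>, S) v"
      proof (cases "i \<in> {1..n}")
        case True
        have "g v = (if b then g (alpha i) else bar (g (alpha i)))"
          using B_bar[OF g, of "alpha i"] by (simp add: v alpha_def bar_def)
        then show ?thesis using True by (cases "g (alpha i)") (auto simp: v G_def \<pi>_def S_def bar_def)
      next
        case False
        then have "v \<notin> V n" by (auto simp: v V_eq)
        then show ?thesis using False permutes_not_in[OF B_permutes[OF g]] by (auto simp: v G_def)
      qed
    qed
    ultimately show "g \<in> G ` ({\<pi>. \<pi> permutes {1..n}} \<times> Pow {1..n})" by (auto simp: S_def)
  qed
  then have "card (B n) = card ({\<pi>. \<pi> permutes {1..n}} \<times> Pow {1..n})" by (metis bij_betw_same_card)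
  then show ?thesis using card_permutations[of "{1..n}" n] by (simp add: card_cartesian_product card_Pow)
qed

section \<open>Stabilizers, orbit counting and the invariant bilinear form\<close>

definition stab :: "nat \<Rightarrow> vertex set \<Rightarrow> (vertex \<Rightarrow> vertex) set"
  where "stab n x = {g \<in> B n. g ` x = x}"

lemma finite_stab [simp, intro!]: "finite (stab n x)"
  by (simp add: stab_def)

lemma stab_B: "g \<in> stab n x \<Longrightarrow> g \<in> B n"
  by (simp add: stab_def)

lemma comp_bij_stab:
  assumes "h \<in> B n"
  shows "bij_betw ((\<circ>) h) (stab n x) {g \<in> B n. g ` x = h ` x}"
proof (rule bij_betw_byWitness[of _ "(\<circ>) (inv h)"])
  have hi: "inv h \<circ> h = id" "h \<circ> inv h = id" using B_permutes[OF assms] permutes_inv_o by auto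
  show "\<forall>g\<in>stab n x. inv h \<circ> (h \<circ> g) = g" "\<forall>g\<in>{g \<in> B n. g ` x = h ` x}. h \<circ> (inv h \<circ> g) = g"
    by (simp_all add: hi flip: comp_assoc)
  have ic: "(h \<circ> g) ` x = h ` (g ` x)" for h g :: "vertex \<Rightarrow> vertex" by (simp add: image_comp)
  show "(\<circ>) h ` stab n x \<subseteq> {g \<in> B n. g ` x = h ` x}"
    unfolding image_subset_iff stab_def mem_Collect_eq ic using B_comp[OF assms] by simp
  show "(\<circ>) (inv h) ` {g \<in> B n. g ` x = h ` x} \<subseteq> stab n x"
    unfolding image_subset_iff stab_def mem_Collect_eq ic using B_comp[OF B_inv[OF assms]] assms by simp
qed

lemma card_B_orbit:
  assumes "x \<in> L n k"
  shows "card (B n) = card (L n k) * card (stab n x)"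
proof -
  have "B n = (\<Union>y\<in>L n k. {g \<in> B n. g ` x = y})" using image_L assms by blast
  then have "card (B n) = card (\<Union>y\<in>L n k. {g \<in> B n. g ` x = y})" by simp
  also have "\<dots> = (\<Sum>y\<in>L n k. card {g \<in> B n. g ` x = y})" by (intro card_UN_disjoint) auto
  also have "\<dots> = (\<Sum>y\<in>L n k. card (stab n x))"
  proof (rule sum.cong[OF refl])
    fix y assume "y \<in> L n k"
    then obtain h where "h \<in> B n" "h ` x = y" using B_transitive[OF assms] by blast
    then show "card {g \<in> B n. g ` x = y} = card (stab n x)"
      using bij_betw_same_card[OF comp_bij_stab[of h n x]] by simp
  qed
  finally show ?thesis by simp
qed

text \<open>The bilinear form for which faces are orthonormal. Over a general field it may have
  isotropic vectors, so nonvanishing of \<open>ip n z z\<close> has to be proved where it is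
  used.\<close>

definition ip :: "nat \<Rightarrow> 'f::field vpoly \<Rightarrow> 'f vpoly \<Rightarrow> 'f"
  where "ip n p q = (\<Sum>x\<in>faces n. face_coeff p x * face_coeff q x)"

lemma ip_commute: "ip n p q = ip n q p"
  by (simp add: ip_def mult.commute)

lemma ip_simps:
  "ip n (p + p') q = ip n p q + ip n p' q" "ip n q (p + p') = ip n q p + ip n q p'"
  "ip n (p - p') q = ip n p q - ip n p' q" "ip n q (p - p') = ip n q p - ip n q p'"
  "ip n (scale c p) q = c * ip n p q" "ip n q (scale c p) = c * ip n q p"
  "ip n (sum f A) q = (\<Sum>i\<in>A. ip n (f i) q)" "ip n q (sum f A) = (\<Sum>i\<in>A. ip n q (f i))"
  by (simp_all add: ip_def algebra_simps sum.distrib sum_subtractf sum_distrib_left sum_distrib_right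
      sum.swap[of _ "faces n"])

lemma ip_face:
  assumes "x \<in> faces n" shows "ip n p (face x) = face_coeff p x"
proof -
  have "ip n p (face x) = (\<Sum>y\<in>faces n. if x = y then face_coeff p y else 0)"
    unfolding ip_def using assms faces_finite by (intro sum.cong) (auto simp: face_coeff_face)
  then show ?thesis using assms by simp
qed

lemma ip_M:
  assumes "p \<in> M n k"
  shows "ip n p q = (\<Sum>x\<in>L n k. face_coeff p x * face_coeff q x)"
  unfolding ip_def
  by (rule sum.mono_neutral_right) (use L_faces M_coeff_eq_0[OF assms] faces_finite in auto)

lemma ip_act:
  assumes "g \<in> B n"
  shows "ip n (act n g p) (act n g q) = ip n p q"
proof -
  have "bij_betw ((`) g) (faces n) (faces n)"
    by (rule bij_betw_byWitness[of _ "(`) (inv g)"])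
      (use assms image_faces B_inv[OF assms] in auto)
  then have "ip n (act n g p) (act n g q) =
      (\<Sum>x\<in>faces n. face_coeff (act n g p) (g ` x) * face_coeff (act n g q) (g ` x))"
    unfolding ip_def by (rule sum.reindex_bij_betw[symmetric])
  also have "\<dots> = ip n p q" unfolding ip_def using assms by (simp add: face_coeff_act)
  finally show ?thesis .
qed

lemma face_coeff_sum_faces:
  assumes "A \<subseteq> faces n" "y \<in> faces n"
  shows "face_coeff (\<Sum>x\<in>A. face x) y = (of_bool (y \<in> A) :: 'f::field)"
proof -
  have "finite A" using assms(1) finite_subset by blast
  have "face_coeff (\<Sum>x\<in>A. face x) y = (\<Sum>x\<in>A. if x = y then 1 else (0 :: 'f))"
    unfolding face_coeff_sum using assms faces_finite
    by (intro sum.cong refl face_coeff_face) auto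
  then show ?thesis using \<open>finite A\<close> by simp
qed

text \<open>Both operators have the incidence matrix of faces, read in opposite directions, so they
  are adjoint.\<close>

lemma ip_eps: "ip n (eps n p) q = ip n p (del n q)"
proof -
  let ?h = "\<lambda>x. \<Sum>y | y \<in> L n (card x + 1) \<and> x \<subset> y. face y :: 'a vpoly"
  let ?h' = "\<lambda>x. \<Sum>z | z \<in> faces n \<and> card z + 1 = card x \<and> z \<subset> x. face z :: 'a vpoly"
  have h: "face_coeff (?h x) y = face_coeff (?h' y) x" if "x \<in> faces n" "y \<in> faces n" for x y
  proof -
    have "face_coeff (?h x) y = of_bool (y \<in> {y. y \<in> L n (card x + 1) \<and> x \<subset> y})"
      using that L_faces by (intro face_coeff_sum_faces) auto
    also have "\<dots> = of_bool (x \<in> {z. z \<in> faces n \<and> card z + 1 = card y \<and> z \<subset> y})"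
      using that by (auto simp: L_iff faces_iff)
    also have "\<dots> = face_coeff (?h' y) x"
      using that by (intro face_coeff_sum_faces[symmetric]) auto
    finally show ?thesis .
  qed
  have "ip n (eps n p) q = (\<Sum>y\<in>faces n. \<Sum>x\<in>faces n. face_coeff p x * face_coeff (?h x) y * face_coeff q y)"
    by (simp only: ip_def eps_def face_extend_def face_coeff_sum face_coeff_scale sum_distrib_right)
  also have "\<dots> = (\<Sum>x\<in>faces n. \<Sum>y\<in>faces n. face_coeff p x * face_coeff (?h x) y * face_coeff q y)"
    by (rule sum.swap)
  also have "\<dots> = (\<Sum>x\<in>faces n. \<Sum>y\<in>faces n. face_coeff p x * (face_coeff q y * face_coeff (?h' y) x))"
    by (intro sum.cong) (simp_all only: h mult.commute mult.left_commute)
  also have "\<dots> = ip n p (del n q)"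
    by (simp only: ip_def del_def face_extend_def face_coeff_sum face_coeff_scale sum_distrib_left)
  finally show ?thesis .
qed

lemma ip_nu_plus: "ip n (nu_plus n p) q = ip n p (nu_plus n q)"
  unfolding nu_plus_def by (metis ip_commute ip_eps)

text \<open>Up to a scalar, \<open>sigma\<close> is a sum of flips, and these are involutions that
  preserve the form.\<close>

lemma ip_sigma:
  assumes "p \<in> M n k" "q \<in> M n k"
  shows "ip n (sigma n p) q = ip n p (sigma n q)"
proof -
  have s: "sigma n p = (\<Sum>i\<in>{1..n}. act n (flip i) p) - scale (of_nat (n - k)) p" if "p \<in> M n k" for p :: "'a vpoly"
    unfolding sum_flip[OF that] by simp
  have "ip n (act n (flip i) p) q = ip n p (act n (flip i) q)" if "i \<in> {1..n}" for i
  proof -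
    have "flip i \<circ> flip i = id" by auto
    then have "act n (flip i) (act n (flip i) q) = q"
      using flip_B[OF that] assms act_comp act_id by metis
    then show ?thesis using ip_act[OF flip_B[OF that], of p "act n (flip i) q"] by simp
  qed
  then show ?thesis unfolding s[OF assms(1)] s[OF assms(2)] by (simp add: ip_simps)
qed

lemma face_coeff_sigma:
  assumes "p \<in> M n k" "x \<in> L n k"
  shows "face_coeff (sigma n p) x = (\<Sum>u\<in>x. face_coeff p (insert (bar u) (x - {u})))"
proof -
  have x: "x \<in> faces n" using assms L_faces by blast
  have "face_coeff (sigma n p) x = ip n p (sigma n (face x))"
    using ip_sigma[OF assms(1) face_in_M[OF assms(2)]] ip_face[OF x, of "sigma n p"] by simp
  then show ?thesis using x by (simp add: sigma_face ip_simps ip_face flip_faces)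
qed

lemma exchange_L:
  assumes "x \<in> L n k" "v \<in> free n x" "u \<in> x"
  shows "insert v (x - {u}) \<in> L n k"
proof -
  have "u \<noteq> v" using assms by (auto simp: free_def)
  then have "insert v (x - {u}) = insert v x - {u}" by auto
  then show ?thesis using remove_L[OF insert_free_L[OF assms(1,2)], of u] assms(3) by simp
qed

text \<open>By self-adjointness the coefficient at \<open>x\<close> is the pairing of
  \<open>p\<close> with \<open>nu_plus n (face x)\<close>, which \<open>del_eps_face\<close> makes
  explicit.\<close>

lemma face_coeff_nu_plus:
  assumes "p \<in> M n k" "x \<in> L n k"
  shows "face_coeff (nu_plus n p) x = of_nat (2 * (n - k)) * face_coeff p x +
    (\<Sum>v\<in>free n x. \<Sum>u\<in>x. face_coeff p (insert v (x - {u})))"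
proof -
  have x: "x \<in> faces n" using assms L_faces by blast
  have "face_coeff (nu_plus n p) x = ip n p (nu_plus n (face x))"
    using ip_nu_plus ip_face[OF x, of "nu_plus n p"] by metis
  also have "nu_plus n (face x :: 'a vpoly) = scale (of_nat (2 * (n - k))) (face x)
    + (\<Sum>v\<in>free n x. \<Sum>u\<in>x. face (insert v (x - {u})))"
    unfolding nu_plus_def by (rule del_eps_face[OF assms(2)])
  also have "ip n p \<dots> = of_nat (2 * (n - k)) * face_coeff p x +
    (\<Sum>v\<in>free n x. \<Sum>u\<in>x. face_coeff p (insert v (x - {u})))"
    using x L_faces[OF exchange_L[OF assms(2)]]
    by (simp only: ip_simps ip_face) (intro arg_cong2[where f = "(+)"] sum.cong refl ip_face; simp)
  finally show ?thesis .
qed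

text \<open>The summands \<open>of_bool\<close> on both sides avoid truncated subtraction.\<close>

lemma card_exchange:
  assumes "finite y" "u \<in> y" "v \<notin> y"
  shows "card (insert v (y - {u}) \<inter> N) + of_bool (u \<in> N) = card (y \<inter> N) + of_bool (v \<in> N)"
proof -
  have "card (y \<inter> N) = card ((y - {u}) \<inter> N) + of_bool (u \<in> N)"
  proof (cases "u \<in> N")
    case True
    then have "y \<inter> N = insert u ((y - {u}) \<inter> N)" using assms by auto
    then show ?thesis using True assms by simp
  next
    case False
    then have "y \<inter> N = (y - {u}) \<inter> N" by auto
    then show ?thesis using False by simp
  qed
  moreover have "card (insert v (y - {u}) \<inter> N) = card ((y - {u}) \<inter> N) + of_bool (v \<in> N)"
    using assms by (cases "v \<in> N") simp_all
  ultimately show ?thesis by simp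
qed

section \<open>Vanishing of invariant eigenvectors\<close>

context large_char
begin

lemma card_stab_nonzero:
  assumes "x \<in> L n k" shows "(of_nat (card (stab n x)) :: 'f) \<noteq> 0"
proof
  assume 0: "(of_nat (card (stab n x)) :: 'f) = 0"
  have "(of_nat (fact m) :: 'f) \<noteq> 0" if "m \<le> n" for m
    using that
  proof (induction m)
    case (Suc m)
    then show ?case using of_nat_nonzero[of "Suc m"] unfolding fact_Suc of_nat_mult of_nat_id by simp
  qed simp
  then have "(of_nat (fact n * 2 ^ n) :: 'f) \<noteq> 0" by simp
  moreover have "(of_nat (card (B n)) :: 'f) = 0" unfolding card_B_orbit[OF assms] using 0 by simp
  ultimately show False unfolding card_B by simp
qed

text \<open>
  The coefficient of \<open>y\<close> in an invariant element depends only on how \<open>y\<close> meets \<open>x\<close> and its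
  antipode; the eigenvalue equation of \<open>\<sigma>\<close> determines it from faces meeting the antipode
  less, the one of \<open>\<nu>\<^sup>+\<close> from faces that share more indices with \<open>x\<close>.
\<close>

lemma invariant_eigenvector_eq_0:
  fixes p :: "'f vpoly"
  assumes p: "p \<in> M n k" "sigma n p = scale a p" "nu_plus n p = scale b p"
    and x: "x \<in> L n k" and inv: "\<And>g. g \<in> stab n x \<Longrightarrow> act n g p = p" and 0: "face_coeff p x = 0"
  shows "p = 0"
proof -
  define Q where "Q = bar ` x"
  \<comment> \<open>\<open>N\<close> holds the vertices whose index occurs in \<open>x\<close>; thus
    \<open>?t\<close> counts indices shared with \<open>x\<close>, and \<open>?s\<close> those among
    them with opposite sign.\<close>
  define N where "N = x \<union> Q"
  let ?t = "\<lambda>y. card (y \<inter> N)" and ?s = "\<lambda>y. card (y \<inter> Q)"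
  have xf: "x \<in> faces n" "finite x" "card x = k" "x \<subseteq> V n" "\<forall>v\<in>x. bar v \<notin> x"
    using x L_faces L_finite by (auto simp: L_iff)
  have xQ: "x \<inter> Q = {}" using xf by (auto simp: Q_def)
  have barN: "bar v \<in> N \<longleftrightarrow> v \<in> N" for v by (auto simp: N_def Q_def bar_mem_image)
  have barQ: "bar v \<in> Q \<longleftrightarrow> v \<in> x" for v by (auto simp: Q_def bar_mem_image)
  have kn: "k \<le> n" using L_le[OF x] .
  \<comment> \<open>The pair \<open>?t\<close>, \<open>?s\<close> determines both intersection
    numbers, hence the orbit under the stabilizer of \<open>x\<close>.\<close>
  have same: "face_coeff p y' = face_coeff p y"
    if "y \<in> L n k" "y' \<in> L n k" "?t y' = ?t y" "?s y' = ?s y" for y y'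
  proof -
    have "?t w = card (w \<inter> x) + ?s w" if "w \<in> L n k" for w
      using that L_finite[of w n k] xQ unfolding N_def Int_Un_distrib
      by (intro card_Un_disjoint) auto
    then have "card (y' \<inter> x) = card (y \<inter> x)" using that by simp
    moreover have "card y = card y'" using that by (simp add: L_iff)
    ultimately have "\<exists>g\<in>B n. g ` x = x \<and> g ` y = y'"
      using that xf(1) L_faces by (intro B_transitive_on_pairs) (simp_all add: Q_def)
    then obtain g where g: "g \<in> B n" "g ` x = x" "g ` y = y'" by blast
    then have "act n g p = p" by (intro inv) (simp add: stab_def)
    then show ?thesis using face_coeff_act[OF g(1) L_faces[OF that(1)], of p] g(3) by simp
  qed
  have "face_coeff p y = 0" if "y \<in> L n k" for y
    using that
  proof (induction y rule: wf_induct_rule[OF wf_measures[of "[\<lambda>y. k - ?t y, ?s]"]])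
    case (1 y)
    note y = 1(2)
    have yf: "finite y" "card y = k" "\<forall>v\<in>y. bar v \<notin> y" "y \<in> faces n"
      using y L_finite L_faces by (auto simp: L_iff)
    have tk: "?t w \<le> k" if "w \<in> L n k" for w
      using that card_mono[OF L_finite[OF that], of "w \<inter> N"] by (auto simp: L_iff)
    have IH: "face_coeff p w = 0" if "w \<in> L n k" "?t y < ?t w \<or> ?t y = ?t w \<and> ?s w < ?s y" for w
    proof -
      have "k - ?t w < k - ?t y \<or> k - ?t w = k - ?t y \<and> ?s w < ?s y"
        using that(2) tk[OF that(1)] by arith
      then show ?thesis using 1(1)[of w] that(1) by (simp add: in_measures)
    qed
    show ?case
    proof (cases "y \<inter> Q = {}")
      case False
      then obtain c where c: "c \<in> y" "c \<in> Q" by auto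
      \<comment> \<open>One opposite sign is corrected. As \<open>y\<close> is a flip of
        \<open>?z\<close>, the eigenvalue equation of \<open>sigma\<close> at \<open>?z\<close>
        involves the coefficient at \<open>y\<close>.\<close>
      let ?z = "insert (bar c) (y - {c})"
      have bc: "bar c \<notin> y" "bar c \<in> x" using c yf by (auto simp: Q_def bar_mem_image)
      then have bcQ: "bar c \<notin> Q" "c \<in> N" using xQ c by (auto simp: N_def)
      have z: "?z \<in> L n k" by (rule flip_L[OF y c(1)])
      have zf: "finite ?z" "\<forall>v\<in>?z. bar v \<notin> ?z" using L_finite[OF z] z[unfolded L_iff] by blast+
      have tz: "?t ?z = ?t y" "Suc (?s ?z) = ?s y"
        using card_exchange[OF yf(1) c(1) bc(1), of N] card_exchange[OF yf(1) c(1) bc(1), of Q] c bcQ barN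
        by auto
      \<comment> \<open>Flipping some \<open>u \<in> x\<close> restores the type of
        \<open>y\<close>; any other flip keeps \<open>?s\<close> below its value at
        \<open>y\<close>, where the induction hypothesis applies.\<close>
      have "face_coeff p (insert (bar u) (?z - {u})) = (if u \<in> x then face_coeff p y else 0)"
        if u: "u \<in> ?z" for u
      proof -
        let ?w = "insert (bar u) (?z - {u})"
        have w: "?w \<in> L n k" by (rule flip_L[OF z u])
        have bu: "bar u \<notin> ?z" using zf(2) u by blast
        have tw: "?t ?w = ?t y"
          using card_exchange[OF zf(1) u bu, of N] tz(1) barN[of u] by auto
        have sw: "?s ?w + of_bool (u \<in> Q) = ?s ?z + of_bool (u \<in> x)"
          using card_exchange[OF zf(1) u bu, of Q] barQ[of u] by simp
        show ?thesis
        proof (cases "u \<in> x")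
          case True
          then have "u \<notin> Q" using xQ by auto
          then have "?s ?w = ?s y" using sw True tz(2) by simp
          then show ?thesis using same[OF y w tw] True by simp
        next
          case False
          then have "?s ?w < ?s y" using sw tz(2) by simp
          then show ?thesis using IH[OF w] tw False by simp
        qed
      qed
      then have "face_coeff (sigma n p) ?z = (\<Sum>u\<in>?z. if u \<in> x then face_coeff p y else 0)"
        unfolding face_coeff_sigma[OF p(1) z] by (rule sum.cong[OF refl])
      also have "\<dots> = of_nat (card (?z \<inter> x)) * face_coeff p y"
        using zf(1) by (simp only: sum.inter_restrict[symmetric] sum_constant)
      finally have "of_nat (card (?z \<inter> x)) * face_coeff p y = a * face_coeff p ?z"
        unfolding p(2) by simp
      moreover have "face_coeff p ?z = 0" using IH[OF z] tz by simp
      moreover have "(of_nat (card (?z \<inter> x)) :: 'f) \<noteq> 0"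
      proof (rule of_nat_nonzero)
        have "bar c \<in> ?z \<inter> x" using bc by simp
        then show "0 < card (?z \<inter> x)" using zf(1) by (metis card_gt_0_iff empty_iff finite_Int)
        show "card (?z \<inter> x) \<le> n" using card_mono[of x "?z \<inter> x"] xf kn by simp
      qed
      ultimately show ?thesis by simp
    next
      case True
      then have s0: "?s y = 0" by simp
      show ?thesis
      proof (cases "y \<subseteq> N")
        case True
        then have "y \<subseteq> x" using \<open>y \<inter> Q = {}\<close> by (auto simp: N_def)
        then have "y = x" using xf yf by (simp add: card_subset_eq)
        then show ?thesis using 0 by simp
      next
        case False
        then obtain u where u: "u \<in> y" "u \<notin> N" by auto
        have "\<not> x \<subseteq> y" using u xf yf card_subset_eq[of y x] by (auto simp: N_def)
        then obtain w where w: "w \<in> x" "w \<notin> y" by auto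
        have bw: "bar w \<notin> y" using w(1) barQ[of w] \<open>y \<inter> Q = {}\<close> by auto
        have wN: "w \<in> N" "w \<notin> Q" using w xQ by (auto simp: N_def)
        have uQ: "u \<notin> Q" using u by (auto simp: N_def)
        \<comment> \<open>A vertex of foreign index is exchanged for one of \<open>x\<close>. The
          reverse exchange leads from \<open>?z\<close> to \<open>y\<close>, so the equation of
          \<open>nu_plus\<close> is read at \<open>?z\<close>.\<close>
        let ?z = "insert w (y - {u})"
        have "w \<in> free n y" using w bw xf by (auto simp: free_def)
        then have z: "?z \<in> L n k" by (rule exchange_L[OF y _ u(1)])
        have zf: "finite ?z" "?z \<in> faces n" using L_finite[OF z] L_faces[OF z] by blast+
        have tz: "?t ?z = Suc (?t y)" "?s ?z = 0"
          using card_exchange[OF yf(1) u(1) w(2), of N] card_exchange[OF yf(1) u(1) w(2), of Q] u wN uQ s0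
          by auto
        have zQ: "?z \<inter> Q = {}" using \<open>y \<inter> Q = {}\<close> wN by auto
        \<comment> \<open>Only exchanging a shared index for a foreign one restores the type of
          \<open>y\<close>; all other exchanges share more indices with \<open>x\<close> than
          \<open>y\<close> does.\<close>
        have coeff: "face_coeff p (insert v (?z - {u'})) = (if v \<notin> N \<and> u' \<in> N then face_coeff p y else 0)"
          if v: "v \<in> free n ?z" and u': "u' \<in> ?z" for v u'
        proof -
          let ?w = "insert v (?z - {u'})"
          have vz: "v \<notin> ?z" using v by (simp add: free_def)
          have wL: "?w \<in> L n k" by (rule exchange_L[OF z v u'])
          have tw: "?t ?w + of_bool (u' \<in> N) = Suc (?t y) + of_bool (v \<in> N)"
            using card_exchange[OF zf(1) u' vz, of N] tz(1) by simp
          have sw: "?s ?w + of_bool (u' \<in> Q) = of_bool (v \<in> Q)"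
            using card_exchange[OF zf(1) u' vz, of Q] tz(2) by simp
          show ?thesis
          proof (cases "v \<notin> N \<and> u' \<in> N")
            case True
            then have "v \<notin> Q" by (auto simp: N_def)
            then have "?t ?w = ?t y" "?s ?w = ?s y" using True tw sw s0 by auto
            then show ?thesis using same[OF y wL] True by simp
          next
            case False
            then have "?t y < ?t ?w" using tw by (auto split: if_splits simp: of_bool_def)
            then show ?thesis using IH[OF wL] False by auto
          qed
        qed
        have z0: "face_coeff p ?z = 0" using IH[OF z] tz by simp
        have "b * face_coeff p ?z = of_nat (2 * (n - k)) * face_coeff p ?z +
            (\<Sum>v\<in>free n ?z. \<Sum>u'\<in>?z. face_coeff p (insert v (?z - {u'})))"
          using face_coeff_nu_plus[OF p(1) z] unfolding p(3) face_coeff_scale .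
        then have "0 = (\<Sum>v\<in>free n ?z. \<Sum>u'\<in>?z. face_coeff p (insert v (?z - {u'})))"
          unfolding z0 by simp
        also have "\<dots> = (\<Sum>v\<in>free n ?z. \<Sum>u'\<in>?z. if v \<in> - N then (if u' \<in> N then face_coeff p y else 0) else 0)"
          by (intro sum.cong refl) (simp add: coeff)
        also have "\<dots> = (\<Sum>v\<in>free n ?z. if v \<in> - N then (\<Sum>u'\<in>?z. if u' \<in> N then face_coeff p y else 0) else 0)"
          by (intro sum.cong refl) auto
        also have "\<dots> = of_nat (card (free n ?z \<inter> - N)) * (of_nat (card (?z \<inter> N)) * face_coeff p y)"
          using zf(1) by (simp only: sum.inter_restrict[symmetric] sum_constant finite_free)
        finally have "of_nat (card (free n ?z \<inter> - N)) * (of_nat (card (?z \<inter> N)) * face_coeff p y) = 0" by simp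
        moreover have "(of_nat (card (?z \<inter> N)) :: 'f) \<noteq> 0"
          by (rule of_nat_nonzero) (use tz tk[OF z] kn in auto)
        \<comment> \<open>These are the free vertices of the face \<open>?z \<union> x\<close>, so
          their number is \<open>2 * m\<close> with \<open>m \<le> n\<close>; the vertex
          \<open>u\<close> shows \<open>m > 0\<close>.\<close>
        moreover have "(of_nat (card (free n ?z \<inter> - N)) :: 'f) \<noteq> 0"
        proof -
          have "bar v \<notin> x" if "v \<in> ?z" for v using zQ that by (auto simp: Q_def bar_mem_image)
          moreover have "bar v \<notin> ?z" if "v \<in> x" for v using zQ that by (auto simp: Q_def)
          ultimately have zx: "?z \<union> x \<in> faces n" using zf(2) xf unfolding faces_iff by blast
          have "free n ?z \<inter> - N = free n (?z \<union> x)"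
            by (auto simp: free_def N_def Q_def bar_mem_image)
          then have c: "card (free n ?z \<inter> - N) = 2 * (n - card (?z \<union> x))" using card_free[OF zx] by simp
          have "u \<in> free n ?z \<inter> - N"
            using u w yf y by (auto simp: free_def L_iff N_def Q_def bar_mem_image)
          then have "card (free n ?z \<inter> - N) \<noteq> 0" by auto
          then have "(of_nat (n - card (?z \<union> x)) :: 'f) \<noteq> 0" unfolding c by (intro of_nat_nonzero) auto
          then show ?thesis unfolding c of_nat_mult by simp
        qed
        ultimately show ?thesis by simp
      qed
    qed
  qed
  then show ?thesis by (intro M_eqI[OF p(1), of 0]) (use vpoly.subspace_0[OF subspace_M] in auto)
qed

end

section \<open>Spherical vectors and irreducibility\<close>

context large_char
begin

lemma Ekji_M: "j \<le> k \<Longrightarrow> k \<le> n \<Longrightarrow> (p :: 'f vpoly) \<in> Ekji n k j i \<Longrightarrow> p \<in> M n k"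
  by (simp add: Ekji_iff)

text \<open>Eigenvectors of a self-adjoint operator for different eigenvalues are orthogonal;
  \<open>nu_plus\<close> separates different \<open>i\<close>, and \<open>sigma\<close> separates
  different \<open>j\<close>.\<close>

lemma Ekji_orthogonal:
  assumes "j \<le> k" "j' \<le> k" "k \<le> n" "i \<le> min (k - j) (n - k)" "i' \<le> min (k - j') (n - k)"
    and "(j, i) \<noteq> (j', i')" and p: "(p :: 'f vpoly) \<in> Ekji n k j i" and q: "q \<in> Ekji n k j' i'"
  shows "ip n p q = 0"
proof -
  have p': "p \<in> M n k" "sigma n p = scale (of_int (int k - 2 * int j)) p" "nu_plus n p = scale (lam n k j i) p"
    using p assms(1,3) by (simp_all add: Ekji_iff)
  have q': "q \<in> M n k" "sigma n q = scale (of_int (int k - 2 * int j')) q" "nu_plus n q = scale (lam n k j' i') q"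
    using q assms(2,3) by (simp_all add: Ekji_iff)
  show ?thesis
  proof (cases "j = j'")
    case True
    then have "(lam n k j i :: 'f) \<noteq> lam n k j' i'" using lam_inject[of j k i i'] assms by auto
    moreover have "lam n k j i * ip n p q = lam n k j' i' * ip n p q"
      using ip_nu_plus[of n p q] unfolding p' q' ip_simps .
    ultimately show ?thesis by simp
  next
    case False
    then have "(of_int (int k - 2 * int j) :: 'f) \<noteq> of_int (int k - 2 * int j')"
      using sigma_eigenvalue_inject[of j j' k] assms by simp
    moreover have "of_int (int k - 2 * int j) * ip n p q = of_int (int k - 2 * int j') * ip n p q"
      using ip_sigma[OF p'(1) q'(1)] unfolding p'(2) q'(2) ip_simps .
    ultimately show ?thesis by (metis mult_right_cancel)
  qed
qed

text \<open>The normalized spherical function with base point \<open>x\<close> for the permutation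
  action on faces.\<close>

definition spherical :: "nat \<Rightarrow> vertex set \<Rightarrow> 'f vpoly \<Rightarrow> bool"
  where "spherical m x z \<longleftrightarrow> (\<forall>g\<in>stab m x. act m g z = z) \<and> face_coeff z x = 1"

text \<open>The difference of the two sides is an invariant eigenvector with coefficient 0 at
  \<open>x\<close>, hence zero: the invariants form at most a line.\<close>

lemma invariant_Ekji:
  assumes "j \<le> k" "k \<le> n" "x \<in> L n k" "(z :: 'f vpoly) \<in> Ekji n k j i" "spherical n x z"
    and "u \<in> Ekji n k j i" "\<And>g. g \<in> stab n x \<Longrightarrow> act n g u = u"
  shows "u = scale (face_coeff u x) z"
proof -
  let ?d = "u - scale (face_coeff u x) z"
  have "?d \<in> Ekji n k j i"
    by (intro vpoly.subspace_diff[OF subspace_Ekji] vpoly.subspace_scale[OF subspace_Ekji] assms)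
  then have d: "?d \<in> M n k" "sigma n ?d = scale (of_int (int k - 2 * int j)) ?d"
    "nu_plus n ?d = scale (lam n k j i) ?d" using assms(1,2) by (simp_all only: Ekji_iff)
  have "?d = 0"
    by (rule invariant_eigenvector_eq_0[OF d assms(3)]) (use assms in \<open>auto simp: spherical_def\<close>)
  then show ?thesis by simp
qed

lemma average_invariant:
  assumes "p \<in> M n k" "h \<in> stab n x"
  shows "act n h (\<Sum>g\<in>stab n x. act n g (p :: 'f vpoly)) = (\<Sum>g\<in>stab n x. act n g p)"
proof -
  have "h \<in> B n" "h ` x = x" using assms by (auto simp: stab_def)
  then have b: "bij_betw ((\<circ>) h) (stab n x) (stab n x)"
    using comp_bij_stab[of h n x] by (simp add: stab_def)
  have "act n h (\<Sum>g\<in>stab n x. act n g p) = (\<Sum>g\<in>stab n x. act n (h \<circ> g) p)"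
    using act_comp[OF \<open>h \<in> B n\<close> stab_B assms(1)] by simp
  also have "\<dots> = (\<Sum>g\<in>stab n x. act n g p)" by (rule sum.reindex_bij_betw[OF b])
  finally show ?thesis .
qed

lemma face_coeff_average:
  assumes "x \<in> faces n"
  shows "face_coeff (\<Sum>g\<in>stab n x. act n g (p :: 'f vpoly)) x = of_nat (card (stab n x)) * face_coeff p x"
proof -
  have "face_coeff (act n g p) x = face_coeff p x" if "g \<in> stab n x" for g
    using face_coeff_act[of g n x p] that assms by (simp add: stab_def)
  then show ?thesis by simp
qed

text \<open>Some coefficient of a nonzero element is moved to \<open>x\<close> by transitivity.
  Averaging over the stabilizer multiplies it by the order of that group, which is nonzero in the
  field.\<close>

lemma spherical_exists:
  assumes W: "B_submodule n W" "W \<subseteq> Ekji n k j i" "W \<noteq> {0 :: 'f vpoly}"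
    and jk: "j \<le> k" "k \<le> n" and x: "x \<in> L n k"
  shows "\<exists>z\<in>W. spherical n x z"
proof -
  have sub: "vpoly.subspace W" and act: "\<And>g v. g \<in> B n \<Longrightarrow> v \<in> W \<Longrightarrow> act n g v \<in> W"
    using W(1) by (auto simp: B_submodule_def)
  have WM: "v \<in> M n k" if "v \<in> W" for v using Ekji_M[OF jk] W(2) that by blast
  obtain w where w: "w \<in> W" "w \<noteq> 0" using W(3) vpoly.subspace_0[OF sub] by blast
  obtain y where y: "y \<in> L n k" "face_coeff w y \<noteq> 0"
    using M_eqI[OF WM[OF w(1)] vpoly.subspace_0[OF subspace_M]] w(2) by auto
  obtain h where h: "h \<in> B n" "h ` y = x" using B_transitive[OF y(1) x] by blast
  define v where "v = act n h w"
  have v: "v \<in> W" "face_coeff v x \<noteq> 0"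
    using act[OF h(1) w(1)] face_coeff_act[OF h(1) L_faces[OF y(1)], of w] y(2) by (auto simp: v_def h(2))
  define s where "s = (\<Sum>g\<in>stab n x. act n g v)"
  have s: "s \<in> W" unfolding s_def using v act stab_B by (intro vpoly.subspace_sum[OF sub]) auto
  have sx: "face_coeff s x \<noteq> 0"
    unfolding s_def face_coeff_average[OF L_faces[OF x]] using card_stab_nonzero[OF x] v(2) by simp
  have "spherical n x (scale (1 / face_coeff s x) s)"
    using sx average_invariant[OF WM[OF v(1)]] by (simp add: spherical_def s_def)
  then show ?thesis using vpoly.subspace_scale[OF sub s] by blast
qed

text \<open>Pairing with an invariant vector does not change when \<open>u\<close> is moved by the
  stabilizer, and the sum of these translates is a multiple of \<open>z\<close>.\<close>

lemma ip_spherical: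
  assumes "j \<le> k" "k \<le> n" "x \<in> L n k" "(z :: 'f vpoly) \<in> Ekji n k j i" "spherical n x z" "u \<in> Ekji n k j i"
  shows "ip n u z = face_coeff u x * ip n z z"
proof -
  let ?s = "\<Sum>g\<in>stab n x. act n g u"
  have u: "u \<in> M n k" using Ekji_M assms by blast
  have "?s \<in> Ekji n k j i"
    using B_submodule_Ekji[OF assms(1,2)] assms(6) stab_B
    by (intro vpoly.subspace_sum[OF subspace_Ekji]) (auto simp: B_submodule_def)
  then have s: "?s = scale (face_coeff ?s x) z"
    using assms average_invariant[OF u] by (intro invariant_Ekji) auto
  have "ip n (act n g u) z = ip n u z" if "g \<in> stab n x" for g
  proof -
    have "act n g z = z" using assms(5) that by (simp add: spherical_def)
    then show ?thesis using ip_act[OF stab_B[OF that], of u z] by simp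
  qed
  then have "of_nat (card (stab n x)) * ip n u z = ip n ?s z" by (simp add: ip_simps)
  also have "\<dots> = of_nat (card (stab n x)) * (face_coeff u x * ip n z z)"
    by (subst s) (simp only: ip_simps face_coeff_average[OF L_faces[OF assms(3)]] mult.assoc)
  finally show ?thesis using card_stab_nonzero[OF assms(3)] by simp
qed

text \<open>If \<open>z\<close> were isotropic, it would be orthogonal to its own eigenspace and, as
  always, to the others, hence to all of \<open>M n k\<close>; but its pairing with
  \<open>face x\<close> is 1.\<close>

lemma ip_spherical_nonzero:
  assumes "j \<le> k" "k \<le> n" "x \<in> L n k" "(z :: 'f vpoly) \<in> Ekji n k j i" "spherical n x z"
    and i: "i \<le> min (k - j) (n - k)"
  shows "ip n z z \<noteq> 0"
proof
  assume 0: "ip n z z = 0"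
  have E: "ip n z v = 0" if "v \<in> Ekji n k j' i'" "j' \<le> k" "i' \<le> min (k - j') (n - k)" for v j' i'
  proof (cases "(j', i') = (j, i)")
    case True
    then have "v \<in> Ekji n k j i" using that by auto
    then have "ip n v z = 0" using ip_spherical[OF assms(1-5)] 0 by simp
    then show ?thesis by (simp add: ip_commute)
  next
    case False
    then show ?thesis using Ekji_orthogonal[OF assms(1) that(2) assms(2) i that(3) _ assms(4) that(1)] by auto
  qed
  have E': "ip n z v = 0" if v: "v \<in> Ekj n k j'" "j' \<le> k" for v j'
  proof -
    obtain u where "\<forall>i\<in>{0..min (k - j') (n - k)}. u i \<in> Ekji n k j' i" "v = (\<Sum>i\<in>{0..min (k - j') (n - k)}. u i)"
      using Ekj_sum_Ekji[OF v(2) assms(2) v(1)] by blast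
    moreover from this have "ip n z (u i) = 0" if "i \<in> {0..min (k - j') (n - k)}" for i
      using that v(2) by (intro E[of _ j' i]) auto
    ultimately show ?thesis by (simp only: ip_simps) (rule sum.neutral, blast)
  qed
  have "face x \<in> (M n k :: 'f vpoly set)" by (rule face_in_M[OF assms(3)])
  from M_sum_Ekj[OF two_nonzero this] obtain u
    where "\<forall>j\<in>{0..k}. u j \<in> Ekj n k j" "face x = (\<Sum>j\<in>{0..k}. u j :: 'f vpoly)" by blast
  moreover from this have "ip n z (u j) = 0" if "j \<in> {0..k}" for j
    using that by (intro E'[of _ j]) auto
  ultimately have "ip n z (face x) = 0" by (simp only: ip_simps) (rule sum.neutral, blast)
  then show False using ip_face[OF L_faces[OF assms(3)], of z] assms(5) by (simp add: spherical_def)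
qed

lemma spherical_act:
  assumes "spherical n x z" "g \<in> B n" "z \<in> M n k" "x \<in> faces n"
  shows "spherical n (g ` x) (act n g z)"
  unfolding spherical_def
proof (intro conjI ballI)
  show "face_coeff (act n g z) (g ` x) = 1"
    using face_coeff_act[OF assms(2,4), of z] assms(1) by (simp add: spherical_def)
  fix h assume h: "h \<in> stab n (g ` x)"
  let ?h = "inv g \<circ> (h \<circ> g)"
  have hB: "h \<in> B n" "h ` g ` x = g ` x" using h by (auto simp: stab_def)
  have "?h \<in> B n" by (intro B_comp B_inv assms hB)
  moreover have "?h ` x = x" unfolding image_comp[symmetric] hB(2) using assms(2) by simp
  ultimately have "act n ?h z = z" using assms(1) by (simp add: spherical_def stab_def)
  then have "act n g z = act n (g \<circ> ?h) z"
    using act_comp[OF assms(2) \<open>?h \<in> B n\<close> assms(3)] by simp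
  also have "g \<circ> ?h = h \<circ> g"
    using permutes_inverses(1)[OF B_permutes[OF assms(2)]] by (simp add: fun_eq_iff)
  also have "act n (h \<circ> g) z = act n h (act n g z)" by (rule act_comp[symmetric, OF hB(1) assms(2,3)])
  finally show "act n h (act n g z) = act n g z" by (rule sym)
qed

text \<open>
  The spherical vectors \<open>z x\<close> reproduce every element of \<open>E\<^sub>k\<^sub>,\<^sub>j\<^sub>,\<^sub>i\<close> up to a nonzero scalar, so any
  nonzero submodule, which contains all of them by averaging, is everything.
\<close>

lemma spherical_expansion:
  assumes jk: "j \<le> k" "k \<le> n" and i: "i \<le> min (k - j) (n - k)"
    and z: "\<And>x. x \<in> L n k \<Longrightarrow> z x \<in> Ekji n k j i \<and> spherical n x (z x :: 'f vpoly)"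
  shows "\<exists>\<theta>. \<theta> \<noteq> 0 \<and> (\<forall>x\<in>L n k. \<forall>u\<in>Ekji n k j i. ip n u (z x) = \<theta> * face_coeff u x) \<and>
    (\<forall>u\<in>Ekji n k j i. (\<Sum>y\<in>L n k. scale (face_coeff u y) (z y)) = scale \<theta> u)"
proof (cases "L n k = {}")
  case True
  then have "u = 0" if "u \<in> Ekji n k j i" for u :: "'f vpoly"
    using M_expand[OF Ekji_M[OF jk that]] by simp
  then show ?thesis using True by (intro exI[of _ 1]) auto
next
  case False
  then obtain x0 where x0: "x0 \<in> L n k" by blast
  have zM: "z x \<in> M n k" if "x \<in> L n k" for x using z[OF that] Ekji_M[OF jk] by blast
  define \<theta> where "\<theta> = ip n (z x0) (z x0)"
  have "\<theta> \<noteq> 0" unfolding \<theta>_def using ip_spherical_nonzero[OF jk x0 _ _ i] z[OF x0] by blast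
  \<comment> \<open>By uniqueness the group carries \<open>z x0\<close> to \<open>z x\<close>, and
    it preserves the form, so the value does not depend on the face.\<close>
  have \<theta>: "ip n (z x) (z x) = \<theta>" if x: "x \<in> L n k" for x
  proof -
    obtain g where g: "g \<in> B n" "g ` x0 = x" using B_transitive[OF x0 x] by blast
    have sp: "spherical n x (act n g (z x0))"
      using spherical_act[OF _ g(1) zM[OF x0] L_faces[OF x0]] z[OF x0] g(2) by simp
    have "act n g (z x0) \<in> Ekji n k j i"
      using B_submodule_Ekji[OF jk] g z[OF x0] by (auto simp: B_submodule_def)
    then have "act n g (z x0) = scale (face_coeff (act n g (z x0)) x) (z x)"
      using z[OF x] sp by (intro invariant_Ekji[OF jk x]) (auto simp: spherical_def)
    then have "act n g (z x0) = z x" using sp by (simp add: spherical_def)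
    then show ?thesis unfolding \<theta>_def using ip_act[OF g(1), of "z x0" "z x0"] by simp
  qed
  have ipz: "ip n u (z x) = \<theta> * face_coeff u x" if "x \<in> L n k" "u \<in> Ekji n k j i" for x u
    using ip_spherical[OF jk that(1) _ _ that(2), of "z x"] z[OF that(1)] \<theta>[OF that(1)] by (simp add: mult.commute)
  \<comment> \<open>Both sides are \<open>ip n (z x) (z y)\<close> divided by
    \<open>\<theta>\<close>. This symmetry turns the coefficient of the expansion at
    \<open>x\<close> into a pairing with \<open>z x\<close>.\<close>
  have sym: "face_coeff (z y) x = face_coeff (z x) y" if "x \<in> L n k" "y \<in> L n k" for x y
    using ipz[of x "z y"] ipz[of y "z x"] z that \<open>\<theta> \<noteq> 0\<close> ip_commute[of n "z x" "z y"] by simp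
  have "(\<Sum>y\<in>L n k. scale (face_coeff u y) (z y)) = scale \<theta> u" if u: "u \<in> Ekji n k j i" for u
  proof (rule M_eqI[where n = n and k = k])
    have uM: "u \<in> M n k" using Ekji_M[OF jk u] .
    show "(\<Sum>y\<in>L n k. scale (face_coeff u y) (z y)) \<in> M n k"
      by (intro vpoly.subspace_sum[OF subspace_M] vpoly.subspace_scale[OF subspace_M] zM)
    show "scale \<theta> u \<in> M n k" by (rule vpoly.subspace_scale[OF subspace_M uM])
    fix x assume x: "x \<in> L n k"
    have "face_coeff (\<Sum>y\<in>L n k. scale (face_coeff u y) (z y)) x = (\<Sum>y\<in>L n k. face_coeff u y * face_coeff (z x) y)"
      using sym[OF x] by simp
    also have "\<dots> = ip n u (z x)" by (rule ip_M[OF uM, symmetric])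
    finally show "face_coeff (\<Sum>y\<in>L n k. scale (face_coeff u y) (z y)) x = face_coeff (scale \<theta> u) x"
      using ipz[OF x u] by simp
  qed
  then show ?thesis using ipz \<open>\<theta> \<noteq> 0\<close> by blast
qed

lemma B_irreducible_Ekji:
  assumes jk: "j \<le> k" "k \<le> n" and i: "i \<le> min (k - j) (n - k)"
  shows "B_irreducible n (Ekji n k j i :: 'f vpoly set)"
  unfolding B_irreducible_def
proof (intro conjI allI impI)
  show "B_submodule n (Ekji n k j i :: 'f vpoly set)" by (rule B_submodule_Ekji[OF jk])
  show "(Ekji n k j i :: 'f vpoly set) \<noteq> {0}" by (rule Ekji_nonzero[OF jk i])
  fix W :: "'f vpoly set" assume W: "B_submodule n W \<and> W \<subseteq> Ekji n k j i"
  then have sub: "vpoly.subspace W" by (simp add: B_submodule_def)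
  have "Ekji n k j i \<subseteq> W" if ne: "W \<noteq> {0}"
  proof
    fix u :: "'f vpoly" assume u: "u \<in> Ekji n k j i"
    have "\<forall>x\<in>L n k. \<exists>z\<in>W. spherical n x z"
      using spherical_exists[of W k j i] W ne jk by blast
    then obtain z where z: "\<And>x. x \<in> L n k \<Longrightarrow> z x \<in> W \<and> spherical n x (z x)" by metis
    then have "\<And>x. x \<in> L n k \<Longrightarrow> z x \<in> Ekji n k j i \<and> spherical n x (z x)" using W by blast
    from spherical_expansion[OF jk i this] obtain \<theta>
      where \<theta>: "\<theta> \<noteq> 0" "(\<Sum>y\<in>L n k. scale (face_coeff u y) (z y)) = scale \<theta> u" using u by blast
    have "scale \<theta> u \<in> W"
      unfolding \<theta>(2)[symmetric] using z
      by (intro vpoly.subspace_sum[OF sub] vpoly.subspace_scale[OF sub]) auto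
    from vpoly.subspace_scale[OF sub this, of "1 / \<theta>"] show "u \<in> W" using \<theta>(1) by simp
  qed
  then show "W = {0} \<or> W = Ekji n k j i" using W by blast
qed

lemma not_isomorphic_same_k:
  assumes jk: "j \<le> k" "j' \<le> k" "k \<le> n" and i: "i \<le> min (k - j) (n - k)" "i' \<le> min (k - j') (n - k)"
    and ne: "(j, i) \<noteq> (j', i')"
  shows "\<not> B_isomorphic n (Ekji n k j i :: 'f vpoly set) (Ekji n k j' i')"
proof
  let ?U = "Ekji n k j i :: 'f vpoly set" and ?W = "Ekji n k j' i' :: 'f vpoly set"
  assume "B_isomorphic n ?U ?W"
  then obtain \<phi> where \<phi>: "bij_betw \<phi> ?U ?W" "\<forall>u\<in>?U. \<forall>v\<in>?U. \<phi> (u + v) = \<phi> u + \<phi> v"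
    "\<forall>c. \<forall>u\<in>?U. \<phi> (scale c u) = scale c (\<phi> u)" "\<forall>g\<in>B n. \<forall>u\<in>?U. \<phi> (act n g u) = act n g (\<phi> u)"
    unfolding B_isomorphic_def by blast
  note U = B_submodule_Ekji[OF jk(1,3), of i] and W = B_submodule_Ekji[OF jk(2,3), of i']
  have subU: "vpoly.subspace ?U" and actU: "\<And>g u. g \<in> B n \<Longrightarrow> u \<in> ?U \<Longrightarrow> act n g u \<in> ?U"
    using U by (auto simp: B_submodule_def)
  have ne0: "?U \<noteq> {0}" "?W \<noteq> {0}" using Ekji_nonzero jk i by auto
  have \<phi>W: "\<phi> u \<in> ?W" if "u \<in> ?U" for u using \<phi>(1) that bij_betwE by blast
  have \<phi>0: "\<phi> 0 = 0" using \<phi>(3)[rule_format, of 0 0] vpoly.subspace_0[OF subU] by simp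
  have \<phi>sum: "\<phi> (\<Sum>x\<in>A. f x) = (\<Sum>x\<in>A. \<phi> (f x)) \<and> (\<Sum>x\<in>A. f x) \<in> ?U"
    if "finite A" "\<And>x. x \<in> A \<Longrightarrow> f x \<in> ?U" for A :: "vertex set set" and f
    using that
    by (induction A rule: finite_induct)
      (use \<phi>0 \<phi>(2) vpoly.subspace_0[OF subU] vpoly.subspace_add[OF subU] in auto)
  have "\<forall>x\<in>L n k. \<exists>z\<in>?U. spherical n x z" "\<forall>x\<in>L n k. \<exists>z\<in>?W. spherical n x z"
    using spherical_exists[OF U order_refl ne0(1) jk(1,3)] spherical_exists[OF W order_refl ne0(2) jk(2,3)] by auto
  then obtain z w where z: "\<And>x. x \<in> L n k \<Longrightarrow> z x \<in> ?U \<and> spherical n x (z x)"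
    and w: "\<And>x. x \<in> L n k \<Longrightarrow> w x \<in> ?W \<and> spherical n x (w x)" by metis
  obtain \<theta> where \<theta>: "\<theta> \<noteq> 0" "\<And>u. u \<in> ?U \<Longrightarrow> (\<Sum>y\<in>L n k. scale (face_coeff u y) (z y)) = scale \<theta> u"
    using spherical_expansion[OF jk(1,3) i(1) z] by blast
  obtain \<eta> where \<eta>: "\<eta> \<noteq> 0" "\<And>x u. x \<in> L n k \<Longrightarrow> u \<in> ?W \<Longrightarrow> ip n u (w x) = \<eta> * face_coeff u x"
    using spherical_expansion[OF jk(2,3) i(2) w] by blast
  have \<phi>z: "\<phi> (z x) = scale (face_coeff (\<phi> (z x)) x) (w x)" if x: "x \<in> L n k" for x
  proof (rule invariant_Ekji[OF jk(2,3) x])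
    fix g assume g: "g \<in> stab n x"
    then have "act n g (z x) = z x" using z[OF x] by (simp add: spherical_def)
    then show "act n g (\<phi> (z x)) = \<phi> (z x)" using \<phi>(4) z[OF x] stab_B[OF g] by metis
  qed (use w[OF x] z[OF x] \<phi>W in auto)
  \<comment> \<open>Equivariance and transitivity make the proportionality factor between
    \<open>\<phi> (z x)\<close> and \<open>w x\<close> the same for all faces.\<close>
  have const: "face_coeff (\<phi> (z y)) y = face_coeff (\<phi> (z x)) x" if xy: "x \<in> L n k" "y \<in> L n k" for x y
  proof -
    obtain g where g: "g \<in> B n" "g ` x = y" using B_transitive[OF xy] by blast
    have sp: "spherical n y (act n g (z x))"
      using spherical_act[OF _ g(1) _ L_faces[OF xy(1)], of "z x" k] z[OF xy(1)] g(2) Ekji_M[OF jk(1,3)] by auto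
    have "act n g (z x) = scale (face_coeff (act n g (z x)) y) (z y)"
      using z xy sp actU g(1) by (intro invariant_Ekji[OF jk(1,3) xy(2)]) (auto simp: spherical_def)
    then have "act n g (z x) = z y" using sp by (simp add: spherical_def)
    then have "\<phi> (z y) = act n g (\<phi> (z x))" using \<phi>(4) g z[OF xy(1)] by metis
    then show ?thesis using face_coeff_act[OF g(1) L_faces[OF xy(1)], of "\<phi> (z x)"] g(2) by simp
  qed
  \<comment> \<open>Expanding \<open>u\<close> in the \<open>z y\<close> and applying
    \<open>\<phi>\<close> gives, by symmetry of the \<open>w\<close>, a multiple of
    \<open>ip n u (w x)\<close> as coefficient at \<open>x\<close>; this is 0 by
    orthogonality.\<close>
  have "\<phi> u = 0" if u: "u \<in> ?U" for u
  proof (rule M_eqI[where n = n and k = k])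
    show "\<phi> u \<in> M n k" using \<phi>W[OF u] Ekji_M[OF jk(2,3)] by blast
    show "0 \<in> M n k" by (rule vpoly.subspace_0[OF subspace_M])
    fix x assume x: "x \<in> L n k"
    let ?c = "face_coeff (\<phi> (z x)) x"
    have uM: "u \<in> M n k" using Ekji_M[OF jk(1,3) u] .
    have "scale \<theta> (\<phi> u) = \<phi> (\<Sum>y\<in>L n k. scale (face_coeff u y) (z y))"
      using \<theta>(2)[OF u] \<phi>(3) u by simp
    also have "\<dots> = (\<Sum>y\<in>L n k. \<phi> (scale (face_coeff u y) (z y)))"
      using \<phi>sum[of "L n k" "\<lambda>y. scale (face_coeff u y) (z y)"] z vpoly.subspace_scale[OF subU] by auto
    also have "\<dots> = (\<Sum>y\<in>L n k. scale (face_coeff u y) (scale ?c (w y)))"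
    proof (rule sum.cong[OF refl])
      fix y assume y: "y \<in> L n k"
      have "\<phi> (z y) = scale ?c (w y)" using \<phi>z[OF y] const[OF x y] by simp
      then show "\<phi> (scale (face_coeff u y) (z y)) = scale (face_coeff u y) (scale ?c (w y))"
        using \<phi>(3) z[OF y] by simp
    qed
    finally have "face_coeff (scale \<theta> (\<phi> u)) x =
        face_coeff (\<Sum>y\<in>L n k. scale (face_coeff u y) (scale ?c (w y))) x"
      by (rule arg_cong)
    then have "\<theta> * face_coeff (\<phi> u) x = (\<Sum>y\<in>L n k. face_coeff u y * (?c * face_coeff (w y) x))"
      by (simp only: face_coeff_scale face_coeff_sum)
    also have "\<dots> = (\<Sum>y\<in>L n k. ?c * (face_coeff u y * face_coeff (w x) y))"
    proof (rule sum.cong[OF refl])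
      fix y assume y: "y \<in> L n k"
      have "face_coeff (w y) x = face_coeff (w x) y"
        using \<eta>(2)[OF x, of "w y"] \<eta>(2)[OF y, of "w x"] w[OF x] w[OF y] \<eta>(1)
          ip_commute[of n "w x" "w y"] by simp
      then show "face_coeff u y * (?c * face_coeff (w y) x) = ?c * (face_coeff u y * face_coeff (w x) y)"
        by simp
    qed
    also have "\<dots> = ?c * ip n u (w x)" unfolding ip_M[OF uM] by (rule sum_distrib_left[symmetric])
    also have "ip n u (w x) = 0" using Ekji_orthogonal[OF jk i ne u] w[OF x] by blast
    finally show "face_coeff (\<phi> u) x = face_coeff 0 x" using \<theta>(1) by simp
  qed
  then have "\<phi> ` ?U \<subseteq> {0}" by blast
  moreover have "\<phi> ` ?U = ?W" using \<phi>(1) by (simp add: bij_betw_def)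
  moreover have "0 \<in> \<phi> ` ?U" using \<phi>0 vpoly.subspace_0[OF subU] by (rule image_eqI[OF sym])
  ultimately have "?W = {0}" by (simp only: subset_singleton_iff) (metis empty_iff)
  then show False using ne0(2) by contradiction
qed

lemma Ekji_isomorphic_iff:
  assumes "j \<le> k" "k \<le> n" "i \<le> min (k - j) (n - k)" "j' \<le> k'" "k' \<le> n" "i' \<le> min (k' - j') (n - k')"
  shows "B_isomorphic n (Ekji n k j i :: 'f vpoly set) (Ekji n k' j' i') \<longleftrightarrow> j = j' \<and> i = i'"
proof
  assume iso: "B_isomorphic n (Ekji n k j i :: 'f vpoly set) (Ekji n k' j' i')"
  have j: "j = j'"
    using isomorphic_imp_j_eq[OF assms(1,2,4,5) _ iso] Ekji_nonzero[OF assms(1-3)] by blast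
  \<comment> \<open>A level at which both \<open>i\<close> and \<open>i'\<close> are admissible, so
    the comparison takes place inside one \<open>M n l\<close>.\<close>
  define l where "l = j + max i i'"
  have l: "j \<le> l" "l \<le> n" "i \<le> min (l - j) (n - l)" "i' \<le> min (l - j) (n - l)"
    using assms j by (auto simp: l_def)
  have "B_isomorphic n (Ekji n l j i :: 'f vpoly set) (Ekji n k j i)"
    by (rule Ekji_isomorphic[OF l(1,2,3) assms(1,2,3)])
  moreover have "B_isomorphic n (Ekji n k' j' i' :: 'f vpoly set) (Ekji n l j i')"
    unfolding j[symmetric]
    by (rule Ekji_isomorphic[OF assms(4)[folded j] assms(5) assms(6)[folded j] l(1,2,4)])
  ultimately have "B_isomorphic n (Ekji n l j i :: 'f vpoly set) (Ekji n l j i')"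
    using iso B_isomorphic_trans by blast
  then show "j = j' \<and> i = i'" using j not_isomorphic_same_k[OF l(1,1,2,3,4)] by blast
next
  assume "j = j' \<and> i = i'"
  then show "B_isomorphic n (Ekji n k j i :: 'f vpoly set) (Ekji n k' j' i')"
    using assms Ekji_isomorphic[of j k i k'] by simp
qed

section \<open>Direct sums and lists of eigenspaces\<close>

lemma direct_sumI:
  assumes "\<And>i. i \<in> I \<Longrightarrow> vpoly.subspace (U i)" "finite I" "vpoly.subspace W" "\<And>i. i \<in> I \<Longrightarrow> U i \<subseteq> W"
    and "\<And>p. p \<in> W \<Longrightarrow> \<exists>u. (\<forall>i\<in>I. u i \<in> U i) \<and> p = (\<Sum>i\<in>I. u i)"
    and "vlinear T" "inj_on c I" "\<And>i v. i \<in> I \<Longrightarrow> v \<in> U i \<Longrightarrow> T v = scale (c i) (v :: 'f vpoly)"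
  shows "is_direct_sum W I U"
  unfolding is_direct_sum_def
proof (intro conjI ballI allI impI equalityI subsetI)
  fix p assume "p \<in> W"
  then show "p \<in> {\<Sum>i\<in>I. u i | u. \<forall>i\<in>I. u i \<in> U i}" using assms(5) by blast
next
  fix p assume "p \<in> {\<Sum>i\<in>I. u i | u. \<forall>i\<in>I. u i \<in> U i}"
  then show "p \<in> W" using assms(3,4) by (auto intro!: vpoly.subspace_sum)
next
  fix u i assume u: "(\<forall>i\<in>I. u i \<in> U i) \<and> (\<Sum>i\<in>I. u i) = 0" and i: "i \<in> I"
  \<comment> \<open>Independence comes from the single operator \<open>T\<close>, which has
    different eigenvalues on the summands.\<close>
  show "u i = 0"
    by (rule eigen_sum_zero[OF assms(6,2,7) _ _ i]) (use u assms(8) in auto)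
qed (use assms(1) in auto)

lemma Ekj_direct_sum:
  assumes "k \<le> n"
  shows "is_direct_sum (M n k :: 'f vpoly set) {0..k} (Ekj n k)"
proof (rule direct_sumI[where T = "sigma n" and c = "\<lambda>j. of_int (int k - 2 * int j)"])
  show "inj_on (\<lambda>j. of_int (int k - 2 * int j) :: 'f) {0..k}"
    by (rule inj_onI) (use sigma_eigenvalue_inject assms in auto)
  show "\<And>p. p \<in> M n k \<Longrightarrow> \<exists>u. (\<forall>j\<in>{0..k}. u j \<in> Ekj n k j) \<and> (p :: 'f vpoly) = (\<Sum>j\<in>{0..k}. u j)"
    by (rule M_sum_Ekj[OF two_nonzero])
qed (use Ekj_iff assms in \<open>auto intro: subspace_Ekj subspace_M vlinear_sigma\<close>)

lemma Ekji_direct_sum: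
  assumes "j \<le> k" "k \<le> n"
  shows "is_direct_sum (Ekj n k j :: 'f vpoly set) {0..min (k - j) (n - k)} (Ekji n k j)"
proof (rule direct_sumI[where T = "nu_plus n" and c = "lam n k j"])
  show "inj_on (lam n k j :: nat \<Rightarrow> 'f) {0..min (k - j) (n - k)}"
    by (rule inj_onI) (use lam_inject assms in auto)
  show "\<And>p. p \<in> Ekj n k j \<Longrightarrow> \<exists>u. (\<forall>i\<in>{0..min (k - j) (n - k)}. u i \<in> Ekji n k j i) \<and>
      (p :: 'f vpoly) = (\<Sum>i\<in>{0..min (k - j) (n - k)}. u i)"
    by (rule Ekj_sum_Ekji[OF assms])
  show "\<And>i v. v \<in> Ekji n k j i \<Longrightarrow> nu_plus n v = scale (lam n k j i) (v :: 'f vpoly)"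
    "\<And>i. Ekji n k j i \<subseteq> (Ekj n k j :: 'f vpoly set)"
    by (auto simp: Ekji_def' eigenspace_on_def)
qed (simp_all add: subspace_Ekj subspace_Ekji vlinear_nu_plus)

lemma Ekj_nonzero:
  assumes "j \<le> k" "k \<le> n" shows "(Ekj n k j :: 'f vpoly set) \<noteq> {0}"
proof -
  have "(Ekji n k j 0 :: 'f vpoly set) \<subseteq> Ekj n k j" by (auto simp: Ekji_def' eigenspace_on_def)
  moreover have "0 \<in> (Ekji n k j 0 :: 'f vpoly set)" by (rule vpoly.subspace_0[OF subspace_Ekji])
  ultimately show ?thesis using Ekji_nonzero[OF assms, of 0] by auto
qed

text \<open>An eigenvector whose eigenvalue is none of the \<open>k - 2 * j\<close> would have all
  its components in the \<open>Ekj\<close> equal to zero, so there are no further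
  eigenspaces.\<close>

lemma Ekj_eigenspaces:
  assumes "k \<le> n"
  shows "{Ekj n k j | j. j \<le> k} = {U :: 'f vpoly set. is_eigenspace_on (M n k) (sigma n) U}"
proof (intro equalityI subsetI)
  fix U :: "'f vpoly set" assume "U \<in> {Ekj n k j | j. j \<le> k}"
  then obtain j where j: "j \<le> k" "U = Ekj n k j" by blast
  then show "U \<in> {U. is_eigenspace_on (M n k) (sigma n) U}"
    using Ekj_eq[OF j(1) assms] Ekj_nonzero[OF j(1) assms] sigma_M
    by (auto simp: is_eigenspace_on_def Skj_def)
next
  fix U :: "'f vpoly set" assume "U \<in> {U. is_eigenspace_on (M n k) (sigma n) U}"
  then obtain c where U: "U \<noteq> {0}" "U = eigenspace_on (M n k) (sigma n) c"
    by (auto simp: is_eigenspace_on_def)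
  have "0 \<in> U" unfolding U(2) by (rule vpoly.subspace_0[OF subspace_eigenspace_on[OF vlinear_sigma subspace_M]])
  then obtain v where v: "v \<in> M n k" "sigma n v = scale c v" "v \<noteq> 0"
    using U by (auto simp: eigenspace_on_def)
  obtain u where u: "\<forall>j\<in>{0..k}. u j \<in> Ekj n k j" "v = (\<Sum>j\<in>{0..k}. u j)"
    using M_sum_Ekj[OF two_nonzero v(1)] by blast
  have "\<exists>j\<in>{0..k}. c = of_int (int k - 2 * int j)"
  proof (rule ccontr)
    assume nc: "\<not> (\<exists>j\<in>{0..k}. c = of_int (int k - 2 * int j))"
    have "u j = 0" if "j \<in> {0..k}" for j
    proof (rule eigen_sum_component[OF vlinear_sigma _ _ _ u(2) v(2) that])
      show "inj_on (\<lambda>j. of_int (int k - 2 * int j) :: 'f) {0..k}"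
        by (rule inj_onI) (use sigma_eigenvalue_inject assms in auto)
      show "sigma n (u i) = scale (of_int (int k - 2 * int i)) (u i)" if "i \<in> {0..k}" for i
        using bspec[OF u(1) that] Ekj_iff[of i k "u i"] that assms by simp
      show "of_int (int k - 2 * int j) \<noteq> c" using nc that by blast
    qed simp
    then show False using v(3) u(2) by simp
  qed
  then obtain j where "j \<le> k" "U = Skj n k j" unfolding U(2) Skj_def by auto
  then show "U \<in> {Ekj n k j | j. j \<le> k}" using Ekj_eq[of j k] assms by blast
qed

text \<open>That \<open>nu_plus\<close> preserves \<open>Ekj\<close> follows from the decomposition
  into its eigenvectors.\<close>

lemma Ekji_eigenspace:
  assumes "j \<le> k" "k \<le> n" "i \<le> min (k - j) (n - k)"
  shows "is_eigenspace_on (Ekj n k j :: 'f vpoly set) (nu_plus n) (Ekji n k j i)"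
  unfolding is_eigenspace_on_def
proof (intro conjI)
  show "nu_plus n ` Ekj n k j \<subseteq> (Ekj n k j :: 'f vpoly set)"
  proof
    fix q :: "'f vpoly" assume "q \<in> nu_plus n ` Ekj n k j"
    then obtain p where p: "p \<in> Ekj n k j" "q = nu_plus n p" by blast
    obtain u where u: "\<forall>i\<in>{0..min (k - j) (n - k)}. u i \<in> Ekji n k j i" "p = (\<Sum>i\<in>{0..min (k - j) (n - k)}. u i)"
      using Ekj_sum_Ekji[OF assms(1,2) p(1)] by blast
    have "nu_plus n (u i) \<in> Ekj n k j" if "i \<in> {0..min (k - j) (n - k)}" for i
    proof -
      have "u i \<in> Ekj n k j" "nu_plus n (u i) = scale (lam n k j i) (u i)"
        using bspec[OF u(1) that] by (auto simp: Ekji_def' eigenspace_on_def)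
      then show ?thesis by (simp add: vpoly.subspace_scale[OF subspace_Ekj])
    qed
    then show "q \<in> Ekj n k j" unfolding p(2) u(2) op_simps by (rule vpoly.subspace_sum[OF subspace_Ekj])
  qed
  show "(Ekji n k j i :: 'f vpoly set) \<noteq> {0}" by (rule Ekji_nonzero[OF assms])
  show "\<exists>c. Ekji n k j i = eigenspace_on (Ekj n k j :: 'f vpoly set) (nu_plus n) c"
    unfolding Ekji_def by blast
qed

end

theorem theorem1p2:
  fixes n k :: nat
  assumes "CHAR('f::field) > n \<or> CHAR('f) = 0"
    and "n \<ge> 2"
    and "k \<le> n"
  shows "is_direct_sum (M n k :: 'f vpoly set) {0..k} (Ekj n k) \<and>
    (\<forall>j\<le>k. is_direct_sum (Ekj n k j :: 'f vpoly set) {0..min (k - j) (n - k)} (Ekji n k j)) \<and>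
    {Ekj n k j | j. j \<le> k} = {U :: 'f vpoly set. is_eigenspace_on (M n k) (sigma n) U} \<and>
    (\<forall>j\<le>k. \<forall>i\<le>min (k - j) (n - k).
        is_eigenspace_on (Ekj n k j :: 'f vpoly set) (nu_plus n) (Ekji n k j i)) \<and>
    (\<forall>j\<le>k. \<forall>i\<le>min (k - j) (n - k). B_irreducible n (Ekji n k j i :: 'f vpoly set)) \<and>
    (\<forall>j\<le>k. \<forall>i\<le>min (k - j) (n - k). \<forall>j'\<le>k. \<forall>i'\<le>min (k - j') (n - k).
        (j, i) \<noteq> (j', i') \<longrightarrow> \<not> B_isomorphic n (Ekji n k j i :: 'f vpoly set) (Ekji n k j' i')) \<and>
    (\<forall>k'\<le>n. \<forall>j\<le>k. \<forall>i\<le>min (k - j) (n - k). \<forall>j'\<le>k'. \<forall>i'\<le>min (k' - j') (n - k').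
        B_isomorphic n (Ekji n k j i :: 'f vpoly set) (Ekji n k' j' i') \<longleftrightarrow> j = j' \<and> i = i')"
proof -
  interpret large_char n "TYPE('f)" by unfold_locales (use assms in auto)
  show ?thesis
  proof (intro conjI allI impI)
    show "is_direct_sum (M n k :: 'f vpoly set) {0..k} (Ekj n k)" by (rule Ekj_direct_sum[OF assms(3)])
    show "{Ekj n k j | j. j \<le> k} = {U :: 'f vpoly set. is_eigenspace_on (M n k) (sigma n) U}"
      by (rule Ekj_eigenspaces[OF assms(3)])
    show "is_direct_sum (Ekj n k j :: 'f vpoly set) {0..min (k - j) (n - k)} (Ekji n k j)" if "j \<le> k" for j
      by (rule Ekji_direct_sum[OF that assms(3)])
    show "is_eigenspace_on (Ekj n k j :: 'f vpoly set) (nu_plus n) (Ekji n k j i)"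
      "B_irreducible n (Ekji n k j i :: 'f vpoly set)"
      if "j \<le> k" "i \<le> min (k - j) (n - k)" for j i
      using Ekji_eigenspace B_irreducible_Ekji that assms(3) by blast+
    show "\<not> B_isomorphic n (Ekji n k j i :: 'f vpoly set) (Ekji n k j' i')"
      if "j \<le> k" "i \<le> min (k - j) (n - k)" "j' \<le> k" "i' \<le> min (k - j') (n - k)" "(j, i) \<noteq> (j', i')"
      for j i j' i'
      using not_isomorphic_same_k that assms(3) by blast
    show "B_isomorphic n (Ekji n k j i :: 'f vpoly set) (Ekji n k' j' i') \<longleftrightarrow> j = j' \<and> i = i'"
      if "k' \<le> n" "j \<le> k" "i \<le> min (k - j) (n - k)" "j' \<le> k'" "i' \<le> min (k' - j') (n - k')" for k' j i j' i'
      using Ekji_isomorphic_iff that assms(3) by blast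
  qed
qed

end
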